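(* Let $f\in C^2(\mathbb R;\mathbb R)$ satisfy $f''\ge c$ on $\mathbb R$ for some constant $c>0$ and $f(0)=\min_{\mathbb R} f=0$, and let $T>0$. Let $w\in L^\infty(\mathbb R;\mathbb R)$. Then the following statements are equivalent: (a) $I^{CL}_T(w)\neq\emptyset$; (b) a suitable representative of $w$ satisfies: for all $x\in\mathbb R$ and all $y>0$, $$f'(w(x+y))-f'(w(x))\le \frac{y}{T},$$ equivalently, the map $p(x):=x-T f'(w(x))$ satisfies $p(x)\le p(x+y)$ for all $x\in\mathbb R$ and $y>0$.
   Context: A map $u\in L^\infty([0,T]\times\mathbb R;\mathbb R)\cap C^0([0,T];L^1_{loc}(\mathbb R;\mathbb R))$ is a weak entropy solution to $\partial_t u+\partial_x f(u)=0$ if, for every $k\in\mathbb R$ and every nonnegative $\varphi\in C^1_c(]0,T[\times\mathbb R)$, $$\iint\bigl(|u-k|\,\partial_t\varphi+\operatorname{sgn}(u-k)\,(f(u)-f(k))\,\partial_x\varphi\bigr)\,dt\,dx\ge 0.$$ For $u_o\in L^\infty(\mathbb R;\mathbb R)$, $S^{CL}_t u_o$ denotes the value at time $t\in[0,T]$ of the unique weak entropy solution with $u(0,\cdot)=u_o$, and $$I^{CL}_T(w):=\{u_o\in L^\infty(\mathbb R;\mathbb R): S^{CL}_T u_o=w\}$$ (equality a.e.). *)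

theory Defs
  imports "HOL-Analysis.Analysis"
begin

text \<open>
  Elements of \<open>L\<^sup>\<infinity>\<close> and \<open>L\<^sup>1\<close> are represented by Lebesgue measurable functions; equality of
  classes is always written out as equality almost everywhere.
\<close>

definition Linf :: "'a measure \<Rightarrow> ('a \<Rightarrow> real) set" where
  "Linf M = {g \<in> borel_measurable M. \<exists>C. AE z in M. \<bar>g z\<bar> \<le> C}"

definition C2 :: "(real \<Rightarrow> real) \<Rightarrow> bool" where
  "C2 f \<longleftrightarrow> (\<forall>x. f differentiable (at x)) \<and> (\<forall>x. deriv f differentiable (at x))
     \<and> continuous_on UNIV (deriv (deriv f))"

text \<open>Functions in \<open>C\<^sup>1\<^sub>c\<close> of an open set are identified with their extension by zero.\<close>

definition C1c :: "(real \<times> real) set \<Rightarrow> (real \<times> real \<Rightarrow> real) set" where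
  "C1c \<Omega> = {\<phi>.
     (\<exists>\<phi>'. (\<forall>z. (\<phi> has_derivative blinfun_apply (\<phi>' z)) (at z)) \<and> continuous_on UNIV \<phi>') \<and>
     (\<exists>K. compact K \<and> K \<subseteq> \<Omega> \<and> (\<forall>z. z \<notin> K \<longrightarrow> \<phi> z = 0))}"

text \<open>Continuity of \<open>t \<mapsto> u t\<close> on \<open>[0, T]\<close> in the seminorms of \<open>L\<^sup>1\<close> on compact sets.\<close>

definition C0_L1loc :: "real \<Rightarrow> (real \<Rightarrow> real \<Rightarrow> real) set" where
  "C0_L1loc T = {u.
     (\<forall>t\<in>{0..T}. u t \<in> borel_measurable lebesgue \<and> (\<forall>K. compact K \<longrightarrow> set_integrable lebesgue K (u t))) \<and>
     (\<forall>s\<in>{0..T}. \<forall>K. compact K \<longrightarrow>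
        ((\<lambda>t. LINT x:K|lebesgue. \<bar>u t x - u s x\<bar>) \<longlongrightarrow> 0) (at s within {0..T}))}"

definition weak_entropy_solution ::
    "(real \<Rightarrow> real) \<Rightarrow> real \<Rightarrow> (real \<Rightarrow> real \<Rightarrow> real) \<Rightarrow> bool" where
  "weak_entropy_solution f T u \<longleftrightarrow>
     (\<lambda>(t, x). u t x) \<in> Linf (lebesgue_on ({0..T} \<times> UNIV)) \<and>
     u \<in> C0_L1loc T \<and>
     (\<forall>k. \<forall>\<phi>\<in>C1c ({0<..<T} \<times> UNIV). (\<forall>z. 0 \<le> \<phi> z) \<longrightarrow>
        0 \<le> (LINT (t, x)|lebesgue_on ({0..T} \<times> UNIV).
              \<bar>u t x - k\<bar> * deriv (\<lambda>s. \<phi> (s, x)) t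
              + sgn (u t x - k) * (f (u t x) - f k) * deriv (\<lambda>y. \<phi> (t, y)) x))"

definition weak_entropy_solution_from ::
    "(real \<Rightarrow> real) \<Rightarrow> real \<Rightarrow> (real \<Rightarrow> real) \<Rightarrow> (real \<Rightarrow> real \<Rightarrow> real) \<Rightarrow> bool" where
  "weak_entropy_solution_from f T uo u \<longleftrightarrow>
     weak_entropy_solution f T u \<and> (AE x in lebesgue. u 0 x = uo x)"

text \<open>
  \<open>SCL f T t uo v\<close> says that \<open>S\<^sup>C\<^sup>L\<^sub>t uo = v\<close> almost everywhere. Since the solution with datum
  \<open>uo\<close> is unique only almost everywhere, the description ``the value at time \<open>t\<close> of the solution
  with datum \<open>uo\<close>'' is unfolded: a solution exists, and every solution has the value \<open>v\<close> at
  time \<open>t\<close>.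
\<close>

definition SCL ::
    "(real \<Rightarrow> real) \<Rightarrow> real \<Rightarrow> real \<Rightarrow> (real \<Rightarrow> real) \<Rightarrow> (real \<Rightarrow> real) \<Rightarrow> bool" where
  "SCL f T t uo v \<longleftrightarrow>
     (\<exists>u. weak_entropy_solution_from f T uo u) \<and>
     (\<forall>u. weak_entropy_solution_from f T uo u \<longrightarrow> (AE x in lebesgue. u t x = v x))"

definition ICL :: "(real \<Rightarrow> real) \<Rightarrow> real \<Rightarrow> (real \<Rightarrow> real) \<Rightarrow> (real \<Rightarrow> real) set" where
  "ICL f T w = {uo \<in> Linf lebesgue. SCL f T T uo w}"

end

theory Submission imports Defs
begin

text \<open>
  A weak entropy solution has a potential \<open>V\<close> with \<open>V\<^sub>x = u\<close> and \<open>V\<^sub>t = - f u\<close>. Convexity of \<open>f\<close> alone gives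
  \<open>V t x \<le> V 0 y + t * L ((x - y) / t)\<close>, where \<open>L\<close> is the Legendre transform of \<open>f\<close>. For the converse inequality,
  test the entropy inequality for the constant \<open>k\<close> with a decreasing function of
  \<open>V - (k * x - f k * t)\<close> plus a cone-shaped penalty: the leading terms
  \<open>\<bar>u - k\<bar> * (f u - f k)\<close> and \<open>sgn (u - k) * (f u - f k) * (u - k)\<close> cancel, so an affine minorant of \<open>V\<close> on the base
  of a cone of dependence stays one at its tip. Small time steps with tangents of the
  concave function \<open>y \<mapsto> - (T - t) * L ((x - y) / (T - t))\<close> turn this into the Hopf-Lax formula
  \<open>V T x = min\<^sub>y (V 0 y + T * L ((x - y) / T))\<close> for every entropy solution.

  Hence the value at time \<open>T\<close> depends on the initial datum only, and monotonicity of the minimiser in \<open>x\<close>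
  is the one-sided estimate at time \<open>T\<close>. Conversely, if \<open>p x = x - T * deriv f (v x)\<close> is nondecreasing, the straight
  characteristics joining \<open>p x\<close> at time \<open>0\<close> to \<open>x\<close> at time \<open>T\<close> do not cross in between. With shocks and
  rarefactions filled in, they sweep out a solution that is continuous for \<open>0 < t < T\<close> and satisfies the
  entropy condition with equality, as a limit of smooth families of characteristics.
\<close>

section \<open>Smooth kernels and averages\<close>

text \<open>Existence of a solution does not yet give (a): \<open>SCL\<close> requires that every
  solution with the datum has the value \<open>w\<close> at time \<open>T\<close>, so uniqueness
  must be proved along the way. The Hopf-Lax formula serves for this and for the one-sided estimate
  at once. The obstacle is regularity: the potential is only Lipschitz, while a test function must
  be C^1. Averaging in space alone cures this. The averaged potential \<open>Vd\<close> has the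
  derivatives \<open>ud\<close> and \<open>- fd\<close>, averages of \<open>u\<close> and
  \<open>f u\<close>, and these are jointly continuous because \<open>u\<close> is continuous in
  time with values in L^1_loc. The cancellation then holds up to \<open>u - ud\<close> and
  \<open>f u - fd\<close>, which vanish in L^1. Kruzkov's entropy degenerates where
  \<open>u = k\<close>, so a constant \<epsilon> is added to it: the inequality does not notice a
  constant, since the time derivative of a test function has integral 0, but the constant gives a
  strict sign. In the converse direction neither end of a characteristic determines it, as a fan may
  leave one point and a compression may focus in one point. The position at time
  \<open>T / 2\<close> does, and both ends are nondecreasing functions of it.\<close>

lemma integrable_indicator_Icc [simp]: "integrable lborel (indicator {a..b::real} :: real \<Rightarrow> real)"
  by (intro integrable_real_indicator) (auto simp: emeasure_lborel_Icc_eq)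

lemma integrable_bounded_support:
  fixes g :: "real \<Rightarrow> real"
  assumes "g \<in> borel_measurable borel" "\<And>x. \<bar>g x\<bar> \<le> B" "\<And>x. R < \<bar>x\<bar> \<Longrightarrow> g x = 0"
  shows "integrable lborel g"
proof -
  have "integrable lborel (\<lambda>x. B * indicator {-R..R} x :: real)"
    by (intro integrable_mult_right integrable_indicator_Icc)
  moreover have "B \<ge> 0" using assms(2)[of 0] by linarith
  then have "norm (g x) \<le> norm (B * indicator {-R..R} x :: real)" for x
    using assms(2)[of x] assms(3)[of x] by (cases "R < \<bar>x\<bar>") (auto simp: indicator_def)
  then have "AE x in lborel. norm (g x) \<le> norm (B * indicator {-R..R} x :: real)" by (rule AE_I2)
  ultimately show ?thesis
    using Bochner_Integration.integrable_bound[of lborel "\<lambda>x. B * indicator {-R..R} x :: real" g] assms(1)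
    by simp
qed

lemma abs_integral_bounded_support:
  fixes g :: "real \<Rightarrow> real"
  assumes "g \<in> borel_measurable borel" "\<And>x. \<bar>g x\<bar> \<le> B" "\<And>x. x \<notin> {a..b} \<Longrightarrow> g x = 0" "a \<le> b"
  shows "\<bar>\<integral>x. g x \<partial>lborel\<bar> \<le> B * (b - a)"
proof -
  have B: "B \<ge> 0" using assms(2)[of 0] by linarith
  have "g x = 0" if "max \<bar>a\<bar> \<bar>b\<bar> < \<bar>x\<bar>" for x
    using that by (intro assms(3)) auto
  then have "integrable lborel g"
    using assms by (intro integrable_bounded_support[where B = B and R = "max \<bar>a\<bar> \<bar>b\<bar>"]) auto
  moreover have "norm (g x) \<le> B * indicator {a..b} x" for x
    using assms(2)[of x] assms(3)[of x] B by (cases "x \<in> {a..b}") (auto simp: indicator_def)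
  ultimately have "norm (\<integral>x. g x \<partial>lborel) \<le> (\<integral>x. B * indicator {a..b} x \<partial>lborel)"
    by (intro Bochner_Integration.integral_norm_bound_integral integrable_mult_right integrable_indicator_Icc)
  then show ?thesis using assms(4) by simp
qed

lemma integral_tendsto_bounded_support:
  fixes g :: "nat \<Rightarrow> real \<Rightarrow> real"
  assumes "\<And>n. g n \<in> borel_measurable borel" "h \<in> borel_measurable borel"
    "\<And>n x. \<bar>g n x\<bar> \<le> B" "\<And>n x. R < \<bar>x\<bar> \<Longrightarrow> g n x = 0"
    "AE x in lborel. (\<lambda>n. g n x) \<longlonglongrightarrow> h x"
  shows "(\<lambda>n. \<integral>x. g n x \<partial>lborel) \<longlonglongrightarrow> (\<integral>x. h x \<partial>lborel)"
proof (rule integral_dominated_convergence[where w = "\<lambda>x. B * indicator {-R..R} x"])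
  have "B \<ge> 0" using assms(3)[of 0 0] by linarith
  then show "AE x in lborel. norm (g n x) \<le> B * indicator {- R..R} x" for n
    using assms(3)[of n] assms(4)[of _ n]
    by (intro AE_I2) (auto simp: indicator_def abs_le_iff not_less[symmetric])
qed (use assms in \<open>auto intro!: integrable_mult_right integrable_indicator_Icc\<close>)

definition clamp01 :: "real \<Rightarrow> real" where "clamp01 z = max 0 (min 1 z)"

text \<open>The cubic \<open>3 z^2 - 2 z^3\<close> between 0 and 1, continued by constants: a simple
  cutoff that is C^1, which is all that \<open>C1c\<close> asks of a test function.
  \<open>bump\<close> is its derivative.\<close>

definition step :: "real \<Rightarrow> real" where "step z = (clamp01 z)\<^sup>2 * (3 - 2 * clamp01 z)"

definition bump :: "real \<Rightarrow> real" where "bump z = 6 * clamp01 z * (1 - clamp01 z)"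

lemma continuous_clamp01 [continuous_intros]:
  "continuous_on S g \<Longrightarrow> continuous_on S (\<lambda>x. clamp01 (g x))"
  unfolding clamp01_def by (intro continuous_intros)

lemma continuous_bump [continuous_intros]:
  "continuous_on S g \<Longrightarrow> continuous_on S (\<lambda>x. bump (g x))"
  unfolding bump_def by (intro continuous_intros)

lemma continuous_step [continuous_intros]:
  "continuous_on S g \<Longrightarrow> continuous_on S (\<lambda>x. step (g x))"
  unfolding step_def by (intro continuous_intros)

lemma clamp01_range: "0 \<le> clamp01 z" "clamp01 z \<le> 1"
  by (auto simp: clamp01_def)

lemma bump_nonneg: "0 \<le> bump z"
  unfolding bump_def using clamp01_range by simp

lemma bump_le: "bump z \<le> 2"
proof -
  have "0 \<le> 6 * (clamp01 z - 1/2)\<^sup>2" by simp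
  then show ?thesis unfolding bump_def by (simp add: power2_eq_square algebra_simps)
qed

lemma bump_eq_0: "z \<notin> {0..1} \<Longrightarrow> bump z = 0"
  by (auto simp: bump_def clamp01_def)

lemma step_eq_0: "z \<le> 0 \<Longrightarrow> step z = 0"
  by (auto simp: step_def clamp01_def)

lemma step_eq_1: "1 \<le> z \<Longrightarrow> step z = 1"
  by (auto simp: step_def clamp01_def)

text \<open>Away from 0 and 1 the three branches are differentiated on open sets. At the two seams
  \<open>step\<close> leaves its constant value at most quadratically, so the difference quotient
  there tends to 0.\<close>

lemma step_has_derivative: "(step has_real_derivative bump z) (at z)"
proof -
  have 1: "((\<lambda>z. z\<^sup>2 * (3 - 2 * z)) has_real_derivative 6 * z * (1 - z)) (at z within S)" for z S
    by (auto intro!: derivative_eq_intros simp: power2_eq_square algebra_simps)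
  have pc: "((\<lambda>z. if z \<in> {..0} then 0 else if z \<in> {0..1} then z\<^sup>2 * (3 - 2 * z) else 1)
      has_real_derivative bump z) (at z)"
    if "z \<noteq> 0" "z \<noteq> 1"
  proof -
    consider "z < 0" | "0 < z" "z < 1" | "1 < z" using \<open>z \<noteq> 0\<close> \<open>z \<noteq> 1\<close> by linarith
    then show ?thesis
    proof cases
      case 1
      have "((\<lambda>z. if z \<in> {..0} then 0 else if z \<in> {0..1} then z\<^sup>2 * (3 - 2 * z) else 1) has_real_derivative 0) (at z)"
        by (rule has_field_derivative_transform_within_open[of "\<lambda>_. 0" 0 z "{..<0}"]) (use 1 in auto)
      moreover have "bump z = 0" using 1 by (simp add: bump_eq_0)
      ultimately show ?thesis by simp
    next
      case 2
      have "((\<lambda>z. if z \<in> {..0} then 0 else if z \<in> {0..1} then z\<^sup>2 * (3 - 2 * z) else 1) has_real_derivative 6 * z * (1 - z)) (at z)"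
        by (rule has_field_derivative_transform_within_open[OF 1, of "{0<..<1}"]) (use 2 in auto)
      moreover have "bump z = 6 * z * (1 - z)" using 2 by (simp add: bump_def clamp01_def)
      ultimately show ?thesis by simp
    next
      case 3
      have "((\<lambda>z. if z \<in> {..0} then 0 else if z \<in> {0..1} then z\<^sup>2 * (3 - 2 * z) else 1) has_real_derivative 0) (at z)"
        by (rule has_field_derivative_transform_within_open[of "\<lambda>_. 1" 0 z "{1<..}"]) (use 3 in auto)
      moreover have "bump z = 0" using 3 by (simp add: bump_eq_0)
      ultimately show ?thesis by simp
    qed
  qed
  have eq: "step = (\<lambda>z. if z \<in> {..0} then 0 else if z \<in> {0..1} then z\<^sup>2 * (3 - 2 * z) else 1)"
    by (auto simp: step_def clamp01_def fun_eq_iff)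
  consider "z = 0" | "z = 1" | "z \<noteq> 0" "z \<noteq> 1" by blast
  then show ?thesis
  proof cases
    case 1
    have q: "\<bar>step h\<bar> \<le> 3 * h\<^sup>2" for h
    proof (cases "h \<le> 0")
      case False
      then have "step h = (min 1 h)\<^sup>2 * (3 - 2 * min 1 h)" by (simp add: step_def clamp01_def)
      moreover have "(min 1 h)\<^sup>2 \<le> h\<^sup>2" using False by (intro power_mono) auto
      moreover have "(min 1 h)\<^sup>2 * (3 - 2 * min 1 h) \<le> (min 1 h)\<^sup>2 * 3" "0 \<le> (min 1 h)\<^sup>2 * (3 - 2 * min 1 h)"
        using False by (intro mult_left_mono mult_nonneg_nonneg; simp)+
      ultimately show ?thesis by linarith
    qed (simp add: step_eq_0)
    have "((\<lambda>h. (step h - step 0) / (h - 0)) \<longlongrightarrow> 0) (at 0)"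
    proof (rule Lim_null_comparison)
      show "\<forall>\<^sub>F h in at 0. norm ((step h - step 0) / (h - 0)) \<le> 3 * \<bar>h\<bar>"
      proof (rule always_eventually, intro allI)
        fix h :: real
        have "\<bar>step h - step 0\<bar> \<le> 3 * \<bar>h - 0\<bar> * \<bar>h - 0\<bar>"
          using q[of h] by (simp add: step_eq_0 power2_eq_square abs_mult)
        then show "norm ((step h - step 0) / (h - 0)) \<le> 3 * \<bar>h\<bar>"
          by (cases "h = 0") (auto simp: divide_le_eq)
      qed
    qed (auto intro!: tendsto_eq_intros)
    then show ?thesis using 1 unfolding has_field_derivative_iff
      by (simp add: step_eq_0 bump_def clamp01_def)
  next
    case 2
    have q: "\<bar>step h - 1\<bar> \<le> 3 * (h - 1)\<^sup>2" for h
    proof (cases "h \<ge> 1")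
      case False
      then have "step h - 1 = - ((1 - max 0 h)\<^sup>2 * (1 + 2 * max 0 h))"
        by (simp add: step_def clamp01_def power2_eq_square algebra_simps max_def)
      moreover have "(1 - max 0 h)\<^sup>2 \<le> (1 - h)\<^sup>2" using False by (intro power_mono) auto
      moreover have "(1 - max 0 h)\<^sup>2 * (1 + 2 * max 0 h) \<le> (1 - max 0 h)\<^sup>2 * 3" "0 \<le> (1 - max 0 h)\<^sup>2 * (1 + 2 * max 0 h)"
        using False by (intro mult_left_mono mult_nonneg_nonneg; simp)+
      moreover have "(1 - h)\<^sup>2 = (h - 1)\<^sup>2" by (rule power2_commute)
      ultimately show ?thesis by linarith
    qed (simp add: step_eq_1)
    have "((\<lambda>h. (step h - step 1) / (h - 1)) \<longlongrightarrow> 0) (at 1)"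
    proof (rule Lim_null_comparison)
      show "\<forall>\<^sub>F h in at 1. norm ((step h - step 1) / (h - 1)) \<le> 3 * \<bar>h - 1\<bar>"
      proof (rule always_eventually, intro allI)
        fix h :: real
        have "\<bar>step h - step 1\<bar> \<le> 3 * \<bar>h - 1\<bar> * \<bar>h - 1\<bar>"
          using q[of h] by (simp add: step_eq_1 power2_eq_square abs_mult)
        then show "norm ((step h - step 1) / (h - 1)) \<le> 3 * \<bar>h - 1\<bar>"
          by (cases "h = 1") (auto simp: divide_le_eq)
      qed
    qed (auto intro!: tendsto_eq_intros)
    then show ?thesis using 2 unfolding has_field_derivative_iff
      by (simp add: step_eq_1 bump_def clamp01_def)
  next
    case 3
    then show ?thesis using pc unfolding eq by simp
  qed
qed

lemma step_mono: "x \<le> y \<Longrightarrow> step x \<le> step y"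
  using DERIV_nonneg_imp_nondecreasing[of x y step] step_has_derivative bump_nonneg by blast

lemma step_range: "0 \<le> step z" "step z \<le> 1"
  using step_mono[of "min 0 z" z] step_mono[of z "max 1 z"] by (simp_all add: step_eq_0 step_eq_1)

lemma step_DERIV [derivative_intros]:
  "(g has_real_derivative g') (at x within S) \<Longrightarrow>
    ((\<lambda>x. step (g x)) has_real_derivative bump (g x) * g') (at x within S)"
  using DERIV_chain2[OF step_has_derivative] .

text \<open>The derivative of \<open>step (z / d)\<close> in \<open>z\<close>. It is one-sided: an
  average with weight \<open>kern d (x - y)\<close> over \<open>y\<close> looks only to the left of
  \<open>x\<close>, and as the derivative of a time cutoff it has its mass just after the given
  time.\<close>

definition kern :: "real \<Rightarrow> real \<Rightarrow> real" where "kern d z = bump (z / d) / d"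

lemma kern_nonneg: "0 < d \<Longrightarrow> 0 \<le> kern d z"
  by (simp add: kern_def bump_nonneg)

lemma kern_le: "0 < d \<Longrightarrow> kern d z \<le> 2 / d"
  by (simp add: kern_def bump_le divide_right_mono)

lemma kern_eq_0: "0 < d \<Longrightarrow> z \<notin> {0..d} \<Longrightarrow> kern d z = 0"
  unfolding kern_def by (subst bump_eq_0) (auto simp: zero_le_divide_iff divide_le_eq)

lemma continuous_kern [continuous_intros]:
  "0 < d \<Longrightarrow> continuous_on S g \<Longrightarrow> continuous_on S (\<lambda>x. kern d (g x))"
  unfolding kern_def by (intro continuous_intros) auto

lemma measurable_kern [measurable]:
  "0 < d \<Longrightarrow> kern d \<in> borel_measurable borel"
  by (intro borel_measurable_continuous_onI continuous_intros) auto

lemma measurable_bump [measurable]: "bump \<in> borel_measurable borel"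
  by (intro borel_measurable_continuous_onI continuous_intros)

lemma measurable_step [measurable]: "step \<in> borel_measurable borel"
  by (intro borel_measurable_continuous_onI continuous_intros)

lemma integral_kern:
  assumes "0 < d" shows "(\<integral>y. kern d (x - y) \<partial>lborel) = 1"
proof -
  have "(\<integral>y. indicator {x-d..x} y *\<^sub>R kern d (x - y) \<partial>lborel) = - step ((x - x)/d) - (- step ((x - (x-d))/d))"
  proof (rule integral_FTC_atLeastAtMost)
    fix y
    have "((\<lambda>y. - step ((x - y) / d)) has_real_derivative kern d (x - y)) (at y within {x-d..x})"
      using assms unfolding kern_def by (auto intro!: derivative_eq_intros)
    then show "((\<lambda>y. - step ((x - y) / d)) has_vector_derivative kern d (x - y)) (at y within {x-d..x})"
      by (simp add: has_real_derivative_iff_has_vector_derivative)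
  qed (use assms in \<open>auto intro!: continuous_intros\<close>)
  also have "\<dots> = 1" using assms by (simp add: step_eq_0 step_eq_1)
  also have "(\<lambda>y. indicator {x-d..x} y *\<^sub>R kern d (x - y)) = (\<lambda>y. kern d (x - y))"
    using kern_eq_0[OF assms] by (force simp: fun_eq_iff indicator_def)
  finally show ?thesis .
qed

text \<open>Difference quotients of a primitive are averages too, with the discontinuous kernel
  \<open>indicator {0..d} z / d\<close>; hence only measurability is required.\<close>

locale mollifier =
  fixes K :: "real \<Rightarrow> real" and d :: real
  assumes K_meas [measurable]: "K \<in> borel_measurable borel"
    and K_nonneg: "0 \<le> K z" and K_bdd: "K z \<le> 2 / d" and K_supp: "z \<notin> {0..d} \<Longrightarrow> K z = 0"
    and K_int: "(\<integral>y. K (x - y) \<partial>lborel) = 1" and d_pos: "0 < d"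
begin

lemma K_int': "(\<integral>x. K (x - y) \<partial>lborel) = 1"
proof -
  have "(\<integral>x. K (x - y) \<partial>lborel) = (\<integral>x. K (0 + 1 * x) \<partial>lborel)"
    using lborel_integral_real_affine[of 1 "\<lambda>x. K (x - y)" y] by simp
  also have "\<dots> = (\<integral>x. K (0 - x) \<partial>lborel)"
    using lborel_integral_real_affine[of "-1" K 0] by simp
  finally show ?thesis using K_int[of 0] by simp
qed

lemma integrable_K: "integrable lborel (\<lambda>y. K (x - y))" "integrable lborel (\<lambda>x. K (x - y))"
  using K_int[of x] K_int'[of y] not_integrable_integral_eq by fastforce+

lemma integrable_mult_K:
  assumes [measurable]: "h \<in> borel_measurable borel" and "\<And>x. \<bar>h x\<bar> \<le> M"
  shows "integrable lborel (\<lambda>y. h y * K (x - y))"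
proof (rule Bochner_Integration.integrable_bound[of lborel "\<lambda>y. M * K (x - y)"])
  show "AE y in lborel. norm (h y * K (x - y)) \<le> norm (M * K (x - y))"
    using assms(2) K_nonneg by (auto simp: abs_mult intro!: mult_right_mono AE_I2) (meson abs_ge_self order_trans)
qed (use integrable_K in auto)

lemma K_le_indicator: "x \<in> {-R..R} \<Longrightarrow> d \<le> 1 \<Longrightarrow> K (x - y) = K (x - y) * indicator {-R-1..R} y"
  using K_supp[of "x - y"] by (cases "x - y \<in> {0..d}") (auto simp: indicator_def)

lemma mollify_abs_le:
  assumes [measurable]: "h \<in> borel_measurable borel" and b: "\<And>x. \<bar>h x\<bar> \<le> M"
  shows "\<bar>\<integral>y. h y * K (x - y) \<partial>lborel\<bar> \<le> M"
proof -
  have "norm (\<integral>y. h y * K (x - y) \<partial>lborel) \<le> (\<integral>y. M * K (x - y) \<partial>lborel)"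
    using b K_nonneg integrable_K integrable_mult_K[OF assms]
    by (intro Bochner_Integration.integral_norm_bound_integral) (auto simp: abs_mult intro!: mult_right_mono)
  then show ?thesis using K_int by simp
qed

text \<open>By Fubini each \<open>y\<close> is charged with total mass at most 1. The window grows
  to the left only, by one unit, since \<open>K\<close> looks back by at most
  \<open>d \<le> 1\<close>.\<close>

lemma integral_mollify_le:
  assumes [measurable]: "h \<in> borel_measurable borel" and b: "\<And>x. \<bar>h x\<bar> \<le> M" and "d \<le> 1" "0 \<le> R"
  shows "(\<integral>x. indicator {-R..R} x * \<bar>\<integral>y. h y * K (x - y) \<partial>lborel\<bar> \<partial>lborel)
      \<le> (\<integral>y. indicator {-R-1..R} y * \<bar>h y\<bar> \<partial>lborel)"
proof -
  have M: "0 \<le> M" using b[of 0] by linarith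
  have int1: "integrable lborel (\<lambda>y. indicator {-R-1..R} y * \<bar>h y\<bar>)"
    using b M by (intro integrable_bounded_support[where B = M and R = "R + 1"]) (auto simp: indicator_def)
  let ?F = "\<lambda>(x, y). indicator {-R..R} x * (indicator {-R-1..R} y * \<bar>h y\<bar> * K (x - y))"
  have intF: "integrable (lborel \<Otimes>\<^sub>M lborel) ?F"
  proof (rule Bochner_Integration.integrable_bound)
    show "integrable (lborel \<Otimes>\<^sub>M lborel) (\<lambda>z. M * (2/d) * indicator ({-R..R} \<times> {-R-1..R}) z :: real)"
      by (intro integrable_mult_right integrable_real_indicator)
        (auto simp: lborel.emeasure_pair_measure_Times ennreal_mult_less_top emeasure_lborel_Icc_eq)
    show "AE z in lborel \<Otimes>\<^sub>M lborel. norm (?F z) \<le> norm (M * (2 / d) * indicator ({- R..R} \<times> {- R - 1..R}) z :: real)"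
    proof (rule AE_I2)
      fix z :: "real \<times> real"
      show "norm (?F z) \<le> norm (M * (2 / d) * indicator ({- R..R} \<times> {- R - 1..R}) z :: real)"
        using mult_mono[OF b[of "snd z"] K_bdd[of "fst z - snd z"] M] K_nonneg[of "fst z - snd z"] M d_pos
        by (cases z) (auto simp: indicator_def abs_mult)
    qed
  qed measurable
  have "(\<integral>x. indicator {-R..R} x * \<bar>\<integral>y. h y * K (x - y) \<partial>lborel\<bar> \<partial>lborel)
     \<le> (\<integral>x. (\<integral>y. ?F (x, y) \<partial>lborel) \<partial>lborel)"
  proof (rule integral_mono)
    show "integrable lborel (\<lambda>x. \<integral>y. ?F (x, y) \<partial>lborel)"
      using lborel_pair.integrable_fst'[OF intF] .
    show "integrable lborel (\<lambda>x. indicator {-R..R} x * \<bar>\<integral>y. h y * K (x - y) \<partial>lborel\<bar>)"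
      using mollify_abs_le[OF assms(1) b]
      by (intro integrable_bounded_support[where B = M and R = R]) (auto simp: indicator_def M)
    fix x
    show "indicator {-R..R} x * \<bar>\<integral>y. h y * K (x - y) \<partial>lborel\<bar> \<le> (\<integral>y. ?F (x, y) \<partial>lborel)"
    proof (cases "x \<in> {-R..R}")
      case True
      have "norm (\<integral>y. h y * K (x - y) \<partial>lborel) \<le> (\<integral>y. norm (h y * K (x - y)) \<partial>lborel)"
        by (rule integral_norm_bound)
      also have "(\<lambda>y. norm (h y * K (x - y))) = (\<lambda>y. indicator {-R-1..R} y * \<bar>h y\<bar> * K (x - y))"
        using K_le_indicator[OF True \<open>d \<le> 1\<close>] K_nonneg by (auto simp: fun_eq_iff abs_mult mult_ac)
      finally show ?thesis using True by simp
    qed auto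
  qed
  also have "\<dots> = (\<integral>y. (\<integral>x. ?F (x, y) \<partial>lborel) \<partial>lborel)"
    using lborel_pair.Fubini_integral[of "\<lambda>x y. ?F (x, y)"] intF by simp
  also have "\<dots> \<le> (\<integral>y. indicator {-R-1..R} y * \<bar>h y\<bar> \<partial>lborel)"
  proof (rule integral_mono)
    show "integrable lborel (\<lambda>y. \<integral>x. ?F (x, y) \<partial>lborel)"
      using lborel_pair.integrable_snd[of "\<lambda>x y. ?F (x, y)"] intF by simp
    fix y
    have "(\<integral>x. ?F (x, y) \<partial>lborel) \<le> (\<integral>x. indicator {-R-1..R} y * \<bar>h y\<bar> * K (x - y) \<partial>lborel)"
    proof (rule integral_mono')
      show "integrable lborel (\<lambda>x. indicator {-R-1..R} y * \<bar>h y\<bar> * K (x - y))"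
        using integrable_K by simp
    qed (use K_nonneg in \<open>auto simp: indicator_def\<close>)
    then show "(\<integral>x. ?F (x, y) \<partial>lborel) \<le> indicator {-R-1..R} y * \<bar>h y\<bar>"
      using K_int' by simp
  qed (rule int1)
  finally show ?thesis .
qed

end

lemma mollifier_kern: "0 < d \<Longrightarrow> mollifier (kern d) d"
  by unfold_locales (auto simp: kern_nonneg kern_le kern_eq_0 integral_kern)

text \<open>\<open>measurable_on\<close> supplies continuous functions that converge to
  \<open>h\<close> off a negligible set; cutting them off at \<open>M\<close> makes dominated
  convergence applicable on the window.\<close>

lemma L1_continuous_approximation:
  fixes h :: "real \<Rightarrow> real"
  assumes [measurable]: "h \<in> borel_measurable borel" and b: "\<And>x. \<bar>h x\<bar> \<le> M" and "0 < e"
  obtains g where "continuous_on UNIV g" "\<And>x. \<bar>g x\<bar> \<le> M"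
    "(\<integral>x. indicator {-R..R} x * \<bar>h x - g x\<bar> \<partial>lborel) < e"
proof -
  have M: "0 \<le> M" using b[of 0] by linarith
  have "h measurable_on UNIV"
    by (intro lebesgue_measurable_imp_measurable_on_real measurable_completion) auto
  then obtain N g where N: "negligible N" and g: "\<And>n. continuous_on UNIV (g n)"
    and lim: "\<And>x. x \<notin> N \<Longrightarrow> (\<lambda>n. g n x) \<longlonglongrightarrow> h x"
    unfolding measurable_on_def by auto
  have [measurable]: "g n \<in> borel_measurable borel" for n
    using g by (rule borel_measurable_continuous_onI)
  define G where "G n x = max (-M) (min M (g n x))" for n x
  have "AE x in lborel. x \<notin> N"
    using N by (metis AE_not_in AE_completion_iff negligible_iff_null_sets)
  then have "AE x in lborel. (\<lambda>n. indicator {-R..R} x * \<bar>h x - G n x\<bar>) \<longlonglongrightarrow> 0"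
  proof eventually_elim
    case (elim x)
    have "(\<lambda>n. G n x) \<longlonglongrightarrow> max (-M) (min M (h x))"
      unfolding G_def by (intro tendsto_intros lim elim)
    then have "(\<lambda>n. indicator {-R..R} x * \<bar>h x - G n x\<bar>) \<longlonglongrightarrow> indicator {-R..R} x * \<bar>h x - max (-M) (min M (h x))\<bar>"
      by (intro tendsto_intros)
    moreover have "max (-M) (min M (h x)) = h x" using b[of x] by (simp add: abs_le_iff max_def)
    ultimately show ?case by simp
  qed
  note ae = this
  have "(\<lambda>n. \<integral>x. indicator {-R..R} x * \<bar>h x - G n x\<bar> \<partial>lborel) \<longlonglongrightarrow> (\<integral>x. (0::real) \<partial>(lborel :: real measure))"
  proof (rule integral_tendsto_bounded_support[where g = "\<lambda>n x. indicator {-R..R} x * \<bar>h x - G n x\<bar>"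
        and h = "\<lambda>_. 0" and B = "2 * M" and R = R])
    fix n x
    have "\<bar>G n x\<bar> \<le> M" using M by (auto simp: G_def)
    then show "\<bar>indicator {-R..R} x * \<bar>h x - G n x\<bar>\<bar> \<le> 2 * M"
      using b[of x] M by (auto simp: indicator_def)
  qed (use ae in \<open>auto simp: G_def indicator_def\<close>)
  then have "\<forall>\<^sub>F n in sequentially. (\<integral>x. indicator {-R..R} x * \<bar>h x - G n x\<bar> \<partial>lborel) < e"
    using \<open>0 < e\<close> by (intro order_tendstoD) auto
  then obtain n where "(\<integral>x. indicator {-R..R} x * \<bar>h x - G n x\<bar> \<partial>lborel) < e"
    by (auto simp: eventually_sequentially)
  moreover have "continuous_on UNIV (G n)"
    unfolding G_def by (intro continuous_intros g)
  moreover have "\<bar>G n x\<bar> \<le> M" for x using M by (auto simp: G_def)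
  ultimately show ?thesis using that by blast
qed

text \<open>For a continuous \<open>g\<close> close to \<open>h\<close> in L^1 the error splits into
  \<open>h - g\<close>, \<open>g\<close> minus its average, and the average of \<open>h - g\<close>.
  Uniform continuity controls the second part, and \<open>integral_mollify_le\<close> reduces the
  third to the first.\<close>

lemma mollify_tendsto_L1:
  fixes h :: "real \<Rightarrow> real"
  assumes [measurable]: "h \<in> borel_measurable borel" and b: "\<And>x. \<bar>h x\<bar> \<le> M" and "0 \<le> R"
    and K: "\<And>n. mollifier (K n) (d n)" and d0: "d \<longlonglongrightarrow> 0"
  shows "(\<lambda>n. \<integral>x. indicator {-R..R} x * \<bar>h x - (\<integral>y. h y * K n (x - y) \<partial>lborel)\<bar> \<partial>lborel) \<longlonglongrightarrow> 0"
proof (rule tendsto_0_le[where K = 1], rule LIMSEQ_I)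
  fix e :: real assume "0 < e"
  have M: "0 \<le> M" using b[of 0] by linarith
  have [measurable]: "K n \<in> borel_measurable borel" for n
    using K by (rule mollifier.K_meas)
  obtain g where g: "continuous_on UNIV g" "\<And>x. \<bar>g x\<bar> \<le> M"
    "(\<integral>x. indicator {-(R+1)..R+1} x * \<bar>h x - g x\<bar> \<partial>lborel) < e / 4"
    using L1_continuous_approximation[OF assms(1) b, of "e/4" "R+1"] \<open>0 < e\<close> by auto
  have [measurable]: "g \<in> borel_measurable borel"
    using g(1) by (rule borel_measurable_continuous_onI)
  \<comment> \<open>Chosen so that the window of length \<open>2 * R\<close> contributes at most
    \<open>e / 4\<close>; the two L^1 terms contribute less than \<open>e / 4\<close> each.\<close>
  define e' where "e' = e / (8 * (R + 1))"
  have "0 < e'" using \<open>0 < e\<close> \<open>0 \<le> R\<close> by (simp add: e'_def)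
  have "uniformly_continuous_on {-R-1..R} g"
    by (intro compact_uniformly_continuous continuous_on_subset[OF g(1)]) auto
  then obtain \<delta> where \<delta>: "\<delta> > 0" "\<And>x y. x \<in> {-R-1..R} \<Longrightarrow> y \<in> {-R-1..R} \<Longrightarrow> dist y x < \<delta> \<Longrightarrow> dist (g y) (g x) < e'"
    using \<open>0 < e'\<close> unfolding uniformly_continuous_on_def by metis
  have "\<forall>\<^sub>F n in sequentially. d n < min 1 \<delta>"
    using d0 \<delta>(1) by (intro order_tendstoD) auto
  then obtain n0 where n0: "\<And>n. n \<ge> n0 \<Longrightarrow> d n < min 1 \<delta>"
    by (auto simp: eventually_sequentially)
  have "(\<integral>x. indicator {-R..R} x * \<bar>h x - (\<integral>y. h y * K n (x - y) \<partial>lborel)\<bar> \<partial>lborel) < e" (is "?I n < e") if "n \<ge> n0" for n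
  proof -
    interpret mollifier "K n" "d n" by (rule K)
    let ?I = "indicator {-R..R} :: real \<Rightarrow> real"
    have dn: "d n < 1" "d n < \<delta>" using n0[OF that] by auto
    define mh where "mh x = (\<integral>y. h y * K n (x - y) \<partial>lborel)" for x
    define mg where "mg x = (\<integral>y. g y * K n (x - y) \<partial>lborel)" for x
    define mf where "mf x = (\<integral>y. (h y - g y) * K n (x - y) \<partial>lborel)" for x
    have [measurable]: "mh \<in> borel_measurable borel" "mg \<in> borel_measurable borel" "mf \<in> borel_measurable borel"
      unfolding mh_def mg_def mf_def by measurable
    have hg: "\<bar>h x - g x\<bar> \<le> 2 * M" for x using b[of x] g(2)[of x] by linarith
    have mfeq: "mf x = mh x - mg x" for x
      unfolding mf_def mh_def mg_def left_diff_distrib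
      by (intro Bochner_Integration.integral_diff integrable_mult_K[OF _ b] integrable_mult_K[OF _ g(2)]) auto
    have mh: "\<bar>mh x\<bar> \<le> M" and mg: "\<bar>mg x\<bar> \<le> M" and mf: "\<bar>mf x\<bar> \<le> 2 * M" for x
      unfolding mh_def mg_def mf_def
      by (intro mollify_abs_le b g(2) hg; simp)+
    have 2: "\<bar>g x - mg x\<bar> \<le> e'" if x: "x \<in> {-R..R}" for x
    proof -
      have "g x - mg x = (\<integral>y. g x * K n (x - y) \<partial>lborel) - mg x"
        using K_int by simp
      also have "\<dots> = (\<integral>y. g x * K n (x - y) - g y * K n (x - y) \<partial>lborel)"
        unfolding mg_def using integrable_K
        by (intro Bochner_Integration.integral_diff[symmetric] integrable_mult_K[OF _ g(2)]) auto
      also have "norm \<dots> \<le> (\<integral>y. e' * K n (x - y) \<partial>lborel)"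
      proof (rule Bochner_Integration.integral_norm_bound_integral)
        show "integrable lborel (\<lambda>y. g x * K n (x - y) - g y * K n (x - y))"
          using integrable_K by (intro Bochner_Integration.integrable_diff integrable_mult_K[OF _ g(2)]) auto
        show "integrable lborel (\<lambda>y. e' * K n (x - y))" using integrable_K by simp
        fix y
        show "norm (g x * K n (x - y) - g y * K n (x - y)) \<le> e' * K n (x - y)"
        proof (cases "x - y \<in> {0..d n}")
          case True
          then have "dist (g y) (g x) < e'" using x dn by (intro \<delta>(2)) (auto simp: dist_real_def)
          then have "\<bar>g x - g y\<bar> * K n (x - y) \<le> e' * K n (x - y)"
            using K_nonneg by (intro mult_right_mono) (auto simp: dist_real_def)
          then show ?thesis using K_nonneg[of "x - y"] by (simp add: abs_mult flip: left_diff_distrib)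
        qed (simp add: K_supp)
      qed
      finally show ?thesis using K_int by simp
    qed
    have i1: "integrable lborel (\<lambda>x. ?I x * \<bar>h x - g x\<bar>)" "integrable lborel (\<lambda>x. ?I x * \<bar>mf x\<bar>)"
        "integrable lborel (\<lambda>x. ?I x * \<bar>h x - mh x\<bar>)"
        "integrable lborel (\<lambda>x. indicator {-R-1..R} x * \<bar>h x - g x\<bar>)"
        "integrable lborel (\<lambda>x. indicator {-(R+1)..R+1} x * \<bar>h x - g x\<bar>)"
    proof -
      have *: "\<bar>h x - mh x\<bar> \<le> 2 * M" for x using b[of x] mh[of x] by linarith
      show "integrable lborel (\<lambda>x. ?I x * \<bar>h x - g x\<bar>)" "integrable lborel (\<lambda>x. ?I x * \<bar>mf x\<bar>)"
        "integrable lborel (\<lambda>x. ?I x * \<bar>h x - mh x\<bar>)"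
        "integrable lborel (\<lambda>x. indicator {-R-1..R} x * \<bar>h x - g x\<bar>)"
        "integrable lborel (\<lambda>x. indicator {-(R+1)..R+1} x * \<bar>h x - g x\<bar>)"
        using M hg mf * by (intro integrable_bounded_support[where B = "2*M" and R = "R+1"]; auto simp: indicator_def)+
    qed
    have "?I x * \<bar>h x - mh x\<bar> \<le> ?I x * \<bar>h x - g x\<bar> + (e' * ?I x + ?I x * \<bar>mf x\<bar>)" for x
      using 2[of x] mfeq[of x] by (auto simp: indicator_def)
    then have "(\<integral>x. ?I x * \<bar>h x - mh x\<bar> \<partial>lborel) \<le> (\<integral>x. ?I x * \<bar>h x - g x\<bar> + (e' * ?I x + ?I x * \<bar>mf x\<bar>) \<partial>lborel)"
      using i1 by (intro integral_mono) auto
    also have "\<dots> = (\<integral>x. ?I x * \<bar>h x - g x\<bar> \<partial>lborel) + (e' * (2 * R) + (\<integral>x. ?I x * \<bar>mf x\<bar> \<partial>lborel))"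
      using i1 \<open>0 \<le> R\<close> by simp
    also have "(\<integral>x. ?I x * \<bar>mf x\<bar> \<partial>lborel) \<le> (\<integral>x. indicator {-R-1..R} x * \<bar>h x - g x\<bar> \<partial>lborel)"
      unfolding mf_def using dn \<open>0 \<le> R\<close> by (intro integral_mollify_le[OF _ hg]) auto
    also have "\<dots> \<le> (\<integral>x. indicator {-(R+1)..R+1} x * \<bar>h x - g x\<bar> \<partial>lborel)"
      using i1 \<open>0 \<le> R\<close> by (intro integral_mono) (auto simp: indicator_def)
    also have "(\<integral>x. ?I x * \<bar>h x - g x\<bar> \<partial>lborel) \<le> (\<integral>x. indicator {-(R+1)..R+1} x * \<bar>h x - g x\<bar> \<partial>lborel)"
      using i1 \<open>0 \<le> R\<close> by (intro integral_mono) (auto simp: indicator_def)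
    also have "e' * (2 * R) \<le> e / 4"
      using \<open>0 \<le> R\<close> \<open>0 < e\<close> by (simp add: e'_def field_simps)
    finally show ?thesis using g(3) \<open>0 < e\<close> unfolding mh_def by linarith
  qed
  moreover have "0 \<le> ?I n" for n by (intro integral_nonneg_AE AE_I2) auto
  ultimately show "\<exists>no. \<forall>n\<ge>no. norm (?I n - 0) < e" by (intro exI[of _ n0]) auto
qed auto

section \<open>Test functions\<close>

lemma mollifier_box:
  assumes "0 < d" shows "mollifier (\<lambda>z. indicator {0..d} z / d) d"
proof
  fix x :: real
  have "(\<integral>y. indicator {0..d} (x - y) / d \<partial>lborel) = (\<integral>y. indicator {x-d..x} y / d \<partial>lborel)"
    by (intro Bochner_Integration.integral_cong) (auto simp: indicator_def)
  then show "(\<integral>y. indicator {0..d} (x - y) / d \<partial>lborel) = 1" using assms by simp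
qed (use assms in \<open>auto simp: indicator_def divide_right_mono\<close>)

text \<open>The backward difference quotients of \<open>V\<close> are averages of \<open>w\<close>
  for the box kernel, hence converge to \<open>w\<close> in L^1 on compact sets; by hypothesis they
  converge to \<open>v\<close> almost everywhere, and they are bounded by \<open>M\<close>. So the
  two limits agree.\<close>

lemma AE_eq_derivative_of_primitive:
  fixes w v V :: "real \<Rightarrow> real"
  assumes [measurable]: "w \<in> borel_measurable borel" "v \<in> borel_measurable borel"
    and wb: "\<And>x. \<bar>w x\<bar> \<le> M"
    and V: "\<And>a b. a \<le> b \<Longrightarrow> V b - V a = (\<integral>x. indicator {a..b} x * w x \<partial>lborel)"
    and D: "AE x in lborel. (V has_real_derivative v x) (at x)"
  shows "AE x in lborel. w x = v x"
proof -
  define d where "d n = 1 / real (Suc n)" for n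
  have d: "0 < d n" for n by (simp add: d_def)
  have d0: "d \<longlonglongrightarrow> 0" unfolding d_def by (rule LIMSEQ_Suc[OF lim_1_over_n])
  have M: "0 \<le> M" using wb[of 0] by linarith
  define D where "D n x = (V x - V (x - d n)) / d n" for n x
  have Deq: "(\<integral>y. w y * (indicator {0..d n} (x - y) / d n) \<partial>lborel) = D n x" for n x
  proof -
    have "(\<integral>y. w y * (indicator {0..d n} (x - y) / d n) \<partial>lborel) = (\<integral>y. (indicator {x - d n..x} y * w y) / d n \<partial>lborel)"
      by (intro Bochner_Integration.integral_cong) (auto simp: indicator_def)
    also have "\<dots> = D n x" using V[of "x - d n" x] d[of n] by (simp add: D_def)
    finally show ?thesis .
  qed
  have Db: "\<bar>D n x\<bar> \<le> M" for n x
    unfolding Deq[symmetric] by (rule mollifier.mollify_abs_le[OF mollifier_box[OF d] assms(1) wb])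
  have [measurable]: "D n \<in> borel_measurable borel" for n
  proof -
    have "(\<lambda>x. \<integral>y. w y * (indicator {0..d n} (x - y) / d n) \<partial>lborel) \<in> borel_measurable borel"
      by measurable
    then have "(\<lambda>x. D n x) \<in> borel_measurable borel" by (simp only: Deq)
    then show ?thesis by simp
  qed
  have lim: "AE x in lborel. (\<lambda>n. D n x) \<longlonglongrightarrow> v x"
    using D
  proof eventually_elim
    case (elim x)
    have "filterlim (\<lambda>n. x - d n) (at x) sequentially"
      unfolding filterlim_at using d by (auto intro!: tendsto_eq_intros d0 always_eventually simp: less_imp_neq[symmetric])
    with elim have "(\<lambda>n. (V (x - d n) - V x) / ((x - d n) - x)) \<longlonglongrightarrow> v x"
      unfolding has_field_derivative_iff by (rule filterlim_compose)
    moreover have "(V (x - d n) - V x) / ((x - d n) - x) = D n x" for n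
      using d[of n] by (simp add: D_def field_simps)
    ultimately show ?case by simp
  qed
  have vb: "AE x in lborel. \<bar>v x\<bar> \<le> M"
    using lim
  proof eventually_elim
    case (elim x)
    then have "(\<lambda>n. \<bar>D n x\<bar>) \<longlonglongrightarrow> \<bar>v x\<bar>" by (intro tendsto_intros)
    then show ?case using Db by (intro LIMSEQ_le_const2) auto
  qed
  have R: "AE x in lborel. x \<in> {-real m..real m} \<longrightarrow> w x = v x" for m :: nat
  proof -
    let ?I = "indicator {-real m..real m} :: real \<Rightarrow> real"
    have "(\<lambda>n. \<integral>x. ?I x * \<bar>w x - D n x\<bar> \<partial>lborel) \<longlonglongrightarrow> 0"
      using mollify_tendsto_L1[OF assms(1) wb _ mollifier_box[OF d] d0, of "real m"] unfolding Deq by simp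
    moreover have "(\<lambda>n. \<integral>x. ?I x * \<bar>w x - D n x\<bar> \<partial>lborel) \<longlonglongrightarrow> (\<integral>x. ?I x * \<bar>w x - v x\<bar> \<partial>lborel)"
    proof (rule integral_tendsto_bounded_support[where B = "2*M" and R = "real m"])
      show "AE x in lborel. (\<lambda>n. ?I x * \<bar>w x - D n x\<bar>) \<longlonglongrightarrow> ?I x * \<bar>w x - v x\<bar>"
        using lim by eventually_elim (intro tendsto_intros)
      fix n x
      show "\<bar>?I x * \<bar>w x - D n x\<bar>\<bar> \<le> 2 * M"
        using wb[of x] Db[of n x] M by (auto simp: indicator_def)
    qed (auto simp: indicator_def)
    ultimately have 0: "(\<integral>x. ?I x * \<bar>w x - v x\<bar> \<partial>lborel) = 0"
      by (rule LIMSEQ_unique[symmetric])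
    have "integrable lborel (\<lambda>x. ?I x * \<bar>w x - v x\<bar>)"
    proof (rule Bochner_Integration.integrable_bound[of lborel "\<lambda>x. (2*M) * ?I x"])
      show "AE x in lborel. norm (?I x * \<bar>w x - v x\<bar>) \<le> norm ((2*M) * ?I x)"
        using vb
      proof eventually_elim
        case (elim x)
        then show ?case using wb[of x] M by (auto simp: indicator_def)
      qed
    qed auto
    then have "AE x in lborel. ?I x * \<bar>w x - v x\<bar> = 0"
      using 0 by (subst (asm) integral_nonneg_eq_0_iff_AE) auto
    then show ?thesis by eventually_elim auto
  qed
  then have "AE x in lborel. \<forall>m::nat. x \<in> {-real m..real m} \<longrightarrow> w x = v x"
    unfolding AE_all_countable by blast
  then show ?thesis
  proof eventually_elim
    case (elim x)
    obtain m :: nat where "\<bar>x\<bar> \<le> real m" using real_arch_simple by blast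
    then have "x \<in> {-real m..real m}" by auto
    then show ?case using elim by blast
  qed
qed

text \<open>The constant 0 is a primitive of \<open>g - h\<close>, and its derivative is 0.\<close>

lemma AE_eq_of_interval_integrals:
  fixes g h :: "real \<Rightarrow> real"
  assumes [measurable]: "g \<in> borel_measurable borel" "h \<in> borel_measurable borel"
    and gb: "\<And>x. \<bar>g x\<bar> \<le> M" and hb: "\<And>x. \<bar>h x\<bar> \<le> M"
    and eq: "\<And>a b. a \<le> b \<Longrightarrow> (\<integral>x. indicator {a..b} x * g x \<partial>lborel) = (\<integral>x. indicator {a..b} x * h x \<partial>lborel)"
  shows "AE x in lborel. g x = h x"
proof -
  have M: "0 \<le> M" using gb[of 0] by linarith
  have i: "integrable lborel (\<lambda>x. indicator {a..b} x * g x)" "integrable lborel (\<lambda>x. indicator {a..b} x * h x)" for a b :: real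
    using gb hb M by (intro integrable_bounded_support[where B = M and R = "max \<bar>a\<bar> \<bar>b\<bar>"]; auto simp: indicator_def)+
  have "AE x in lborel. g x - h x = 0"
  proof (rule AE_eq_derivative_of_primitive[where M = "2 * M" and V = "\<lambda>_. 0"])
    show "\<bar>g x - h x\<bar> \<le> 2 * M" for x using gb[of x] hb[of x] by linarith
    show "0 - 0 = (\<integral>x. indicator {a..b} x * (g x - h x) \<partial>lborel)" if "a \<le> b" for a b
      using eq[OF that] i by (simp add: right_diff_distrib)
  qed auto
  then show ?thesis by simp
qed

text \<open>The partial derivatives as two real functions, instead of the
  \<open>blinfun\<close>-valued derivative of \<open>C1c\<close>: the entropy inequality uses them
  separately, and test functions are built with explicit ones.\<close>

definition has_C1_grad :: "(real \<times> real \<Rightarrow> real) \<Rightarrow> (real \<times> real \<Rightarrow> real) \<Rightarrow> (real \<times> real \<Rightarrow> real) \<Rightarrow> bool" where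
  "has_C1_grad \<phi> p q \<longleftrightarrow> (\<forall>z. (\<phi> has_derivative (\<lambda>h. p z * fst h + q z * snd h)) (at z))
     \<and> continuous_on UNIV p \<and> continuous_on UNIV q"

lemma C1c_iff_grad:
  "\<phi> \<in> C1c \<Omega> \<longleftrightarrow> (\<exists>p q K. has_C1_grad \<phi> p q \<and> compact K \<and> K \<subseteq> \<Omega> \<and> (\<forall>z. z \<notin> K \<longrightarrow> \<phi> z = 0))"
proof
  assume "\<phi> \<in> C1c \<Omega>"
  then obtain \<phi>' K where \<phi>': "\<And>z. (\<phi> has_derivative blinfun_apply (\<phi>' z)) (at z)" "continuous_on UNIV \<phi>'"
    and K: "compact K" "K \<subseteq> \<Omega>" "\<And>z. z \<notin> K \<Longrightarrow> \<phi> z = 0"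
    unfolding C1c_def by blast
  let ?p = "\<lambda>z. blinfun_apply (\<phi>' z) (1, 0)" and ?q = "\<lambda>z. blinfun_apply (\<phi>' z) (0, 1)"
  have "blinfun_apply (\<phi>' z) = (\<lambda>h. ?p z * fst h + ?q z * snd h)" for z
  proof
    fix h :: "real \<times> real"
    have "h = fst h *\<^sub>R (1, 0) + snd h *\<^sub>R (0, 1)" by (simp add: prod_eq_iff)
    then have "blinfun_apply (\<phi>' z) h = blinfun_apply (\<phi>' z) (fst h *\<^sub>R (1, 0) + snd h *\<^sub>R (0, 1))" by simp
    then show "blinfun_apply (\<phi>' z) h = ?p z * fst h + ?q z * snd h"
      unfolding blinfun.add_right blinfun.scaleR_right by (simp add: mult.commute)
  qed
  then have "has_C1_grad \<phi> ?p ?q"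
    unfolding has_C1_grad_def using \<phi>' by (auto intro!: continuous_intros simp flip: fun_eq_iff)
  then show "\<exists>p q K. has_C1_grad \<phi> p q \<and> compact K \<and> K \<subseteq> \<Omega> \<and> (\<forall>z. z \<notin> K \<longrightarrow> \<phi> z = 0)"
    using K by blast
next
  assume "\<exists>p q K. has_C1_grad \<phi> p q \<and> compact K \<and> K \<subseteq> \<Omega> \<and> (\<forall>z. z \<notin> K \<longrightarrow> \<phi> z = 0)"
  then obtain p q K where g: "has_C1_grad \<phi> p q" and K: "compact K" "K \<subseteq> \<Omega>" "\<forall>z. z \<notin> K \<longrightarrow> \<phi> z = 0"
    by blast
  let ?\<phi>' = "\<lambda>z. p z *\<^sub>R fst_blinfun + q z *\<^sub>R snd_blinfun"
  have "(\<phi> has_derivative blinfun_apply (?\<phi>' z)) (at z)" for z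
  proof -
    have "blinfun_apply (?\<phi>' z) = (\<lambda>h. p z * fst h + q z * snd h)"
      by (simp add: fun_eq_iff blinfun.add_left blinfun.scaleR_left)
    moreover have "(\<phi> has_derivative (\<lambda>h. p z * fst h + q z * snd h)) (at z)"
      using g unfolding has_C1_grad_def by blast
    ultimately show ?thesis by (simp only:)
  qed
  moreover have "continuous_on UNIV ?\<phi>'"
    using g unfolding has_C1_grad_def by (intro continuous_intros) auto
  ultimately show "\<phi> \<in> C1c \<Omega>" unfolding C1c_def mem_Collect_eq
    using K by (intro conjI exI[of _ ?\<phi>'] exI[of _ K]) auto
qed

lemma has_C1_grad_partials:
  assumes "has_C1_grad \<phi> p q"
  shows "((\<lambda>s. \<phi> (s, x)) has_real_derivative p (t, x)) (at t)"
    and "((\<lambda>y. \<phi> (t, y)) has_real_derivative q (t, x)) (at x)"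
proof -
  have d: "(\<phi> has_derivative (\<lambda>h. p (t, x) * fst h + q (t, x) * snd h)) (at (t, x))"
    using assms unfolding has_C1_grad_def by blast
  have "((\<lambda>s. \<phi> (s, x)) has_derivative (\<lambda>h. p (t, x) * fst (h, 0::real) + q (t, x) * snd (h, 0::real))) (at t)"
    by (rule has_derivative_compose[of "\<lambda>s. (s, x)", OF _ d]) (auto intro!: derivative_eq_intros)
  then show "((\<lambda>s. \<phi> (s, x)) has_real_derivative p (t, x)) (at t)"
    by (simp add: has_field_derivative_def)
  have "((\<lambda>y. \<phi> (t, y)) has_derivative (\<lambda>h. p (t, x) * fst (0::real, h) + q (t, x) * snd (0::real, h))) (at x)"
    by (rule has_derivative_compose[of "\<lambda>y. (t, y)", OF _ d]) (auto intro!: derivative_eq_intros)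
  then show "((\<lambda>y. \<phi> (t, y)) has_real_derivative q (t, x)) (at x)"
    by (simp add: has_field_derivative_def)
qed

lemma has_C1_grad_eq_0:
  assumes g: "has_C1_grad \<phi> p q" and K: "closed K" "\<And>z. z \<notin> K \<Longrightarrow> \<phi> z = 0" and z: "z \<notin> K"
  shows "p z = 0" "q z = 0"
proof -
  have "(\<phi> has_derivative (\<lambda>h. p z * fst h + q z * snd h)) (at z)"
    using g unfolding has_C1_grad_def by blast
  moreover have "((\<lambda>_. 0) has_derivative (\<lambda>h. 0 :: real)) (at z)" by simp
  then have "(\<phi> has_derivative (\<lambda>h. 0)) (at z)"
    by (rule has_derivative_transform_within_open[where s = "- K"]) (use K z in auto)
  ultimately have *: "(\<lambda>h. p z * fst h + q z * snd h) = (\<lambda>h. 0)"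
    by (rule has_derivative_unique)
  show "p z = 0" using fun_cong[OF *, of "(1, 0)"] by simp
  show "q z = 0" using fun_cong[OF *, of "(0, 1)"] by simp
qed

text \<open>Made for test functions that depend on the potential: they are differentiable only for
  times inside the interval, but vanish off a compact subset of that strip.\<close>

lemma has_C1_grad_extend_by_0:
  assumes "open \<Omega>" "compact K" "K \<subseteq> \<Omega>"
    and d: "\<And>z. z \<in> \<Omega> \<Longrightarrow> (\<phi> has_derivative (\<lambda>h. p z * fst h + q z * snd h)) (at z)"
    and c: "continuous_on \<Omega> p" "continuous_on \<Omega> q"
    and 0: "\<And>z. z \<in> \<Omega> - K \<Longrightarrow> \<phi> z = 0 \<and> p z = 0 \<and> q z = 0"
  shows "has_C1_grad (\<lambda>z. if z \<in> \<Omega> then \<phi> z else 0) (\<lambda>z. if z \<in> \<Omega> then p z else 0) (\<lambda>z. if z \<in> \<Omega> then q z else 0)"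
  unfolding has_C1_grad_def
proof (intro conjI allI)
  have "open (- K)" using assms(2) by (simp add: compact_imp_closed open_Compl)
  fix z
  show "((\<lambda>z. if z \<in> \<Omega> then \<phi> z else 0) has_derivative
      (\<lambda>h. (if z \<in> \<Omega> then p z else 0) * fst h + (if z \<in> \<Omega> then q z else 0) * snd h)) (at z)"
  proof (cases "z \<in> \<Omega>")
    case True
    show ?thesis
      by (rule has_derivative_transform_within_open[where s = \<Omega> and f = \<phi>]) (use d True assms(1) in auto)
  next
    case False
    have "((\<lambda>z. if z \<in> \<Omega> then \<phi> z else 0) has_derivative (\<lambda>h. 0)) (at z)"
    proof (rule has_derivative_transform_within_open[OF _ \<open>open (- K)\<close>])
      show "((\<lambda>_. 0) has_derivative (\<lambda>h. 0 :: real)) (at z)" by simp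
      show "z \<in> - K" using False assms(3) by blast
      show "0 = (if y \<in> \<Omega> then \<phi> y else 0)" if "y \<in> - K" for y using that 0[of y] by simp
    qed
    then show ?thesis using False by simp
  qed
next
  have "open (- K)" using assms(2) by (simp add: compact_imp_closed open_Compl)
  have cont: "continuous_on (\<Omega> \<union> - K) (\<lambda>z. if z \<in> \<Omega> then r z else 0)"
    if "continuous_on \<Omega> r" "\<And>z. z \<in> \<Omega> - K \<Longrightarrow> r z = 0" for r :: "real \<times> real \<Rightarrow> real"
  proof (rule continuous_on_open_Un[OF assms(1) \<open>open (- K)\<close>])
    show "continuous_on \<Omega> (\<lambda>z. if z \<in> \<Omega> then r z else 0)"
      using that(1) by (rule continuous_on_eq) auto
    show "continuous_on (- K) (\<lambda>z. if z \<in> \<Omega> then r z else 0)"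
      by (rule continuous_on_eq[of _ "\<lambda>_. 0"]) (use that(2) in auto)
  qed
  have un: "\<Omega> \<union> - K = UNIV" using assms(3) by auto
  show "continuous_on UNIV (\<lambda>z. if z \<in> \<Omega> then p z else 0)"
    by (rule cont[unfolded un, OF c(1)]) (use 0 in blast)
  show "continuous_on UNIV (\<lambda>z. if z \<in> \<Omega> then q z else 0)"
    by (rule cont[unfolded un, OF c(2)]) (use 0 in blast)
qed

text \<open>Partial derivatives give a total derivative as soon as one of them is continuous; here
  it is the one in \<open>x\<close>.\<close>

lemma has_derivative_strip:
  assumes t: "t \<in> {a<..<b}"
    and p: "\<And>t x. t \<in> {a<..<b} \<Longrightarrow> ((\<lambda>t. \<phi> (t, x)) has_real_derivative p (t, x)) (at t)"
    and q: "\<And>t x. t \<in> {a<..<b} \<Longrightarrow> ((\<lambda>x. \<phi> (t, x)) has_real_derivative q (t, x)) (at x)"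
    and c: "continuous_on ({a<..<b} \<times> UNIV) q"
  shows "(\<phi> has_derivative (\<lambda>h. p (t, x) * fst h + q (t, x) * snd h)) (at (t, x :: real))"
proof -
  have "((\<lambda>(t, x). \<phi> (t, x)) has_derivative (\<lambda>(h, k). p (t, x) * h + blinfun_apply (q (t, x) *\<^sub>R id_blinfun) k))
      (at (t, x) within {a<..<b} \<times> UNIV)"
  proof (rule has_derivative_partialsI)
    show "((\<lambda>t. \<phi> (t, x)) has_derivative (*) (p (t, x))) (at t within {a<..<b})"
      using p[OF t] by (simp add: has_field_derivative_def has_derivative_at_withinI)
    show "((\<lambda>y. \<phi> (s, y)) has_derivative blinfun_apply (q (s, y) *\<^sub>R id_blinfun)) (at y within UNIV)"
      if "s \<in> {a<..<b}" for s y
    proof -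
      have "blinfun_apply (q (s, y) *\<^sub>R id_blinfun) = (*) (q (s, y))"
        by (simp add: fun_eq_iff blinfun.scaleR_left)
      then show ?thesis using q[OF that, of y] unfolding has_field_derivative_def by simp
    qed
    have "continuous_on ({a<..<b} \<times> UNIV) (\<lambda>z. q z *\<^sub>R (id_blinfun :: real \<Rightarrow>\<^sub>L real))"
      by (intro continuous_intros c)
    then show "continuous (at (t, x) within {a<..<b} \<times> UNIV) (\<lambda>(x, y). q (x, y) *\<^sub>R (id_blinfun :: real \<Rightarrow>\<^sub>L real))"
      using t by (simp add: continuous_on_eq_continuous_within split_beta')
  qed auto
  moreover have "at (t, x) within {a<..<b} \<times> UNIV = at (t, x)"
    using t by (intro at_within_open) (auto intro: open_Times)
  ultimately show ?thesis by (simp add: blinfun.scaleR_left split_beta')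
qed

lemma compact_subset_box:
  fixes K :: "(real \<times> real) set"
  assumes "compact K"
  obtains R where "0 \<le> R" "K \<subseteq> {-R..R} \<times> {-R..R}"
proof -
  obtain B where B: "\<And>z. z \<in> K \<Longrightarrow> norm z \<le> B"
    using compact_imp_bounded[OF assms] bounded_iff by blast
  have "\<bar>t\<bar> \<le> max 0 B \<and> \<bar>x\<bar> \<le> max 0 B" if "(t, x) \<in> K" for t x
    using B[OF that] norm_fst_le[of t x] norm_snd_le[of x t] by auto
  then show ?thesis by (intro that[of "max 0 B"]) (fastforce simp: abs_le_iff)+
qed

lemma integrable_compact_support_pair:
  fixes p :: "real \<times> real \<Rightarrow> real"
  assumes c: "continuous_on UNIV p" and K: "compact K" "\<And>z. z \<notin> K \<Longrightarrow> p z = 0"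
  shows "integrable (lborel \<Otimes>\<^sub>M lborel) p"
proof -
  have "integrable lborel (\<lambda>z. indicator K z *\<^sub>R p z)"
    using c K by (intro borel_integrable_compact) (auto intro: continuous_on_subset)
  moreover have "(\<lambda>z. indicator K z *\<^sub>R p z) = p" using K by (auto simp: indicator_def fun_eq_iff)
  ultimately show ?thesis by (simp add: lborel_prod)
qed

text \<open>The boundary terms vanish by compact support. This removes additive constants from the
  entropy and from its flux.\<close>

lemma iterated_integral_grad_eq_0:
  assumes g: "has_C1_grad \<phi> p q" and K: "compact K" "\<And>z. z \<notin> K \<Longrightarrow> \<phi> z = 0"
  shows "(\<integral>t. \<integral>x. p (t, x) \<partial>lborel \<partial>lborel) = 0" "(\<integral>x. q (t, x) \<partial>lborel) = 0"
proof -
  obtain R where R: "0 \<le> R" "K \<subseteq> {-R..R} \<times> {-R..R}" using compact_subset_box[OF K(1)] .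
  have c: "continuous_on UNIV p" "continuous_on UNIV q" using g unfolding has_C1_grad_def by auto
  have 0: "z \<notin> {-R..R} \<times> {-R..R} \<Longrightarrow> \<phi> z = 0" "z \<notin> {-R..R} \<times> {-R..R} \<Longrightarrow> p z = 0"
    "z \<notin> {-R..R} \<times> {-R..R} \<Longrightarrow> q z = 0" for z
    using R K has_C1_grad_eq_0[OF g compact_imp_closed[OF K(1)]] by blast+
  have "(\<integral>t. \<integral>x. p (t, x) \<partial>lborel \<partial>lborel) = (\<integral>x. \<integral>t. p (t, x) \<partial>lborel \<partial>lborel)"
    using lborel_pair.Fubini_integral[of "\<lambda>t x. p (t, x)"]
      integrable_compact_support_pair[OF c(1), of "{-R..R} \<times> {-R..R}"] 0
      compact_Times[OF compact_Icc compact_Icc, of "-R" R "-R" R]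
    by auto
  also have "(\<lambda>x. \<integral>t. p (t, x) \<partial>lborel) = (\<lambda>_. 0)"
  proof
    fix x
    have "(\<integral>t. indicator {-R-1..R+1} t *\<^sub>R p (t, x) \<partial>lborel) = \<phi> (R + 1, x) - \<phi> (-R-1, x)"
      using R(1) has_C1_grad_partials(1)[OF g]
      by (intro integral_FTC_atLeastAtMost)
        (auto simp: has_real_derivative_iff_has_vector_derivative[symmetric] intro!: continuous_on_compose2[OF c(1)] continuous_intros
          intro: has_field_derivative_at_within)
    moreover have "(\<lambda>t. indicator {-R-1..R+1} t *\<^sub>R p (t, x)) = (\<lambda>t. p (t, x))"
    proof
      show "indicator {-R-1..R+1} t *\<^sub>R p (t, x) = p (t, x)" for t
      using 0(2)[of "(t, x)"] by (cases "t \<in> {-R..R}") (auto simp: indicator_def)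
    qed
    ultimately show "(\<integral>t. p (t, x) \<partial>lborel) = 0" using 0(1)[of "(R+1, x)"] 0(1)[of "(-R-1, x)"] by simp
  qed
  finally show "(\<integral>t. \<integral>x. p (t, x) \<partial>lborel \<partial>lborel) = 0" by simp
  have "(\<integral>x. indicator {-R-1..R+1} x *\<^sub>R q (t, x) \<partial>lborel) = \<phi> (t, R + 1) - \<phi> (t, -R-1)"
    using R(1) has_C1_grad_partials(2)[OF g]
    by (intro integral_FTC_atLeastAtMost)
      (auto simp: has_real_derivative_iff_has_vector_derivative[symmetric] intro!: continuous_on_compose2[OF c(2)] continuous_intros
        intro: has_field_derivative_at_within)
  moreover have "(\<lambda>x. indicator {-R-1..R+1} x *\<^sub>R q (t, x)) = (\<lambda>x. q (t, x))"
  proof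
    show "indicator {-R-1..R+1} x *\<^sub>R q (t, x) = q (t, x)" for x
    using 0(3)[of "(t, x)"] by (cases "x \<in> {-R..R}") (auto simp: indicator_def)
  qed
  ultimately show "(\<integral>x. q (t, x) \<partial>lborel) = 0" using 0(1)[of "(t, R+1)"] 0(1)[of "(t, -R-1)"] by simp
qed

section \<open>Strictly convex fluxes\<close>

lemma continuous_on_compact_bdd:
  fixes g :: "'a::topological_space \<Rightarrow> real"
  assumes "continuous_on K g" "compact K"
  obtains B where "0 \<le> B" "\<And>z. z \<in> K \<Longrightarrow> \<bar>g z\<bar> \<le> B"
proof -
  obtain B where B: "\<And>y. y \<in> g ` K \<Longrightarrow> norm y \<le> B"
    using compact_imp_bounded[OF compact_continuous_image[OF assms]] bounded_iff by metis
  have "\<bar>g z\<bar> \<le> max 0 B" if "z \<in> K" for z using B[of "g z"] that by auto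
  then show ?thesis by (intro that[of "max 0 B"]) auto
qed

lemma integrable_continuous_support:
  fixes h :: "real \<Rightarrow> real"
  assumes "continuous_on UNIV h" "\<And>r. R < \<bar>r\<bar> \<Longrightarrow> h r = 0"
  shows "integrable lborel h"
proof -
  have "h r = indicator {-R..R} r *\<^sub>R h r" for r using assms(2)[of r] by (cases "R < \<bar>r\<bar>") (auto simp: indicator_def)
  then have "h = (\<lambda>r. indicator {-R..R} r *\<^sub>R h r)" by (rule ext)
  moreover have "integrable lborel (\<lambda>r. indicator {-R..R} r *\<^sub>R h r)"
    by (rule borel_integrable_compact) (auto intro: continuous_on_subset[OF assms(1)])
  ultimately show ?thesis by simp
qed

locale convex_flux =
  fixes f :: "real \<Rightarrow> real" and c :: real
  assumes C2f: "C2 f" and c_pos: "0 < c" and f''_ge: "c \<le> deriv (deriv f) x"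
    and f_0: "f 0 = 0" and f_min: "f 0 \<le> f x"
begin

definition b :: "real \<Rightarrow> real" where "b = inv (deriv f)"

text \<open>The supremum of \<open>a * u - f u\<close> over \<open>u\<close> is attained where
  \<open>deriv f u = a\<close>, that is at \<open>u = b a\<close>; \<open>young\<close> confirms
  it.\<close>

definition L :: "real \<Rightarrow> real" where "L a = a * b a - f (b a)"

lemma f_DERIV: "(f has_real_derivative deriv f x) (at x within S)"
  using C2f unfolding C2_def
  by (metis DERIV_deriv_iff_real_differentiable has_field_derivative_at_within)

lemma f'_DERIV: "(deriv f has_real_derivative deriv (deriv f) x) (at x within S)"
  using C2f unfolding C2_def
  by (metis DERIV_deriv_iff_real_differentiable has_field_derivative_at_within)

lemma continuous_f [continuous_intros]: "continuous_on S g \<Longrightarrow> continuous_on S (\<lambda>x. f (g x))"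
  using continuous_on_compose2[OF DERIV_continuous_on[of UNIV f "deriv f", OF f_DERIV], of S g] by auto

lemma continuous_f' [continuous_intros]: "continuous_on S g \<Longrightarrow> continuous_on S (\<lambda>x. deriv f (g x))"
  using continuous_on_compose2[OF DERIV_continuous_on[of UNIV "deriv f" "deriv (deriv f)", OF f'_DERIV], of S g] by auto

lemma measurable_f [measurable]: "f \<in> borel_measurable borel"
  by (intro borel_measurable_continuous_onI continuous_intros)

text \<open>The function \<open>deriv f x - c * x\<close> is nondecreasing. The quantitative
  convexity of \<open>f\<close> acts through this inequality: on the range of
  \<open>deriv f\<close>, on the Lipschitz bound for \<open>b\<close>, and through that on the
  parabola above \<open>L\<close>.\<close>

lemma f'_growth: assumes "x \<le> y" shows "c * (y - x) \<le> deriv f y - deriv f x"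
proof -
  have "deriv f x - c * x \<le> deriv f y - c * y"
    by (rule DERIV_nonneg_imp_nondecreasing[OF assms])
      (use f''_ge in \<open>fastforce intro!: derivative_eq_intros f'_DERIV\<close>)
  then show ?thesis by (simp add: algebra_simps)
qed

lemma f'_strict_mono: "strict_mono (deriv f)"
proof (rule strict_monoI)
  fix x y :: real assume "x < y"
  moreover from this have "0 < c * (y - x)" using c_pos by simp
  ultimately show "deriv f x < deriv f y" using f'_growth[of x y] by linarith
qed

lemma f'_le_iff [simp]: "deriv f x \<le> deriv f y \<longleftrightarrow> x \<le> y"
  and f'_less_iff [simp]: "deriv f x < deriv f y \<longleftrightarrow> x < y"
  and f'_eq_iff [simp]: "deriv f x = deriv f y \<longleftrightarrow> x = y"
  using f'_strict_mono by (auto simp: strict_mono_less_eq strict_mono_less strict_mono_eq)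

lemma f'_0 [simp]: "deriv f 0 = 0"
  by (rule DERIV_local_min[where f = f and d = 1 and x = 0]) (use f_DERIV f_min in auto)

lemma surj_f': "\<exists>x. deriv f x = a"
proof -
  have c: "continuous_on {-\<bar>a\<bar>/c..\<bar>a\<bar>/c} (deriv f)" by (intro continuous_intros)
  have "deriv f (-\<bar>a\<bar>/c) \<le> a" "a \<le> deriv f (\<bar>a\<bar>/c)"
    using f'_growth[of "-\<bar>a\<bar>/c" 0] f'_growth[of 0 "\<bar>a\<bar>/c"] c_pos by auto
  moreover have "-\<bar>a\<bar>/c \<le> \<bar>a\<bar>/c" using c_pos by (simp add: divide_right_mono)
  ultimately show ?thesis using IVT'[of "deriv f" "-\<bar>a\<bar>/c" a "\<bar>a\<bar>/c"] c by blast
qed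

lemma f'_b [simp]: "deriv f (b a) = a"
  unfolding b_def using surj_f' by (metis f_inv_into_f rangeI)

lemma b_f' [simp]: "b (deriv f x) = x"
  by (metis f'_eq_iff f'_b)

lemma b_0 [simp]: "b 0 = 0"
  by (metis f'_0 b_f')

lemma b_le_iff [simp]: "b x \<le> b y \<longleftrightarrow> x \<le> y"
  by (metis f'_b f'_le_iff)

lemma b_lipschitz: "\<bar>b x - b y\<bar> \<le> \<bar>x - y\<bar> / c"
proof -
  have *: "\<bar>b y - b x\<bar> \<le> \<bar>y - x\<bar> / c" if "x \<le> y" for x y
  proof -
    have "b x \<le> b y" using that by simp
    moreover have "b y - b x \<le> (y - x) / c"
      using f'_growth[of "b x" "b y"] that c_pos by (simp add: field_simps)
    ultimately show ?thesis using that by simp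
  qed
  show ?thesis using *[of x y] *[of y x] by (cases "x \<le> y") (auto simp: abs_minus_commute)
qed

lemma continuous_b [continuous_intros]: assumes "continuous_on S g" shows "continuous_on S (\<lambda>x. b (g x))"
proof -
  have "(1/c)-lipschitz_on UNIV b"
    using b_lipschitz c_pos by (intro lipschitz_onI) (auto simp: dist_real_def)
  then show ?thesis
    by (intro continuous_on_compose2[OF lipschitz_on_continuous_on assms]) auto
qed

lemma measurable_b [measurable]: "b \<in> borel_measurable borel"
  by (intro borel_measurable_continuous_onI continuous_intros)

lemma f_above_tangent: "f k + deriv f k * (u - k) \<le> f u"
proof -
  have "f u - f k \<ge> deriv f k * (u - k)"
  proof (cases "k = u")
    case False
    then consider "k < u" | "u < k" by linarith
    then show ?thesis
    proof cases
      case 1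
      obtain z where z: "k < z" "z < u" "f u - f k = (u - k) * deriv f z"
        using MVT2[OF 1, of f "deriv f"] f_DERIV by blast
      have "(u - k) * deriv f k \<le> (u - k) * deriv f z" using z 1 by (intro mult_left_mono) auto
      then show ?thesis using z by (simp add: mult.commute)
    next
      case 2
      obtain z where z: "u < z" "z < k" "f k - f u = (k - u) * deriv f z"
        using MVT2[OF 2, of f "deriv f"] f_DERIV by blast
      have "(k - u) * deriv f z \<le> (k - u) * deriv f k" using z 2 by (intro mult_left_mono) auto
      then show ?thesis using z by (simp add: algebra_simps)
    qed
  qed simp
  then show ?thesis by simp
qed

lemma young: "a * u - f u \<le> L a"
  using f_above_tangent[of "b a" u] by (simp add: L_def algebra_simps)

lemma L_0 [simp]: "L 0 = 0"
  by (simp add: L_def f_0)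

lemma L_above_tangent: "L a + b a * (a' - a) \<le> L a'"
  using young[of a' "b a"] by (simp add: L_def algebra_simps)

text \<open>The tangent inequality at \<open>a'\<close>, solved for \<open>L a'\<close>, has the
  slope \<open>b a'\<close>; the Lipschitz bound on \<open>b\<close> trades it for
  \<open>b a\<close>. The quadratic remainder makes \<open>L\<close> differentiable and later makes
  the error of one Hopf-Lax step quadratic in the step size.\<close>

lemma L_below_parabola: "L a' \<le> L a + b a * (a' - a) + (a' - a)\<^sup>2 / c"
proof -
  have "L a' \<le> L a + b a' * (a' - a)"
    using L_above_tangent[of a' a] by (simp add: algebra_simps)
  also have "b a' * (a' - a) = b a * (a' - a) + (b a' - b a) * (a' - a)"
    by (simp add: algebra_simps)
  also have "(b a' - b a) * (a' - a) \<le> \<bar>b a' - b a\<bar> * \<bar>a' - a\<bar>"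
    by (metis abs_ge_self abs_mult)
  also have "\<dots> \<le> \<bar>a' - a\<bar> / c * \<bar>a' - a\<bar>"
    by (intro mult_right_mono b_lipschitz) auto
  also have "\<dots> = (a' - a)\<^sup>2 / c" by (simp add: power2_eq_square flip: abs_mult)
  finally show ?thesis by simp
qed

lemma L_DERIV: "(L has_real_derivative b a) (at a)"
proof -
  have "((\<lambda>x. (L x - L a) / (x - a) - b a) \<longlongrightarrow> 0) (at a)"
  proof (rule Lim_null_comparison)
    show "\<forall>\<^sub>F x in at a. norm ((L x - L a) / (x - a) - b a) \<le> \<bar>x - a\<bar> / c"
      unfolding eventually_at_filter
    proof (intro always_eventually allI impI)
      fix x assume "x \<noteq> a"
      then have "(L x - L a) / (x - a) - b a = (L x - L a - b a * (x - a)) / (x - a)"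
        by (simp add: field_simps)
      moreover have "\<bar>L x - L a - b a * (x - a)\<bar> \<le> \<bar>x - a\<bar> / c * \<bar>x - a\<bar>"
        using L_above_tangent[of a x] L_below_parabola[of x a]
        by (simp add: power2_eq_square flip: abs_mult)
      ultimately show "norm ((L x - L a) / (x - a) - b a) \<le> \<bar>x - a\<bar> / c"
        using \<open>x \<noteq> a\<close> by (simp add: divide_le_eq)
    qed
  qed (use c_pos in \<open>auto intro!: tendsto_eq_intros\<close>)
  then show ?thesis unfolding has_field_derivative_iff by (simp add: LIM_zero_iff)
qed

text \<open>Two tangent inequalities, joined at the midpoint \<open>?m\<close>: on the second half
  the slope \<open>b ?m\<close> is already strictly on the favourable side of
  \<open>b a\<close>.\<close>

lemma L_strict: "a \<noteq> a' \<Longrightarrow> L a + b a * (a' - a) < L a'"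
proof -
  assume "a \<noteq> a'"
  let ?m = "(a + a') / 2"
  have 1: "L a + b a * (?m - a) \<le> L ?m" "L ?m + b ?m * (a' - ?m) \<le> L a'"
    by (rule L_above_tangent)+
  have "b a * (a' - ?m) < b ?m * (a' - ?m)"
  proof (cases "a < a'")
    case True
    then have "b a < b ?m" using b_le_iff[of ?m a] by (simp add: not_le[symmetric])
    with True show ?thesis by (intro mult_strict_right_mono) auto
  next
    case False
    with \<open>a \<noteq> a'\<close> have "a' < a" by simp
    then have "b ?m < b a" using b_le_iff[of a ?m] by (simp add: not_le[symmetric])
    with \<open>a' < a\<close> show ?thesis by (intro mult_strict_right_mono_neg) auto
  qed
  moreover have "b a * (a' - a) = b a * (?m - a) + b a * (a' - ?m)" by (simp add: field_simps)
  ultimately show ?thesis using 1 by linarith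
qed

lemma f_lipschitz:
  assumes "\<And>x. \<bar>x\<bar> \<le> M \<Longrightarrow> \<bar>deriv f x\<bar> \<le> \<Lambda>" "\<bar>x\<bar> \<le> M" "\<bar>y\<bar> \<le> M"
  shows "\<bar>f x - f y\<bar> \<le> \<Lambda> * \<bar>x - y\<bar>"
proof -
  have "norm (f x - f y) \<le> \<Lambda> * norm (x - y)"
    by (rule field_differentiable_bound[of "{-M..M}" f "deriv f" \<Lambda>])
      (use assms f_DERIV in auto)
  then show ?thesis by simp
qed

lemma f'_bdd: obtains \<Lambda> where "0 < \<Lambda>" "\<And>x. \<bar>x\<bar> \<le> M \<Longrightarrow> \<bar>deriv f x\<bar> \<le> \<Lambda>"
proof
  let ?\<Lambda> = "max 1 (max \<bar>deriv f (-M)\<bar> \<bar>deriv f M\<bar>)"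
  show "0 < ?\<Lambda>" by simp
  show "\<bar>deriv f x\<bar> \<le> ?\<Lambda>" if "\<bar>x\<bar> \<le> M" for x
  proof -
    have "deriv f (-M) \<le> deriv f x" "deriv f x \<le> deriv f M" using that by auto
    then show ?thesis by linarith
  qed
qed

lemma f_bdd: obtains B where "0 \<le> B" "\<And>x. \<bar>x\<bar> \<le> M \<Longrightarrow> \<bar>f x\<bar> \<le> B"
proof -
  have "continuous_on {-M..M} f" by (intro continuous_intros)
  then obtain B where B: "0 \<le> B" "\<And>x. x \<in> {-M..M} \<Longrightarrow> \<bar>f x\<bar> \<le> B"
    using continuous_on_compact_bdd[OF _ compact_Icc] by metis
  have "\<bar>f x\<bar> \<le> B" if "\<bar>x\<bar> \<le> M" for x using that by (intro B(2)) auto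
  with B(1) show ?thesis by (rule that)
qed

text \<open>The sign jumps only at \<open>v = k\<close>, where the other factor vanishes. Written as
  \<open>f (max v k) - f (min v k)\<close> the flux shows no jump at all.\<close>

lemma continuous_kruzkov_flux: "continuous_on S (\<lambda>v. sgn (v - k) * (f v - f k))"
proof -
  have "sgn (v - k) * (f v - f k) = f (max v k) - f (min v k)" for v
    by (auto simp: sgn_if max_def min_def)
  then show ?thesis by (simp only:) (intro continuous_intros)
qed

text \<open>The variation of \<open>v\<close> splits without loss between \<open>max v k\<close> and
  \<open>min v k\<close>, so the constant is that of \<open>f\<close> itself.\<close>

lemma kruzkov_flux_lipschitz:
  assumes "\<bar>v\<bar> \<le> A" "\<bar>v'\<bar> \<le> A" "\<bar>k\<bar> \<le> A" and \<Lambda>: "\<And>x. \<bar>x\<bar> \<le> A \<Longrightarrow> \<bar>deriv f x\<bar> \<le> \<Lambda>"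
  shows "\<bar>sgn (v - k) * (f v - f k) - sgn (v' - k) * (f v' - f k)\<bar> \<le> \<Lambda> * \<bar>v - v'\<bar>"
proof -
  have eq: "sgn (v - k) * (f v - f k) = f (max v k) - f (min v k)" for v
    by (auto simp: sgn_if max_def min_def)
  have 1: "\<bar>f (max v k) - f (max v' k)\<bar> \<le> \<Lambda> * \<bar>max v k - max v' k\<bar>"
    by (rule f_lipschitz[OF \<Lambda>]) (use assms in auto)
  have 2: "\<bar>f (min v k) - f (min v' k)\<bar> \<le> \<Lambda> * \<bar>min v k - min v' k\<bar>"
    by (rule f_lipschitz[OF \<Lambda>]) (use assms in auto)
  have 3: "\<bar>max v k - max v' k\<bar> + \<bar>min v k - min v' k\<bar> = \<bar>v - v'\<bar>" by (auto simp: max_def min_def)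
  have "\<bar>(f (max v k) - f (min v k)) - (f (max v' k) - f (min v' k))\<bar>
      \<le> \<bar>f (max v k) - f (max v' k)\<bar> + \<bar>f (min v k) - f (min v' k)\<bar>"
    using abs_triangle_ineq4[of "f (max v k) - f (max v' k)" "f (min v k) - f (min v' k)"] by (simp add: algebra_simps)
  also have "\<dots> \<le> \<Lambda> * (\<bar>max v k - max v' k\<bar> + \<bar>min v k - min v' k\<bar>)"
    unfolding distrib_left by (rule add_mono[OF 1 2])
  finally show ?thesis unfolding eq 3 .
qed

text \<open>The dominating function for Fubini and for limits in the entropy inequality; of the
  solution it sees only the bound \<open>M\<close>.\<close>

lemma kruzkov_integrand_bdd:
  assumes "continuous_on UNIV p" "continuous_on UNIV q" and K: "compact (K :: (real \<times> real) set)"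
    and 0: "\<And>z. z \<notin> K \<Longrightarrow> p z = 0" "\<And>z. z \<notin> K \<Longrightarrow> q z = 0"
  obtains B where "integrable lborel (\<lambda>z. B * indicator K z)"
    "\<And>w z. \<bar>w\<bar> \<le> M \<Longrightarrow> \<bar>\<bar>w - k\<bar> * p z + sgn (w - k) * (f w - f k) * q z\<bar> \<le> B * indicator K z"
proof -
  obtain B1 where B1: "0 \<le> B1" "\<And>z. z \<in> K \<Longrightarrow> \<bar>p z\<bar> \<le> B1"
    using continuous_on_compact_bdd[OF continuous_on_subset[OF assms(1)] K] by auto
  obtain B2 where B2: "0 \<le> B2" "\<And>z. z \<in> K \<Longrightarrow> \<bar>q z\<bar> \<le> B2"
    using continuous_on_compact_bdd[OF continuous_on_subset[OF assms(2)] K] by auto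
  obtain B3 where B3: "0 \<le> B3" "\<And>w. w \<in> {-M..M} \<Longrightarrow> \<bar>sgn (w - k) * (f w - f k)\<bar> \<le> B3"
    using continuous_on_compact_bdd[OF continuous_kruzkov_flux compact_Icc] by metis
  show ?thesis
  proof (rule that[of "(M + \<bar>k\<bar>) * B1 + B3 * B2"])
    show "integrable lborel (\<lambda>z. ((M + \<bar>k\<bar>) * B1 + B3 * B2) * indicator K z)"
      using emeasure_compact_finite[OF K] compact_imp_closed[OF K]
      by (intro integrable_mult_right integrable_real_indicator) (auto simp: less_top)
    fix w z assume w: "\<bar>w\<bar> \<le> M"
    show "\<bar>\<bar>w - k\<bar> * p z + sgn (w - k) * (f w - f k) * q z\<bar> \<le> ((M + \<bar>k\<bar>) * B1 + B3 * B2) * indicator K z"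
    proof (cases "z \<in> K")
      case True
      have "\<bar>\<bar>w - k\<bar> * p z\<bar> \<le> (M + \<bar>k\<bar>) * B1"
        unfolding abs_mult using w by (intro mult_mono B1 True) auto
      moreover have "\<bar>sgn (w - k) * (f w - f k)\<bar> \<le> B3" using w by (intro B3(2)) auto
      then have "\<bar>sgn (w - k) * (f w - f k) * q z\<bar> \<le> B3 * B2"
        unfolding abs_mult[of _ "q z"] using B3 by (intro mult_mono B2 True) auto
      ultimately show ?thesis using True by (simp add: order_trans[OF abs_triangle_ineq add_mono])
    qed (simp add: 0)
  qed
qed

end

text \<open>Representatives are fixed once for all, Borel measurable and bounded at every point and
  for every real time, so that no null sets have to be carried along. In
  \<open>solution_slices\<close> times outside \<open>{0..T}\<close> are clamped, which keeps the
  continuity in time global.\<close>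

locale slices =
  fixes u :: "real \<Rightarrow> real \<Rightarrow> real" and M :: real
  assumes u_meas [measurable]: "u t \<in> borel_measurable borel" and u_bdd: "\<bar>u t x\<bar> \<le> M"
    and u_cont: "s \<longlonglongrightarrow> t \<Longrightarrow> (\<lambda>n. \<integral>x. indicator {-R..R} x * \<bar>u (s n) x - u t x\<bar> \<partial>lborel) \<longlonglongrightarrow> 0"
begin

lemma M_nonneg: "0 \<le> M" using u_bdd[of 0 0] by linarith

text \<open>Strong convergence in L^1_loc passes through nonlinear \<open>\<Phi>\<close>: the
  Lipschitz bound absorbs the change from \<open>u (s n)\<close> to \<open>u t\<close>, and for the
  fixed slice \<open>u t\<close> dominated convergence handles the change from
  \<open>\<Phi> n\<close> to \<open>\<Psi>\<close>.\<close>

lemma slice_tendsto: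
  assumes s: "s \<longlonglongrightarrow> t"
    and [measurable]: "\<And>n. (\<lambda>(x, v). \<Phi> n x v) \<in> borel_measurable (borel \<Otimes>\<^sub>M borel)"
      "(\<lambda>(x, v). \<Psi> x v) \<in> borel_measurable (borel \<Otimes>\<^sub>M borel)"
    and lip: "\<And>n x v v'. \<bar>v\<bar> \<le> M \<Longrightarrow> \<bar>v'\<bar> \<le> M \<Longrightarrow> \<bar>\<Phi> n x v - \<Phi> n x v'\<bar> \<le> C * \<bar>v - v'\<bar>"
    and bdd: "\<And>n x v. \<bar>v\<bar> \<le> M \<Longrightarrow> \<bar>\<Phi> n x v\<bar> \<le> B"
    and supp: "\<And>n x v. R < \<bar>x\<bar> \<Longrightarrow> \<Phi> n x v = 0"
    and lim: "\<And>x v. \<bar>v\<bar> \<le> M \<Longrightarrow> (\<lambda>n. \<Phi> n x v) \<longlonglongrightarrow> \<Psi> x v"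
  shows "(\<lambda>n. \<integral>x. \<Phi> n x (u (s n) x) \<partial>lborel) \<longlonglongrightarrow> (\<integral>x. \<Psi> x (u t x) \<partial>lborel)"
proof -
  have [measurable]: "(\<lambda>x. \<Phi> n x (u r x)) \<in> borel_measurable borel" for n r
    using measurable_compose[of "\<lambda>x. (x, u r x)" borel "borel \<Otimes>\<^sub>M borel" "\<lambda>(x, v). \<Phi> n x v" borel] by simp
  have [measurable]: "(\<lambda>x. \<Psi> x (u r x)) \<in> borel_measurable borel" for r
    using measurable_compose[of "\<lambda>x. (x, u r x)" borel "borel \<Otimes>\<^sub>M borel" "\<lambda>(x, v). \<Psi> x v" borel] by simp
  have 1: "(\<lambda>n. \<integral>x. \<Phi> n x (u t x) \<partial>lborel) \<longlonglongrightarrow> (\<integral>x. \<Psi> x (u t x) \<partial>lborel)"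
    by (rule integral_tendsto_bounded_support[where B = B and R = R]) (use bdd supp lim u_bdd in auto)
  have int: "integrable lborel (\<lambda>x. \<Phi> n x (u r x))" for n r
    by (rule integrable_bounded_support[where B = B and R = R]) (use bdd supp u_bdd in auto)
  have "(\<lambda>n. (\<integral>x. \<Phi> n x (u (s n) x) \<partial>lborel) - (\<integral>x. \<Phi> n x (u t x) \<partial>lborel)) \<longlonglongrightarrow> 0"
  proof (rule Lim_null_comparison[OF always_eventually, OF allI])
    fix n
    have i: "integrable lborel (\<lambda>x. C * (indicator {-R..R} x * \<bar>u (s n) x - u t x\<bar>))"
    proof (rule integrable_mult_right, rule integrable_bounded_support[where B = "2 * M" and R = R])
      show "\<bar>indicator {-R..R} x * \<bar>u (s n) x - u t x\<bar>\<bar> \<le> 2 * M" for x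
        using u_bdd[of "s n" x] u_bdd[of t x] by (auto simp: indicator_def)
    qed (auto simp: indicator_def)
    have "(\<integral>x. \<Phi> n x (u (s n) x) \<partial>lborel) - (\<integral>x. \<Phi> n x (u t x) \<partial>lborel)
       = (\<integral>x. \<Phi> n x (u (s n) x) - \<Phi> n x (u t x) \<partial>lborel)"
      using int by simp
    also have "norm \<dots> \<le> (\<integral>x. C * (indicator {-R..R} x * \<bar>u (s n) x - u t x\<bar>) \<partial>lborel)"
    proof (rule Bochner_Integration.integral_norm_bound_integral[OF _ i])
      fix x
      show "norm (\<Phi> n x (u (s n) x) - \<Phi> n x (u t x)) \<le> C * (indicator {-R..R} x * \<bar>u (s n) x - u t x\<bar>)"
        using lip[OF u_bdd u_bdd, of n x "s n" x t x] supp[of x n] by (cases "R < \<bar>x\<bar>") (auto simp: indicator_def)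
    qed (use int in auto)
    also have "\<dots> = C * (\<integral>x. indicator {-R..R} x * \<bar>u (s n) x - u t x\<bar> \<partial>lborel)" by simp
    finally show "norm ((\<integral>x. \<Phi> n x (u (s n) x) \<partial>lborel) - (\<integral>x. \<Phi> n x (u t x) \<partial>lborel))
      \<le> C * (\<integral>x. indicator {-R..R} x * \<bar>u (s n) x - u t x\<bar> \<partial>lborel)" .
  qed (use tendsto_mult_right_zero[OF u_cont[OF s]] in auto)
  from tendsto_add[OF this 1] show ?thesis by simp
qed

lemma slice_continuous:
  assumes c: "continuous_on UNIV (\<lambda>(t, x, v). \<Phi> t x v)"
    and lip: "\<And>t x v v'. \<bar>v\<bar> \<le> M \<Longrightarrow> \<bar>v'\<bar> \<le> M \<Longrightarrow> \<bar>\<Phi> t x v - \<Phi> t x v'\<bar> \<le> C * \<bar>v - v'\<bar>"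
    and bdd: "\<And>t x v. \<bar>v\<bar> \<le> M \<Longrightarrow> \<bar>\<Phi> t x v\<bar> \<le> B"
    and supp: "\<And>t x v. R < \<bar>x\<bar> \<Longrightarrow> \<Phi> t x v = 0"
  shows "continuous_on UNIV (\<lambda>t. \<integral>x. \<Phi> t x (u t x) \<partial>lborel)"
  unfolding continuous_on_sequentially comp_def
proof (intro allI ballI impI, elim conjE)
  fix s t assume s: "s \<longlonglongrightarrow> (t :: real)"
  have m: "(\<lambda>(x, v). \<Phi> t x v) \<in> borel_measurable (borel \<Otimes>\<^sub>M borel)" for t
  proof -
    have "continuous_on UNIV (\<lambda>z. (t, fst z, snd z))" by (intro continuous_intros)
    from continuous_on_compose2[OF c this] have "continuous_on UNIV (\<lambda>(x, v). \<Phi> t x v)"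
      by (simp add: split_beta')
    then show ?thesis unfolding borel_prod by (rule borel_measurable_continuous_onI)
  qed
  show "(\<lambda>n. \<integral>x. \<Phi> (s n) x (u (s n) x) \<partial>lborel) \<longlonglongrightarrow> (\<integral>x. \<Phi> t x (u t x) \<partial>lborel)"
  proof (rule slice_tendsto[OF s, of "\<lambda>n. \<Phi> (s n)" "\<Phi> t" C B R])
    show "(\<lambda>n. \<Phi> (s n) x v) \<longlonglongrightarrow> \<Phi> t x v" for x v
    proof -
      have "(\<lambda>n. (s n, x, v)) \<longlonglongrightarrow> (t, x, v)" by (intro tendsto_intros s)
      from continuous_on_tendsto_compose[OF c this] show ?thesis by simp
    qed
  qed (use m lip bdd supp in auto)
qed

lemma slice_continuous_bounded_weight:
  assumes p: "continuous_on UNIV p" "\<And>t x. R < \<bar>x\<bar> \<Longrightarrow> p (t, x) = (0 :: real)" "\<And>z. \<bar>p z\<bar> \<le> B0"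
    and g: "continuous_on UNIV g" "\<And>v v'. \<bar>v\<bar> \<le> M \<Longrightarrow> \<bar>v'\<bar> \<le> M \<Longrightarrow> \<bar>g v - g v'\<bar> \<le> C * \<bar>v - v'\<bar>"
  shows "continuous_on UNIV (\<lambda>t. \<integral>x. g (u t x) * p (t, x) \<partial>lborel)"
    and "integrable lborel (\<lambda>x. g (u t x) * p (t, x))"
    and "\<exists>B. \<forall>t. \<bar>\<integral>x. g (u t x) * p (t, x) \<partial>lborel\<bar> \<le> B"
proof -
  obtain G0 where G0: "0 \<le> G0" "\<And>v. v \<in> {-M..M} \<Longrightarrow> \<bar>g v\<bar> \<le> G0"
    using continuous_on_compact_bdd[OF continuous_on_subset[OF g(1)] compact_Icc] by auto
  have G: "\<bar>g v\<bar> \<le> G0" if "\<bar>v\<bar> \<le> M" for v using that by (intro G0(2)) auto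
  have gp: "\<bar>g v * p z\<bar> \<le> G0 * B0" if "\<bar>v\<bar> \<le> M" for v z
    unfolding abs_mult using G0(1) by (intro mult_mono G p(3) that) auto
  show "continuous_on UNIV (\<lambda>t. \<integral>x. g (u t x) * p (t, x) \<partial>lborel)"
  proof (rule slice_continuous[where R = R and B = "G0 * B0" and C = "\<bar>C\<bar> * B0"])
    show "continuous_on UNIV (\<lambda>(t, x, v). g v * p (t, x))"
      unfolding split_beta'
      by (intro continuous_intros continuous_on_compose2[OF g(1)] continuous_on_compose2[OF p(1)]) auto
    show "\<bar>g v * p (t, x) - g v' * p (t, x)\<bar> \<le> \<bar>C\<bar> * B0 * \<bar>v - v'\<bar>"
      if "\<bar>v\<bar> \<le> M" "\<bar>v'\<bar> \<le> M" for t x v v'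
    proof -
      have "\<bar>g v * p (t, x) - g v' * p (t, x)\<bar> = \<bar>g v - g v'\<bar> * \<bar>p (t, x)\<bar>"
        by (simp add: abs_mult flip: left_diff_distrib)
      also have "\<dots> \<le> (\<bar>C\<bar> * \<bar>v - v'\<bar>) * B0"
      proof (intro mult_mono p(3))
        have "C * \<bar>v - v'\<bar> \<le> \<bar>C\<bar> * \<bar>v - v'\<bar>" by (intro mult_right_mono) auto
        then show "\<bar>g v - g v'\<bar> \<le> \<bar>C\<bar> * \<bar>v - v'\<bar>" using g(2)[OF that] by linarith
      qed auto
      finally show ?thesis by (simp add: mult_ac)
    qed
  qed (use gp p(2) in auto)
  have [measurable]: "g \<in> borel_measurable borel" "(\<lambda>x. p (t, x)) \<in> borel_measurable borel" for t
    by (intro borel_measurable_continuous_onI g continuous_on_compose2[OF p(1)] continuous_intros; simp)+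
  show "integrable lborel (\<lambda>x. g (u t x) * p (t, x))"
    by (intro integrable_bounded_support[where B = "G0 * B0" and R = R]) (use gp u_bdd p(2) in auto)
  have p0: "p (t, x) = 0" if "x \<notin> {-\<bar>R\<bar>..\<bar>R\<bar>}" for t x using that by (intro p(2)) auto
  have "\<bar>\<integral>x. g (u t x) * p (t, x) \<partial>lborel\<bar> \<le> G0 * B0 * (\<bar>R\<bar> - - \<bar>R\<bar>)" for t
    by (rule abs_integral_bounded_support) (use gp u_bdd p0 in auto)
  then show "\<exists>B. \<forall>t. \<bar>\<integral>x. g (u t x) * p (t, x) \<partial>lborel\<bar> \<le> B" by blast
qed

lemma slice_continuous_mult:
  assumes p: "continuous_on UNIV p" "compact K" "\<And>z. z \<notin> K \<Longrightarrow> p z = (0 :: real)"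
    and g: "continuous_on UNIV g" "\<And>v v'. \<bar>v\<bar> \<le> M \<Longrightarrow> \<bar>v'\<bar> \<le> M \<Longrightarrow> \<bar>g v - g v'\<bar> \<le> C * \<bar>v - v'\<bar>"
  shows "continuous_on UNIV (\<lambda>t. \<integral>x. g (u t x) * p (t, x) \<partial>lborel)"
    and "integrable lborel (\<lambda>t. \<integral>x. g (u t x) * p (t, x) \<partial>lborel)"
    and "integrable lborel (\<lambda>x. g (u t x) * p (t, x))"
proof -
  obtain R where R: "0 \<le> R" "K \<subseteq> {-R..R} \<times> {-R..R}" using compact_subset_box[OF p(2)] .
  have p0: "p (t, x) = 0" if "R < \<bar>t\<bar> \<or> R < \<bar>x\<bar>" for t x
    using that R p(3) by fastforce
  obtain B0 where B0: "0 \<le> B0" "\<And>z. z \<in> K \<Longrightarrow> \<bar>p z\<bar> \<le> B0"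
    using continuous_on_compact_bdd[OF continuous_on_subset[OF p(1)] p(2)] by auto
  have B: "\<bar>p z\<bar> \<le> B0" for z using B0 p(3)[of z] by (cases "z \<in> K") auto
  note w = slice_continuous_bounded_weight[OF p(1) p0[OF disjI2] B g]
  show c: "continuous_on UNIV (\<lambda>t. \<integral>x. g (u t x) * p (t, x) \<partial>lborel)" by (rule w(1))
  show "integrable lborel (\<lambda>t. \<integral>x. g (u t x) * p (t, x) \<partial>lborel)"
    by (rule integrable_continuous_support[OF c, of R]) (simp add: p0)
  show "integrable lborel (\<lambda>x. g (u t x) * p (t, x))" by (rule w(2))
qed

lemma slice_continuous_weight:
  assumes g: "continuous_on UNIV g" "\<And>x. R < \<bar>x\<bar> \<Longrightarrow> g x = (0 :: real)"
    and h: "continuous_on UNIV h" "\<And>v v'. \<bar>v\<bar> \<le> M \<Longrightarrow> \<bar>v'\<bar> \<le> M \<Longrightarrow> \<bar>h v - h v'\<bar> \<le> C * \<bar>v - v'\<bar>"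
  shows "continuous_on UNIV (\<lambda>t. \<integral>x. h (u t x) * g x \<partial>lborel)"
    and "\<exists>B. \<forall>t. \<bar>\<integral>x. h (u t x) * g x \<partial>lborel\<bar> \<le> B"
    and "integrable lborel (\<lambda>x. h (u t x) * g x)"
proof -
  obtain B0 where B0: "0 \<le> B0" "\<And>x. x \<in> {-\<bar>R\<bar>..\<bar>R\<bar>} \<Longrightarrow> \<bar>g x\<bar> \<le> B0"
    using continuous_on_compact_bdd[OF continuous_on_subset[OF g(1)] compact_Icc] by auto
  have g0: "g x = 0" if "x \<notin> {-\<bar>R\<bar>..\<bar>R\<bar>}" for x using that by (intro g(2)) auto
  have B: "\<bar>g x\<bar> \<le> B0" for x using B0 g0[of x] by (cases "x \<in> {-\<bar>R\<bar>..\<bar>R\<bar>}") auto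
  have "continuous_on UNIV (\<lambda>z :: real \<times> real. g (snd z))"
    by (intro continuous_on_compose2[OF g(1)] continuous_intros) simp
  note w = slice_continuous_bounded_weight[of "\<lambda>z. g (snd z)", OF this _ _ h, of R B0, simplified]
  show "continuous_on UNIV (\<lambda>t. \<integral>x. h (u t x) * g x \<partial>lborel)"
    "\<exists>B. \<forall>t. \<bar>\<integral>x. h (u t x) * g x \<partial>lborel\<bar> \<le> B"
    "integrable lborel (\<lambda>x. h (u t x) * g x)"
    using w g(2) B by blast+
qed

end

section \<open>Bounded entropy solutions and their weak form\<close>

text \<open>The integral is iterated, with \<open>x\<close> inside, so that each time slice can be
  treated by the continuity statements of \<open>slices\<close>.\<close>

locale entropy_slices = convex_flux f c + slices u M for f c u M +
  fixes T :: real
  assumes T_pos: "0 < T"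
    and entropy: "has_C1_grad \<phi> p q \<Longrightarrow> compact K \<Longrightarrow> K \<subseteq> {0<..<T} \<times> UNIV \<Longrightarrow> (\<And>z. z \<notin> K \<Longrightarrow> \<phi> z = 0)
      \<Longrightarrow> (\<And>z. 0 \<le> \<phi> z) \<Longrightarrow>
      0 \<le> (\<integral>t. \<integral>x. \<bar>u t x - k\<bar> * p (t, x) + sgn (u t x - k) * (f (u t x) - f k) * q (t, x) \<partial>lborel \<partial>lborel)"
begin

lemma f_lip: "\<exists>\<Lambda>>0. \<forall>v v'. \<bar>v\<bar> \<le> M \<longrightarrow> \<bar>v'\<bar> \<le> M \<longrightarrow> \<bar>f v - f v'\<bar> \<le> \<Lambda> * \<bar>v - v'\<bar>"
proof -
  obtain \<Lambda> where \<Lambda>: "0 < \<Lambda>" "\<And>x. \<bar>x\<bar> \<le> M \<Longrightarrow> \<bar>deriv f x\<bar> \<le> \<Lambda>" using f'_bdd by blast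
  have "\<bar>f v - f v'\<bar> \<le> \<Lambda> * \<bar>v - v'\<bar>" if "\<bar>v\<bar> \<le> M" "\<bar>v'\<bar> \<le> M" for v v'
    by (rule f_lipschitz[OF _ that]) (rule \<Lambda>(2))
  with \<Lambda>(1) show ?thesis by blast
qed

text \<open>For the constants \<open>M + 1\<close> and \<open>- M - 1\<close> the sign of
  \<open>u - k\<close> never changes. The entropy inequality becomes linear in \<open>u\<close> and
  \<open>f u\<close>, and the two signs give both inequalities.\<close>

lemma weak_form_nonneg:
  assumes g: "has_C1_grad \<phi> p q" and K: "compact K" "K \<subseteq> {0<..<T} \<times> UNIV" "\<And>z. z \<notin> K \<Longrightarrow> \<phi> z = 0"
    and pos: "\<And>z. 0 \<le> \<phi> z"
  shows "(\<integral>t. (\<integral>x. u t x * p (t, x) \<partial>lborel) + (\<integral>x. f (u t x) * q (t, x) \<partial>lborel) \<partial>lborel) = 0"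
proof -
  have c: "continuous_on UNIV p" "continuous_on UNIV q" using g unfolding has_C1_grad_def by auto
  have 0: "p z = 0" "q z = 0" if "z \<notin> K" for z
    using has_C1_grad_eq_0[OF g compact_imp_closed[OF K(1)] K(3) that] by auto
  obtain \<Lambda> where "0 < \<Lambda>" and \<Lambda>: "\<And>v v'. \<bar>v\<bar> \<le> M \<Longrightarrow> \<bar>v'\<bar> \<le> M \<Longrightarrow> \<bar>f v - f v'\<bar> \<le> \<Lambda> * \<bar>v - v'\<bar>"
    using f_lip by blast
  have id: "continuous_on UNIV (\<lambda>v::real. v)" "continuous_on UNIV f" "continuous_on UNIV (\<lambda>v::real. 1::real)"
    by (intro continuous_intros)+
  note up = slice_continuous_mult[OF c(1) K(1) 0(1) id(1), of 1, simplified]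
  note fq = slice_continuous_mult[OF c(2) K(1) 0(2) id(2) \<Lambda>]
  note p1 = slice_continuous_mult[OF c(1) K(1) 0(1) id(3), of 1, simplified]
  note q1 = slice_continuous_mult[OF c(2) K(1) 0(2) id(3), of 1, simplified]
  have eq: "(\<integral>t. \<integral>x. \<bar>u t x - k\<bar> * p (t, x) + sgn (u t x - k) * (f (u t x) - f k) * q (t, x) \<partial>lborel \<partial>lborel)
      = \<sigma> * (\<integral>t. (\<integral>x. u t x * p (t, x) \<partial>lborel) + (\<integral>x. f (u t x) * q (t, x) \<partial>lborel) \<partial>lborel)"
    if \<sigma>: "\<And>t x. \<bar>u t x - k\<bar> = \<sigma> * (u t x - k)" "\<And>t x. sgn (u t x - k) = \<sigma>" for \<sigma> k
  proof -
    have "(\<integral>x. \<bar>u t x - k\<bar> * p (t, x) + sgn (u t x - k) * (f (u t x) - f k) * q (t, x) \<partial>lborel)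
       = \<sigma> * (((\<integral>x. u t x * p (t, x) \<partial>lborel) + (\<integral>x. f (u t x) * q (t, x) \<partial>lborel)) - k * (\<integral>x. p (t, x) \<partial>lborel))" for t
    proof -
      have "(\<integral>x. \<bar>u t x - k\<bar> * p (t, x) + sgn (u t x - k) * (f (u t x) - f k) * q (t, x) \<partial>lborel)
        = (\<integral>x. \<sigma> * (((u t x * p (t, x)) + (f (u t x) * q (t, x))) - (k * p (t, x) + f k * q (t, x))) \<partial>lborel)"
        unfolding \<sigma> by (intro Bochner_Integration.integral_cong) (auto simp: algebra_simps)
      also have "\<dots> = \<sigma> * (((\<integral>x. u t x * p (t, x) \<partial>lborel) + (\<integral>x. f (u t x) * q (t, x) \<partial>lborel))
          - (k * (\<integral>x. p (t, x) \<partial>lborel) + f k * (\<integral>x. q (t, x) \<partial>lborel)))"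
        using up(3)[of t] fq(3)[of t] p1(3)[of t] q1(3)[of t] by simp
      finally show ?thesis using iterated_integral_grad_eq_0(2)[OF g K(1,3)] by simp
    qed
    then show ?thesis
      using up(2) fq(2) p1(2) iterated_integral_grad_eq_0(1)[OF g K(1,3)] by simp
  qed
  have "\<bar>u t x - (M + 1)\<bar> = - 1 * (u t x - (M + 1))" "sgn (u t x - (M + 1)) = - 1"
    "\<bar>u t x - (- M - 1)\<bar> = 1 * (u t x - (- M - 1))" "sgn (u t x - (- M - 1)) = 1" for t x
    using u_bdd[of t x] by (auto simp: abs_le_iff sgn_if)
  then show ?thesis
    using entropy[OF g K pos, of "M + 1"] entropy[OF g K pos, of "- M - 1"]
      eq[of "M + 1" "- 1"] eq[of "- M - 1" 1] by simp
qed

lemma kern_limit: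
  assumes G: "continuous_on UNIV G" and B: "\<And>t. \<bar>G t\<bar> \<le> B" and d: "\<And>n. 0 < d n" "d \<longlonglongrightarrow> 0"
  shows "(\<lambda>n. \<integral>t. kern (d n) (t - s) * G t \<partial>lborel) \<longlonglongrightarrow> G s"
proof (rule LIMSEQ_I)
  fix e :: real assume "0 < e"
  have [measurable]: "G \<in> borel_measurable borel" using G by (rule borel_measurable_continuous_onI)
  have "isCont G s" using G by (simp add: continuous_on_eq_continuous_at)
  then obtain r where r: "0 < r" "\<And>t. \<bar>t - s\<bar> < r \<Longrightarrow> \<bar>G t - G s\<bar> < e / 2"
    using \<open>0 < e\<close> unfolding continuous_at_eps_delta dist_real_def by (metis half_gt_zero)
  have "\<forall>\<^sub>F n in sequentially. d n < r" using d(2) r(1) by (rule order_tendstoD)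
  then obtain n0 where n0: "\<And>n. n0 \<le> n \<Longrightarrow> d n < r" by (auto simp: eventually_sequentially)
  show "\<exists>no. \<forall>n\<ge>no. norm ((\<integral>t. kern (d n) (t - s) * G t \<partial>lborel) - G s) < e"
  proof (intro exI allI impI)
    fix n assume n: "n0 \<le> n"
    interpret mollifier "kern (d n)" "d n" by (rule mollifier_kern[OF d(1)])
    have k: "integrable lborel (\<lambda>t. kern (d n) (t - s))" by (rule integrable_K)
    have kG: "integrable lborel (\<lambda>t. kern (d n) (t - s) * G t)"
      using B by (intro Bochner_Integration.integrable_bound[OF integrable_mult_right[OF k, of B]] AE_I2)
        (auto simp: abs_mult mult.commute[of "kern _ _"] K_nonneg intro!: mult_right_mono order_trans[OF B] abs_ge_self)
    have "(\<integral>t. kern (d n) (t - s) * G t \<partial>lborel) - G s = (\<integral>t. kern (d n) (t - s) * G t - kern (d n) (t - s) * G s \<partial>lborel)"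
      using k kG K_int'[of s] by simp
    also have "norm \<dots> \<le> (\<integral>t. kern (d n) (t - s) * (e / 2) \<partial>lborel)"
    proof (rule Bochner_Integration.integral_norm_bound_integral)
      fix t
      show "norm (kern (d n) (t - s) * G t - kern (d n) (t - s) * G s) \<le> kern (d n) (t - s) * (e / 2)"
      proof (cases "t - s \<in> {0..d n}")
        case True
        then have "\<bar>G t - G s\<bar> \<le> e / 2" using n0[OF n] by (intro less_imp_le r(2)) auto
        then have "kern (d n) (t - s) * \<bar>G t - G s\<bar> \<le> kern (d n) (t - s) * (e / 2)"
          using K_nonneg[of "t - s"] by (intro mult_left_mono)
        then show ?thesis using K_nonneg[of "t - s"]
          by (simp add: abs_mult flip: right_diff_distrib)
      qed (simp add: K_supp)
    qed (use k kG in auto)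
    also have "\<dots> = e / 2" using K_int'[of s] by simp
    finally show "norm ((\<integral>t. kern (d n) (t - s) * G t \<partial>lborel) - G s) < e" using \<open>0 < e\<close> by linarith
  qed
qed

text \<open>The test function is \<open>\<tau> n r * g x\<close>, where \<open>\<tau> n\<close>
  rises from 0 to 1 just after \<open>s\<close> and falls back just after \<open>t\<close>. Its time
  derivative tends to the difference of the point masses at \<open>s\<close> and
  \<open>t\<close>.\<close>

lemma weak_form_time_nonneg:
  assumes g': "\<And>x. (g has_real_derivative g' x) (at x)" "continuous_on UNIV g'"
    and supp: "\<And>x. R < \<bar>x\<bar> \<Longrightarrow> g x = 0" and pos: "\<And>x. 0 \<le> g x"
    and st: "0 < s" "s \<le> t" "t < T"
  shows "(\<integral>x. u t x * g x \<partial>lborel) - (\<integral>x. u s x * g x \<partial>lborel) = integral {s..t} (\<lambda>r. \<integral>x. f (u r x) * g' x \<partial>lborel)"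
proof -
  have R0: "0 \<le> \<bar>R\<bar>" "\<And>x. \<bar>R\<bar> < \<bar>x\<bar> \<Longrightarrow> g x = 0" using supp by auto
  have supp': "g' x = 0" if "\<bar>R\<bar> < \<bar>x\<bar>" for x
  proof -
    have "(g has_real_derivative 0) (at x)"
    proof (rule has_field_derivative_transform_within_open[of "\<lambda>_. 0" 0 x "- {-\<bar>R\<bar>..\<bar>R\<bar>}"])
      show "0 = g y" if "y \<in> - {-\<bar>R\<bar>..\<bar>R\<bar>}" for y
        using that by (intro R0(2)[symmetric]) auto
    qed (use that in auto)
    with g'(1)[of x] show ?thesis by (rule DERIV_unique)
  qed
  have gc: "continuous_on UNIV g" by (rule DERIV_continuous_on[OF has_field_derivative_at_within[OF g'(1)]])
  obtain \<Lambda> where "0 < \<Lambda>" and \<Lambda>: "\<And>v v'. \<bar>v\<bar> \<le> M \<Longrightarrow> \<bar>v'\<bar> \<le> M \<Longrightarrow> \<bar>f v - f v'\<bar> \<le> \<Lambda> * \<bar>v - v'\<bar>"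
    using f_lip by blast
  define G where "G t = (\<integral>x. u t x * g x \<partial>lborel)" for t
  define F where "F t = (\<integral>x. f (u t x) * g' x \<partial>lborel)" for t
  have G: "continuous_on UNIV G"
    unfolding G_def by (rule slice_continuous_weight(1)[where h = "\<lambda>v. v" and C = 1, OF gc supp]) (auto intro: continuous_intros)
  have F: "continuous_on UNIV F"
    unfolding F_def by (rule slice_continuous_weight(1)[OF g'(2) supp' _ \<Lambda>]) (auto intro: continuous_intros)
  obtain BG where GB: "\<And>r. \<bar>G r\<bar> \<le> BG"
    using slice_continuous_weight(2)[where h = "\<lambda>v. v" and C = 1, OF gc supp] unfolding G_def by (auto intro: continuous_intros)
  obtain BF where FB: "\<And>r. \<bar>F r\<bar> \<le> BF"
    using slice_continuous_weight(2)[OF g'(2) supp' continuous_f[OF continuous_on_id] \<Lambda>] unfolding F_def by (auto intro: continuous_intros)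
  \<comment> \<open>The denominator starts at 2, so that the falling edge on
    \<open>{t..t + d n}\<close> stays below \<open>T\<close> for every \<open>n\<close>, including
    0.\<close>
  define d where "d n = (T - t) / real (n + 2)" for n
  have d_pos: "0 < d n" for n using st by (simp add: d_def)
  have d_lt: "t + d n < T" for n
  proof -
    have "(T - t) * 1 < (T - t) * real (n + 2)" using st by (intro mult_strict_left_mono) auto
    then have "d n < T - t" unfolding d_def by (simp add: pos_divide_less_eq)
    then show ?thesis by simp
  qed
  have d0: "d \<longlonglongrightarrow> 0" unfolding d_def by (rule LIMSEQ_ignore_initial_segment[OF lim_const_over_n])
  define \<tau> where "\<tau> n r = step ((r - s) / d n) - step ((r - t) / d n)" for n r
  have eq: "(\<integral>r. kern (d n) (r - s) * G r \<partial>lborel) - (\<integral>r. kern (d n) (r - t) * G r \<partial>lborel)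
      + (\<integral>r. \<tau> n r * F r \<partial>lborel) = 0" for n
  proof -
    have \<tau>0: "\<tau> n r = 0" if "r \<notin> {s..t + d n}" for r
      using that st d_pos[of n]
      by (cases "r < s") (auto simp: \<tau>_def step_eq_0 step_eq_1 divide_le_0_iff le_divide_eq)
    have \<tau>p: "0 \<le> \<tau> n r" for r
      unfolding \<tau>_def using st d_pos[of n] by (simp add: step_mono divide_right_mono)
    have \<tau>d: "(\<tau> n has_real_derivative kern (d n) (r - s) - kern (d n) (r - t)) (at r)" for r
      unfolding \<tau>_def kern_def using d_pos[of n] by (auto intro!: derivative_eq_intros)
    have \<tau>c: "continuous_on UNIV (\<tau> n)" by (rule DERIV_continuous_on[OF has_field_derivative_at_within[OF \<tau>d]])
    have grad: "has_C1_grad (\<lambda>z. \<tau> n (fst z) * g (snd z))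
      (\<lambda>z. (kern (d n) (fst z - s) - kern (d n) (fst z - t)) * g (snd z)) (\<lambda>z. \<tau> n (fst z) * g' (snd z))"
      unfolding has_C1_grad_def
    proof (intro conjI allI)
      fix z :: "real \<times> real"
      have 1: "((\<lambda>z. \<tau> n (fst z)) has_derivative (\<lambda>h. (kern (d n) (fst z - s) - kern (d n) (fst z - t)) * fst h)) (at z)"
        by (rule has_derivative_compose[of fst fst, OF _ \<tau>d[unfolded has_field_derivative_def]])
          (auto intro!: derivative_eq_intros)
      have 2: "((\<lambda>z. g (snd z)) has_derivative (\<lambda>h. g' (snd z) * snd h)) (at z)"
        by (rule has_derivative_compose[of snd snd, OF _ g'(1)[unfolded has_field_derivative_def]])
          (auto intro!: derivative_eq_intros)
      show "((\<lambda>z. \<tau> n (fst z) * g (snd z)) has_derivative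
         (\<lambda>h. (kern (d n) (fst z - s) - kern (d n) (fst z - t)) * g (snd z) * fst h + \<tau> n (fst z) * g' (snd z) * snd h)) (at z)"
        by (rule has_derivative_eq_rhs[OF has_derivative_mult[OF 1 2]]) (auto simp: algebra_simps)
    qed (use d_pos[of n] in \<open>auto intro!: continuous_intros continuous_on_compose2[OF gc] continuous_on_compose2[OF \<tau>c] continuous_on_compose2[OF g'(2)]\<close>)
    have K: "compact ({s..t + d n} \<times> {-\<bar>R\<bar>..\<bar>R\<bar>})" "{s..t + d n} \<times> {-\<bar>R\<bar>..\<bar>R\<bar>} \<subseteq> {0<..<T} \<times> UNIV"
      using st d_lt[of n] by (auto intro: compact_Times)
    have K0: "\<tau> n (fst z) * g (snd z) = 0" if "z \<notin> {s..t + d n} \<times> {-\<bar>R\<bar>..\<bar>R\<bar>}" for z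
      using that \<tau>0[of "fst z"] R0(2)[of "snd z"] by (cases z) (auto simp: abs_le_iff not_le)
    have i: "integrable lborel (\<lambda>r. kern (d n) (r - s) * G r)" "integrable lborel (\<lambda>r. kern (d n) (r - t) * G r)"
      "integrable lborel (\<lambda>r. \<tau> n r * F r)"
    proof -
      have *: "integrable lborel h" if "continuous_on UNIV h" "\<And>r. r \<notin> {s..t + d n} \<Longrightarrow> h r = 0" for h :: "real \<Rightarrow> real"
        by (rule integrable_continuous_support[OF that(1), of T], rule that(2)) (use st d_lt[of n] in auto)
      show "integrable lborel (\<lambda>r. kern (d n) (r - s) * G r)"
        by (rule *) (use d_pos[of n] st G in \<open>auto intro!: continuous_intros kern_eq_0\<close>)
      show "integrable lborel (\<lambda>r. kern (d n) (r - t) * G r)"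
        by (rule *) (use d_pos[of n] st G in \<open>auto intro!: continuous_intros kern_eq_0\<close>)
      show "integrable lborel (\<lambda>r. \<tau> n r * F r)"
        by (rule *) (use \<tau>0 \<tau>c F in \<open>auto intro!: continuous_intros\<close>)
    qed
    have "0 = (\<integral>r. (\<integral>x. u r x * ((kern (d n) (r - s) - kern (d n) (r - t)) * g x) \<partial>lborel)
       + (\<integral>x. f (u r x) * (\<tau> n r * g' x) \<partial>lborel) \<partial>lborel)"
      using weak_form_nonneg[OF grad K K0] \<tau>p pos by simp
    also have "\<dots> = (\<integral>r. (kern (d n) (r - s) * G r - kern (d n) (r - t) * G r) + \<tau> n r * F r \<partial>lborel)"
    proof (intro Bochner_Integration.integral_cong refl arg_cong2[where f = "(+)"])
      fix r
      have "(\<integral>x. u r x * ((kern (d n) (r - s) - kern (d n) (r - t)) * g x) \<partial>lborel)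
         = (\<integral>x. (kern (d n) (r - s) - kern (d n) (r - t)) * (u r x * g x) \<partial>lborel)"
        by (simp add: mult_ac)
      also have "\<dots> = (kern (d n) (r - s) - kern (d n) (r - t)) * G r"
        unfolding G_def by (rule integral_mult_right_zero)
      finally show "(\<integral>x. u r x * ((kern (d n) (r - s) - kern (d n) (r - t)) * g x) \<partial>lborel)
         = kern (d n) (r - s) * G r - kern (d n) (r - t) * G r"
        by (simp add: left_diff_distrib)
      have "(\<integral>x. f (u r x) * (\<tau> n r * g' x) \<partial>lborel) = (\<integral>x. \<tau> n r * (f (u r x) * g' x) \<partial>lborel)"
        by (simp add: mult_ac)
      then show "(\<integral>x. f (u r x) * (\<tau> n r * g' x) \<partial>lborel) = \<tau> n r * F r" by (simp add: F_def)
    qed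
    finally show ?thesis using i by simp
  qed
  have [measurable]: "F \<in> borel_measurable borel" "\<tau> n \<in> borel_measurable borel" for n
    unfolding \<tau>_def using F by (auto intro!: borel_measurable_continuous_onI)
  have "(\<lambda>n. \<integral>r. \<tau> n r * F r \<partial>lborel) \<longlonglongrightarrow> (\<integral>r. indicator {s..t} r * F r \<partial>lborel)"
  proof (rule integral_tendsto_bounded_support[where B = "1 * BF" and R = T])
    fix n r
    have "\<bar>\<tau> n r\<bar> \<le> 1" using step_range[of "(r - s) / d n"] step_range[of "(r - t) / d n"] by (auto simp: \<tau>_def)
    then show "\<bar>\<tau> n r * F r\<bar> \<le> 1 * BF"
      unfolding abs_mult by (intro mult_mono FB) auto
    show "\<tau> n r * F r = 0" if "T < \<bar>r\<bar>"
      using that st d_lt[of n] d_pos[of n]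
      by (cases "r < s") (auto simp: \<tau>_def step_eq_0 step_eq_1 divide_le_0_iff le_divide_eq)
  next
    \<comment> \<open>At the edges themselves the limit of \<open>\<tau> n\<close> differs from the
      indicator.\<close>
    have "AE r in lborel. r \<noteq> s \<and> r \<noteq> t" using AE_lborel_singleton[of s] AE_lborel_singleton[of t] by eventually_elim auto
    then show "AE r in lborel. (\<lambda>n. \<tau> n r * F r) \<longlonglongrightarrow> indicator {s..t} r * F r"
    proof eventually_elim
      case (elim r)
      have *: "(\<lambda>n. step ((r - a) / d n)) \<longlonglongrightarrow> (if a < r then 1 else 0)" if "r \<noteq> a" for a
      proof (cases "a < r")
        case True
        then have "\<forall>\<^sub>F n in sequentially. d n < r - a" using d0 by (intro order_tendstoD) auto
        then have "\<forall>\<^sub>F n in sequentially. step ((r - a) / d n) = 1"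
          by eventually_elim (use d_pos in \<open>auto intro!: step_eq_1 simp: le_divide_eq\<close>)
        then show ?thesis using True by (auto intro: tendsto_eventually)
      next
        case False
        then show ?thesis using d_pos that by (auto simp: step_eq_0 divide_le_0_iff less_imp_le)
      qed
      have "(\<lambda>n. \<tau> n r * F r) \<longlonglongrightarrow> ((if s < r then 1 else 0) - (if t < r then 1 else 0)) * F r"
        unfolding \<tau>_def using elim by (intro tendsto_intros *) auto
      moreover have "((if s < r then 1 else 0) - (if t < r then 1 else 0)) = (indicator {s..t} r :: real)"
        using elim st by (auto simp: indicator_def)
      ultimately show ?case by simp
    qed
  qed auto
  then have "(\<lambda>n. (\<integral>r. kern (d n) (r - s) * G r \<partial>lborel) - (\<integral>r. kern (d n) (r - t) * G r \<partial>lborel)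
      + (\<integral>r. \<tau> n r * F r \<partial>lborel)) \<longlonglongrightarrow> G s - G t + (\<integral>r. indicator {s..t} r * F r \<partial>lborel)"
    by (intro tendsto_intros kern_limit[OF G GB d_pos d0])
  then have "G s - G t + (\<integral>r. indicator {s..t} r * F r \<partial>lborel) = 0"
    unfolding eq by (simp add: LIMSEQ_const_iff)
  moreover have "(\<integral>r. indicator {s..t} r * F r \<partial>lborel) = integral {s..t} F"
    using set_borel_integral_eq_integral(2)[OF borel_integrable_atLeastAtMost'[OF continuous_on_subset[OF F subset_UNIV]]]
    unfolding set_lebesgue_integral_def by simp
  ultimately show ?thesis unfolding G_def F_def by simp
qed

end

section \<open>The potential of an entropy solution\<close>

lemma bump_uminus_supp: "1 < \<bar>x\<bar> \<Longrightarrow> bump (- x) = 0"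
  by (intro bump_eq_0) auto

lemma continuous_bump_uminus: "continuous_on UNIV (\<lambda>x. bump (- x))"
  by (intro continuous_intros)

lemma step_lipschitz: "\<bar>step x - step y\<bar> \<le> 2 * \<bar>x - y\<bar>"
proof -
  have "norm (step x - step y) \<le> 2 * norm (x - y)"
    by (rule field_differentiable_bound[of UNIV step bump 2])
      (use step_has_derivative bump_le bump_nonneg in auto)
  then show ?thesis by simp
qed

lemma step_diff_eq_0:
  assumes "0 < d" "\<bar>x\<bar> \<le> R" "R + d + 1 < \<bar>y\<bar>"
  shows "step ((x - y) / d) - step (- y) = 0"
proof -
  consider "R + d + 1 < y" | "y < - (R + d + 1)" using assms(3) by linarith
  then show ?thesis
  proof cases
    case 1
    then show ?thesis using assms by (simp add: step_eq_0 divide_le_0_iff)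
  next
    case 2
    then show ?thesis using assms by (simp add: step_eq_1 le_divide_eq)
  qed
qed

context entropy_slices
begin

text \<open>Both restrictions of \<open>weak_form_time_nonneg\<close> are lifted: the end times by
  continuity, the sign of \<open>g\<close> by adding a nonnegative plateau and subtracting the
  identity for the plateau alone.\<close>

lemma weak_form_time:
  assumes g': "\<And>x. (g has_real_derivative g' x) (at x)" "continuous_on UNIV g'"
    and supp: "\<And>x. R < \<bar>x\<bar> \<Longrightarrow> g x = 0" and st: "0 \<le> s" "s \<le> t" "t \<le> T"
  shows "(\<integral>x. u t x * g x \<partial>lborel) - (\<integral>x. u s x * g x \<partial>lborel) = integral {s..t} (\<lambda>r. \<integral>x. f (u r x) * g' x \<partial>lborel)"
proof -
  obtain \<Lambda> where "0 < \<Lambda>" and \<Lambda>: "\<And>v v'. \<bar>v\<bar> \<le> M \<Longrightarrow> \<bar>v'\<bar> \<le> M \<Longrightarrow> \<bar>f v - f v'\<bar> \<le> \<Lambda> * \<bar>v - v'\<bar>"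
    using f_lip by blast
  have main: "(\<integral>x. u t x * g x \<partial>lborel) - (\<integral>x. u s x * g x \<partial>lborel) = integral {s..t} (\<lambda>r. \<integral>x. f (u r x) * g' x \<partial>lborel)"
    if g': "\<And>x. (g has_real_derivative g' x) (at x)" "continuous_on UNIV g'"
    and supp: "\<And>x. R < \<bar>x\<bar> \<Longrightarrow> g x = 0" "\<And>x. R < \<bar>x\<bar> \<Longrightarrow> g' x = 0" and pos: "\<And>x. 0 \<le> g x" for g g' R
  proof -
    define G where "G t = (\<integral>x. u t x * g x \<partial>lborel)" for t
    define F where "F t = (\<integral>x. f (u t x) * g' x \<partial>lborel)" for t
    have gc: "continuous_on UNIV g" by (rule DERIV_continuous_on[OF has_field_derivative_at_within[OF g'(1)]])
    have Gc: "continuous_on UNIV G"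
      unfolding G_def by (rule slice_continuous_weight(1)[where h = "\<lambda>v. v" and C = 1, OF gc supp(1)]) (auto intro: continuous_intros)
    have Fc: "continuous_on S F" for S
      unfolding F_def by (rule continuous_on_subset[OF slice_continuous_weight(1)[OF g'(2) supp(2) _ \<Lambda>]]) (auto intro: continuous_intros)
    \<comment> \<open>Constant on \<open>{0<..<T}\<close> by the previous lemma and continuous on
      the closed interval, hence constant there too.\<close>
    define N where "N r = G r - integral {0..r} F" for r
    have eq: "N r = N (T/2)" if "r \<in> {0..T}" for r
    proof -
      have *: "N r = N r'" if "0 < r" "r \<le> r'" "r' < T" for r r'
      proof -
        have "G r' - G r = integral {r..r'} F"
          using weak_form_time_nonneg[OF g' supp(1) pos that] unfolding G_def F_def by simp
        moreover have "integral {0..r} F + integral {r..r'} F = integral {0..r'} F"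
          using that Fc by (intro Henstock_Kurzweil_Integration.integral_combine integrable_continuous_real) auto
        ultimately show ?thesis unfolding N_def by linarith
      qed
      have "N r = N (T/2)" if "r \<in> {0<..<T}" for r
        using *[of r "T/2"] *[of "T/2" r] that T_pos by (cases "r \<le> T/2") auto
      moreover have "closure {0<..<T} = {0..T}" using T_pos by simp
      moreover have "continuous_on {0..T} N"
        unfolding N_def
      proof (intro continuous_on_diff continuous_on_subset[OF Gc])
        show "continuous_on {0..T} (\<lambda>r. integral {0..r} F)"
          by (rule indefinite_integral_continuous_1[OF integrable_continuous_real[OF Fc]])
      qed auto
      ultimately show ?thesis
        using continuous_constant_on_closure[of "{0<..<T}" N "N (T/2)" r] that by metis
    qed
    have "N t = N s" using eq[of t] eq[of s] st by simp
    moreover have "integral {0..s} F + integral {s..t} F = integral {0..t} F"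
      using st Fc by (intro Henstock_Kurzweil_Integration.integral_combine integrable_continuous_real) auto
    ultimately show ?thesis unfolding N_def G_def F_def by linarith
  qed
  have gc: "continuous_on UNIV g" by (rule DERIV_continuous_on[OF has_field_derivative_at_within[OF g'(1)]])
  define R' where "R' = \<bar>R\<bar>"
  have supp0: "g x = 0" if "R' < \<bar>x\<bar>" for x using that supp by (simp add: R'_def)
  have supp': "g' x = 0" if "R' < \<bar>x\<bar>" for x
  proof -
    have "(g has_real_derivative 0) (at x)"
    proof (rule has_field_derivative_transform_within_open[of "\<lambda>_. 0" 0 x "- {-R'..R'}"])
      show "0 = g y" if "y \<in> - {-R'..R'}" for y
        using that by (intro supp0[symmetric]) auto
    qed (use that in auto)
    with g'(1)[of x] show ?thesis by (rule DERIV_unique)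
  qed
  obtain B where B: "0 \<le> B" "\<And>x. x \<in> {-R'..R'} \<Longrightarrow> \<bar>g x\<bar> \<le> B"
    using continuous_on_compact_bdd[OF continuous_on_subset[OF gc] compact_Icc] by auto
  \<comment> \<open>A plateau of height \<open>B\<close> over the support of \<open>g\<close>, so
    that both \<open>h\<close> and \<open>g + h\<close> are nonnegative.\<close>
  define h where "h x = B * (step (x + R' + 1) - step (x - R'))" for x
  define h' where "h' x = B * (bump (x + R' + 1) - bump (x - R'))" for x
  have h': "(h has_real_derivative h' x) (at x)" for x
    unfolding h_def h'_def by (auto intro!: derivative_eq_intros)
  have h'c: "continuous_on UNIV h'" unfolding h'_def by (intro continuous_intros)
  have R'0: "0 \<le> R'" by (simp add: R'_def)
  have hs: "h x = 0" if "R' + 1 < \<bar>x\<bar>" for x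
    using that R'0 by (cases "x < 0") (auto simp: h_def step_eq_0 step_eq_1)
  have hs': "h' x = 0" if "R' + 1 < \<bar>x\<bar>" for x
    using that R'0 bump_eq_0[of "x + R' + 1"] bump_eq_0[of "x - R'"] by (cases "x < 0") (auto simp: h'_def)
  have hp: "0 \<le> h x" for x
    unfolding h_def using B(1) R'0 by (intro mult_nonneg_nonneg) (auto simp: step_mono)
  have hB: "h x = B" if "x \<in> {-R'..R'}" for x
    using that by (simp add: h_def step_eq_0 step_eq_1)
  have ghp: "0 \<le> g x + h x" for x
  proof (cases "x \<in> {-R'..R'}")
    case True
    then show ?thesis using B(2)[OF True] hB[OF True] by linarith
  next
    case False
    then have "g x = 0" by (intro supp0) auto
    then show ?thesis using hp by simp
  qed
  have m1: "(\<integral>x. u t x * (g x + h x) \<partial>lborel) - (\<integral>x. u s x * (g x + h x) \<partial>lborel)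
      = integral {s..t} (\<lambda>r. \<integral>x. f (u r x) * (g' x + h' x) \<partial>lborel)"
    by (rule main[where R = "R' + 1"])
      (use g' h' h'c supp0 supp' hs hs' ghp in \<open>auto intro!: derivative_eq_intros continuous_intros\<close>)
  have m2: "(\<integral>x. u t x * h x \<partial>lborel) - (\<integral>x. u s x * h x \<partial>lborel)
      = integral {s..t} (\<lambda>r. \<integral>x. f (u r x) * h' x \<partial>lborel)"
    by (rule main[where R = "R' + 1"]) (use h' h'c hs hs' hp in auto)
  have hc: "continuous_on UNIV h" by (rule DERIV_continuous_on[OF has_field_derivative_at_within[OF h']])
  have s1: "(\<integral>x. u r x * (g x + h x) \<partial>lborel) = (\<integral>x. u r x * g x \<partial>lborel) + (\<integral>x. u r x * h x \<partial>lborel)" for r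
    using slice_continuous_weight(3)[where h = "\<lambda>v. v" and C = 1, OF gc supp0]
      slice_continuous_weight(3)[where h = "\<lambda>v. v" and C = 1, OF hc hs] by (simp add: distrib_left)
  have s2: "(\<integral>x. f (u r x) * (g' x + h' x) \<partial>lborel) = (\<integral>x. f (u r x) * g' x \<partial>lborel) + (\<integral>x. f (u r x) * h' x \<partial>lborel)" for r
    using slice_continuous_weight(3)[OF g'(2) supp' continuous_f[OF continuous_on_id] \<Lambda>]
      slice_continuous_weight(3)[OF h'c hs' continuous_f[OF continuous_on_id] \<Lambda>] by (simp add: distrib_left)
  have "integral {s..t} (\<lambda>r. (\<integral>x. f (u r x) * g' x \<partial>lborel) + (\<integral>x. f (u r x) * h' x \<partial>lborel))
    = integral {s..t} (\<lambda>r. \<integral>x. f (u r x) * g' x \<partial>lborel) + integral {s..t} (\<lambda>r. \<integral>x. f (u r x) * h' x \<partial>lborel)"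
    by (intro Henstock_Kurzweil_Integration.integral_add integrable_continuous_real
        continuous_on_subset[OF slice_continuous_weight(1)[OF g'(2) supp' _ \<Lambda>]]
        continuous_on_subset[OF slice_continuous_weight(1)[OF h'c hs' _ \<Lambda>]]) (auto intro: continuous_intros)
  then show ?thesis using m1 m2 unfolding s1 s2 by linarith
qed

text \<open>The flux up to time \<open>t\<close> through a smeared cross-section between -1 and 0.
  There the weight \<open>step (- y)\<close> of \<open>V\<close> falls from 1 to 0; subtracting
  \<open>base t\<close> removes its contribution to the time derivative, so that exactly
  \<open>- f u\<close> remains.\<close>

definition base :: "real \<Rightarrow> real" where
  "base t = integral {0..t} (\<lambda>r. \<integral>y. f (u r y) * bump (- y) \<partial>lborel)"

text \<open>A primitive of \<open>u t\<close> in \<open>x\<close>. As \<open>u t\<close> need not be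
  integrable near minus infinity, the half-line is cut off by \<open>step (- y)\<close>; the
  difference of the two weights has bounded support.\<close>

definition V :: "real \<Rightarrow> real \<Rightarrow> real" where
  "V t x = (\<integral>y. u t y * (indicator {..<x} y - step (- y)) \<partial>lborel) - base t"

text \<open>The jump of the weight at \<open>x\<close> is spread over \<open>{x - d..x}\<close>.
  Smoothing in space suffices, since the equation itself turns the time derivative into the average
  \<open>- fd\<close>.\<close>

definition Vd :: "real \<Rightarrow> real \<Rightarrow> real \<Rightarrow> real" where
  "Vd d t x = (\<integral>y. u t y * (step ((x - y) / d) - step (- y)) \<partial>lborel) - base t"

definition ud :: "real \<Rightarrow> real \<Rightarrow> real \<Rightarrow> real" where
  "ud d t x = (\<integral>y. u t y * kern d (x - y) \<partial>lborel)"

definition fd :: "real \<Rightarrow> real \<Rightarrow> real \<Rightarrow> real" where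
  "fd d t x = (\<integral>y. f (u t y) * kern d (x - y) \<partial>lborel)"

lemma kern_supp: "0 < d \<Longrightarrow> \<bar>x\<bar> + d < \<bar>y\<bar> \<Longrightarrow> kern d (x - y) = 0"
  by (intro kern_eq_0) auto

lemma continuous_fd_t: assumes "0 < d" shows "continuous_on S (\<lambda>t. fd d t x)"
proof -
  obtain \<Lambda> where "0 < \<Lambda>" and \<Lambda>: "\<And>v v'. \<bar>v\<bar> \<le> M \<Longrightarrow> \<bar>v'\<bar> \<le> M \<Longrightarrow> \<bar>f v - f v'\<bar> \<le> \<Lambda> * \<bar>v - v'\<bar>"
    using f_lip by blast
  have "continuous_on UNIV (\<lambda>y. kern d (x - y))" using assms by (intro continuous_intros)
  from slice_continuous_weight(1)[OF this kern_supp[OF assms] continuous_f[OF continuous_on_id] \<Lambda>]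
  show ?thesis unfolding fd_def by (auto intro: continuous_on_subset)
qed

text \<open>The weak form is tested with the weight that defines \<open>Vd\<close>; its derivative
  is \<open>bump (- y) - kern d (x - y)\<close>, and \<open>base\<close> absorbs the first
  part.\<close>

lemma Vd_t:
  assumes d: "0 < d" and st: "0 \<le> s" "s \<le> t" "t \<le> T"
  shows "Vd d t x - Vd d s x = - integral {s..t} (\<lambda>r. fd d r x)"
proof -
  obtain \<Lambda> where "0 < \<Lambda>" and \<Lambda>: "\<And>v v'. \<bar>v\<bar> \<le> M \<Longrightarrow> \<bar>v'\<bar> \<le> M \<Longrightarrow> \<bar>f v - f v'\<bar> \<le> \<Lambda> * \<bar>v - v'\<bar>"
    using f_lip by blast
  let ?B = "\<lambda>r. \<integral>y. f (u r y) * bump (- y) \<partial>lborel"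
  have Bc: "continuous_on S ?B" for S
    using slice_continuous_weight(1)[OF continuous_bump_uminus bump_uminus_supp continuous_f[OF continuous_on_id] \<Lambda>]
    by (auto intro: continuous_on_subset)
  have D: "((\<lambda>y. step ((x - y) / d) - step (- y)) has_real_derivative bump (- y) - kern d (x - y)) (at y)" for y
    unfolding kern_def using d by (auto intro!: derivative_eq_intros)
  have 1: "(\<integral>y. u t y * (step ((x - y) / d) - step (- y)) \<partial>lborel) - (\<integral>y. u s y * (step ((x - y) / d) - step (- y)) \<partial>lborel)
      = integral {s..t} (\<lambda>r. \<integral>y. f (u r y) * (bump (- y) - kern d (x - y)) \<partial>lborel)"
    by (rule weak_form_time[OF D _ step_diff_eq_0[OF d order_refl] st]) (use d in \<open>auto intro!: continuous_intros\<close>)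
  obtain B where B: "0 \<le> B" "\<And>v. \<bar>v\<bar> \<le> M \<Longrightarrow> \<bar>f v\<bar> \<le> B" using f_bdd by blast
  have 2: "(\<integral>y. f (u r y) * (bump (- y) - kern d (x - y)) \<partial>lborel) = ?B r - fd d r x" for r
  proof -
    have "integrable lborel (\<lambda>y. f (u r y) * bump (- y))"
      by (rule integrable_bounded_support[where B = "B * 2" and R = 1])
        (use B u_bdd bump_le bump_nonneg bump_uminus_supp in \<open>auto simp: abs_mult intro!: mult_mono\<close>)
    moreover have "integrable lborel (\<lambda>y. f (u r y) * kern d (x - y))"
      by (rule mollifier.integrable_mult_K[OF mollifier_kern[OF d], of _ B]) (use B u_bdd in auto)
    ultimately show ?thesis unfolding fd_def by (simp add: right_diff_distrib)
  qed
  have "integral {s..t} (\<lambda>r. ?B r - fd d r x) = integral {s..t} ?B - integral {s..t} (\<lambda>r. fd d r x)"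
    by (intro Henstock_Kurzweil_Integration.integral_diff integrable_continuous_real Bc continuous_fd_t d)
  moreover have "base s + integral {s..t} ?B = base t"
    unfolding base_def using st by (intro Henstock_Kurzweil_Integration.integral_combine integrable_continuous_real Bc) auto
  ultimately show ?thesis using 1 unfolding 2 Vd_def by linarith
qed

text \<open>Joint continuity holds although \<open>u\<close> may have shocks: in \<open>x\<close>
  the kernel is continuous, and in \<open>t\<close> the L^1 continuity of the slices is
  enough.\<close>

lemma continuous_kern_average:
  assumes d: "0 < d" and h: "continuous_on UNIV h" "\<And>v v'. \<bar>v\<bar> \<le> M \<Longrightarrow> \<bar>v'\<bar> \<le> M \<Longrightarrow> \<bar>h v - h v'\<bar> \<le> C * \<bar>v - v'\<bar>"
  shows "continuous_on UNIV (\<lambda>(t, x). \<integral>y. h (u t y) * kern d (x - y) \<partial>lborel)"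
  unfolding continuous_on_sequentially comp_def
proof (intro allI ballI impI, elim conjE)
  fix X :: "nat \<Rightarrow> real \<times> real" and z assume X: "X \<longlonglongrightarrow> z"
  have s: "(\<lambda>n. fst (X n)) \<longlonglongrightarrow> fst z" and x: "(\<lambda>n. snd (X n)) \<longlonglongrightarrow> snd z"
    using tendsto_fst[OF X] tendsto_snd[OF X] by auto
  obtain R where R: "\<And>n. \<bar>snd (X n)\<bar> \<le> R"
    using convergent_imp_Bseq[OF convergentI[OF x]] unfolding Bseq_def by auto
  have [measurable]: "h \<in> borel_measurable borel" using h(1) by (rule borel_measurable_continuous_onI)
  obtain H0 where H0: "0 \<le> H0" "\<And>v. v \<in> {-M..M} \<Longrightarrow> \<bar>h v\<bar> \<le> H0"
    using continuous_on_compact_bdd[OF continuous_on_subset[OF h(1)] compact_Icc] by auto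
  have H: "\<bar>h v\<bar> \<le> H0" if "\<bar>v\<bar> \<le> M" for v using that by (intro H0(2)) auto
  have ka: "\<bar>kern d y\<bar> \<le> 2 / d" for y using kern_le[OF d] kern_nonneg[OF d] by simp
  have "(\<lambda>n. \<integral>y. h (u (fst (X n)) y) * kern d (snd (X n) - y) \<partial>lborel) \<longlonglongrightarrow> (\<integral>y. h (u (fst z) y) * kern d (snd z - y) \<partial>lborel)"
  proof (rule slice_tendsto[OF s, where C = "\<bar>C\<bar> * (2/d)" and B = "H0 * (2/d)" and R = "R + d"
        and \<Phi> = "\<lambda>n y v. h v * kern d (snd (X n) - y)" and \<Psi> = "\<lambda>y v. h v * kern d (snd z - y)"])
    show "(\<lambda>(y, v). h v * kern d (snd (X n) - y)) \<in> borel_measurable (borel \<Otimes>\<^sub>M borel)" for n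
      using d by measurable
    show "(\<lambda>(y, v). h v * kern d (snd z - y)) \<in> borel_measurable (borel \<Otimes>\<^sub>M borel)"
      using d by measurable
    show "\<bar>h v * kern d (snd (X n) - y) - h v' * kern d (snd (X n) - y)\<bar> \<le> \<bar>C\<bar> * (2/d) * \<bar>v - v'\<bar>"
      if "\<bar>v\<bar> \<le> M" "\<bar>v'\<bar> \<le> M" for n y v v'
    proof -
      have "\<bar>h v * kern d (snd (X n) - y) - h v' * kern d (snd (X n) - y)\<bar> = \<bar>h v - h v'\<bar> * \<bar>kern d (snd (X n) - y)\<bar>"
        by (simp add: abs_mult flip: left_diff_distrib)
      also have "\<dots> \<le> (\<bar>C\<bar> * \<bar>v - v'\<bar>) * (2/d)"
      proof (intro mult_mono ka)
        have "C * \<bar>v - v'\<bar> \<le> \<bar>C\<bar> * \<bar>v - v'\<bar>" by (intro mult_right_mono) auto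
        then show "\<bar>h v - h v'\<bar> \<le> \<bar>C\<bar> * \<bar>v - v'\<bar>" using h(2)[OF that] by linarith
      qed auto
      finally show ?thesis by (simp add: mult_ac)
    qed
    show "\<bar>h v * kern d (snd (X n) - y)\<bar> \<le> H0 * (2/d)" if "\<bar>v\<bar> \<le> M" for n y v
      unfolding abs_mult by (intro mult_mono H that ka H0(1)) auto
    show "h v * kern d (snd (X n) - y) = 0" if "R + d < \<bar>y\<bar>" for n y v
      using kern_supp[OF d, of "snd (X n)" y] that R[of n] by simp
    have "continuous_on UNIV (kern d)" using continuous_kern[OF d continuous_on_id] by simp
    then show "(\<lambda>n. h v * kern d (snd (X n) - y)) \<longlonglongrightarrow> h v * kern d (snd z - y)" for y v
      by (intro tendsto_intros continuous_on_tendsto_compose[of UNIV "kern d"] x) auto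
  qed
  then show "(\<lambda>n. case X n of (t, x) \<Rightarrow> \<integral>y. h (u t y) * kern d (x - y) \<partial>lborel) \<longlonglongrightarrow> (case z of (t, x) \<Rightarrow> \<integral>y. h (u t y) * kern d (x - y) \<partial>lborel)"
    by (simp add: split_beta')
qed

lemma continuous_ud: "0 < d \<Longrightarrow> continuous_on UNIV (\<lambda>(t, x). ud d t x)"
  unfolding ud_def by (rule continuous_kern_average[where h = "\<lambda>v. v" and C = 1]) auto

lemma continuous_fd: "0 < d \<Longrightarrow> continuous_on UNIV (\<lambda>(t, x). fd d t x)"
proof -
  obtain \<Lambda> where "0 < \<Lambda>" and \<Lambda>: "\<And>v v'. \<bar>v\<bar> \<le> M \<Longrightarrow> \<bar>v'\<bar> \<le> M \<Longrightarrow> \<bar>f v - f v'\<bar> \<le> \<Lambda> * \<bar>v - v'\<bar>"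
    using f_lip by blast
  then show "0 < d \<Longrightarrow> continuous_on UNIV (\<lambda>(t, x). fd d t x)"
    unfolding fd_def using continuous_kern_average[OF _ continuous_f[OF continuous_on_id] \<Lambda>] by blast
qed

lemma Vd_x: assumes d: "0 < d" shows "((\<lambda>x. Vd d t x) has_real_derivative ud d t x) (at x)"
  unfolding has_field_derivative_iff tendsto_at_iff_sequentially
proof (intro allI impI)
  fix X :: "nat \<Rightarrow> real" assume Xn: "\<forall>i. X i \<in> UNIV - {x}" and X: "X \<longlonglongrightarrow> x"
  obtain R where R: "\<And>n. \<bar>X n\<bar> \<le> R"
    using convergent_imp_Bseq[OF convergentI[OF X]] unfolding Bseq_def by auto
  have xR: "\<bar>x\<bar> \<le> R" using R LIMSEQ_le_const2[OF tendsto_rabs[OF X]] by auto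
  define q where "q n y = (step ((X n - y) / d) - step ((x - y) / d)) / (X n - x)" for n y
  have i: "integrable lborel (\<lambda>y. u t y * (step ((z - y) / d) - step (- y)))" if "\<bar>z\<bar> \<le> R" for z
  proof (rule integrable_bounded_support[where B = "M * 1" and R = "R + d + 1"])
    show "\<bar>u t y * (step ((z - y) / d) - step (- y))\<bar> \<le> M * 1" for y
      unfolding abs_mult using step_range[of "(z - y)/d"] step_range[of "-y"] M_nonneg by (intro mult_mono u_bdd) auto
    show "u t y * (step ((z - y) / d) - step (- y)) = 0" if "R + d + 1 < \<bar>y\<bar>" for y
      using step_diff_eq_0[OF d \<open>\<bar>z\<bar> \<le> R\<close> that] by simp
  qed measurable
  have eq: "(Vd d t (X n) - Vd d t x) / (X n - x) = (\<integral>y. u t y * q n y \<partial>lborel)" for n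
  proof -
    have "Vd d t (X n) - Vd d t x = (\<integral>y. u t y * (step ((X n - y) / d) - step (- y)) - u t y * (step ((x - y) / d) - step (- y)) \<partial>lborel)"
      unfolding Vd_def using i[OF R] i[OF xR] by simp
    also have "\<dots> = (\<integral>y. (u t y * q n y) * (X n - x) \<partial>lborel)"
      using Xn by (intro Bochner_Integration.integral_cong) (auto simp: q_def field_simps)
    also have "\<dots> = (\<integral>y. u t y * q n y \<partial>lborel) * (X n - x)" by (rule integral_mult_left_zero)
    finally show ?thesis using Xn by auto
  qed
  have "(\<lambda>n. \<integral>y. u t y * q n y \<partial>lborel) \<longlonglongrightarrow> (\<integral>y. u t y * kern d (x - y) \<partial>lborel)"
  proof (rule integral_tendsto_bounded_support[where B = "M * (2/d)" and R = "R + d + 1"])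
    fix n y
    have "\<bar>step ((X n - y) / d) - step ((x - y) / d)\<bar> \<le> 2 * \<bar>(X n - y) / d - (x - y) / d\<bar>"
      by (rule step_lipschitz)
    also have "(X n - y) / d - (x - y) / d = (X n - x) / d" by (simp add: diff_divide_distrib)
    finally have "\<bar>q n y\<bar> \<le> 2 / d"
      using Xn d unfolding q_def by (simp add: divide_le_eq abs_divide)
    then show "\<bar>u t y * q n y\<bar> \<le> M * (2 / d)"
      unfolding abs_mult using M_nonneg by (intro mult_mono u_bdd) auto
    show "u t y * q n y = 0" if "R + d + 1 < \<bar>y\<bar>"
      using step_diff_eq_0[OF d R that] step_diff_eq_0[OF d xR that] by (simp add: q_def)
  next
    show "AE y in lborel. (\<lambda>n. u t y * q n y) \<longlonglongrightarrow> u t y * kern d (x - y)"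
    proof (intro AE_I2 tendsto_intros)
      fix y
      have "((\<lambda>x. step ((x - y) / d)) has_real_derivative kern d (x - y)) (at x)"
        unfolding kern_def using d by (auto intro!: derivative_eq_intros)
      then show "(\<lambda>n. q n y) \<longlonglongrightarrow> kern d (x - y)"
        unfolding has_field_derivative_iff tendsto_at_iff_sequentially q_def using Xn X by (auto simp: comp_def)
    qed
  qed (use d in \<open>auto simp: q_def\<close>)
  then show "((\<lambda>y. (Vd d t y - Vd d t x) / (y - x)) \<circ> X) \<longlonglongrightarrow> ud d t x"
    by (simp add: comp_def eq ud_def)
qed

text \<open>The two weights differ only on \<open>{x - d..x}\<close>, and there by at most
  1.\<close>

lemma Vd_V: assumes d: "0 < d" shows "\<bar>Vd d t x - V t x\<bar> \<le> M * d"
proof -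
  have i1: "integrable lborel (\<lambda>y. u t y * (step ((x - y) / d) - step (- y)))"
  proof (rule integrable_bounded_support[where B = "M * 1" and R = "\<bar>x\<bar> + d + 1"])
    show "\<bar>u t y * (step ((x - y) / d) - step (- y))\<bar> \<le> M * 1" for y
      unfolding abs_mult using step_range[of "(x - y)/d"] step_range[of "-y"] M_nonneg by (intro mult_mono u_bdd) auto
    show "u t y * (step ((x - y) / d) - step (- y)) = 0" if "\<bar>x\<bar> + d + 1 < \<bar>y\<bar>" for y
      using step_diff_eq_0[OF d order_refl that] by simp
  qed measurable
  have i2: "integrable lborel (\<lambda>y. u t y * (indicator {..<x} y - step (- y)))"
  proof (rule integrable_bounded_support[where B = "M * 1" and R = "\<bar>x\<bar> + 1"])
    show "\<bar>u t y * (indicator {..<x} y - step (- y))\<bar> \<le> M * 1" for y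
      unfolding abs_mult using step_range[of "-y"] M_nonneg by (intro mult_mono u_bdd) (auto simp: indicator_def)
    show "u t y * (indicator {..<x} y - step (- y)) = 0" if "\<bar>x\<bar> + 1 < \<bar>y\<bar>" for y
      using that by (cases "y < 0") (auto simp: indicator_def step_eq_0 step_eq_1)
  qed measurable
  have "Vd d t x - V t x = (\<integral>y. u t y * (step ((x - y) / d) - step (- y)) - u t y * (indicator {..<x} y - step (- y)) \<partial>lborel)"
    unfolding Vd_def V_def using i1 i2 by simp
  also have "\<bar>\<dots>\<bar> \<le> (M * 1) * (x - (x - d))"
  proof (rule abs_integral_bounded_support)
    have "u t y * (step ((x - y) / d) - step (- y)) - u t y * (indicator {..<x} y - step (- y))
      = u t y * (step ((x - y) / d) - indicator {..<x} y)" for y by (simp add: algebra_simps)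
    moreover have "\<bar>u t y * (step ((x - y) / d) - indicator {..<x} y)\<bar> \<le> M * 1" for y
      unfolding abs_mult using step_range[of "(x - y)/d"] M_nonneg by (intro mult_mono u_bdd) (auto simp: indicator_def)
    ultimately show "\<bar>u t y * (step ((x - y) / d) - step (- y)) - u t y * (indicator {..<x} y - step (- y))\<bar> \<le> M * 1" for y
      by simp
    fix y assume "y \<notin> {x - d..x}"
    then have "step ((x - y) / d) = indicator {..<x} y"
      using d by (cases "y < x - d") (auto simp: indicator_def step_eq_0 step_eq_1 divide_le_0_iff le_divide_eq)
    then show "u t y * (step ((x - y) / d) - step (- y)) - u t y * (indicator {..<x} y - step (- y)) = 0" by simp
  qed (use d in auto)
  finally show ?thesis by simp
qed

lemma V_diff: assumes "a \<le> z" shows "V t z - V t a = (\<integral>x. indicator {a..z} x * u t x \<partial>lborel)"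
proof -
  have i: "integrable lborel (\<lambda>y. u t y * (indicator {..<x} y - step (- y)))" for x
  proof (rule integrable_bounded_support[where B = "M * 1" and R = "\<bar>x\<bar> + 1"])
    show "\<bar>u t y * (indicator {..<x} y - step (- y))\<bar> \<le> M * 1" for y
      unfolding abs_mult using step_range[of "-y"] M_nonneg by (intro mult_mono u_bdd) (auto simp: indicator_def)
    show "u t y * (indicator {..<x} y - step (- y)) = 0" if "\<bar>x\<bar> + 1 < \<bar>y\<bar>" for y
      using that by (cases "y < 0") (auto simp: indicator_def step_eq_0 step_eq_1)
  qed measurable
  have "V t z - V t a = (\<integral>y. u t y * (indicator {..<z} y - step (- y)) - u t y * (indicator {..<a} y - step (- y)) \<partial>lborel)"
    unfolding V_def using i by simp
  also have "\<dots> = (\<integral>x. indicator {a..z} x * u t x \<partial>lborel)"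
  proof (rule integral_cong_AE)
    show "AE y in lborel. u t y * (indicator {..<z} y - step (- y)) - u t y * (indicator {..<a} y - step (- y)) = indicator {a..z} y * u t y"
      using AE_lborel_singleton[of z] by eventually_elim (use assms in \<open>auto simp: indicator_def algebra_simps\<close>)
  qed measurable
  finally show ?thesis .
qed

end

lemma le_of_le_add_mult:
  assumes "\<And>d. 0 < d \<Longrightarrow> a \<le> z + C * d" shows "a \<le> (z :: real)"
proof (rule field_le_epsilon)
  fix e :: real assume "0 < e"
  then have "a \<le> z + C * (e / (\<bar>C\<bar> + 1))" by (intro assms) auto
  also have "C * (e / (\<bar>C\<bar> + 1)) \<le> e"
  proof -
    have "C * e \<le> \<bar>C\<bar> * e" using \<open>0 < e\<close> by (intro mult_right_mono) auto
    moreover have "e * (\<bar>C\<bar> + 1) = \<bar>C\<bar> * e + e" by (simp add: algebra_simps)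
    ultimately have "C * e \<le> e * (\<bar>C\<bar> + 1)" using \<open>0 < e\<close> by linarith
    then show ?thesis by (simp add: pos_divide_le_eq add_nonneg_pos)
  qed
  finally show "a \<le> z + e" by simp
qed


section \<open>Lipschitz bounds for the potential, and its upper bound by the Legendre
  transform\<close>

context entropy_slices
begin

lemma V_lipschitz_x: "\<bar>V t x - V t y\<bar> \<le> M * \<bar>x - y\<bar>"
proof -
  have *: "\<bar>V t z - V t a\<bar> \<le> M * \<bar>z - a\<bar>" if "a \<le> z" for a z
  proof -
    have "\<bar>\<integral>x. indicator {a..z} x * u t x \<partial>lborel\<bar> \<le> M * (z - a)"
      using that M_nonneg u_bdd by (intro abs_integral_bounded_support) (auto simp: indicator_def)
    then show ?thesis using that V_diff[OF that] by simp
  qed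
  show ?thesis using *[of x y] *[of y x] by (cases "x \<le> y") (auto simp: abs_minus_commute)
qed

lemma ud_bdd: "0 < d \<Longrightarrow> \<bar>ud d t x\<bar> \<le> M"
  unfolding ud_def by (rule mollifier.mollify_abs_le[OF mollifier_kern u_meas u_bdd])

lemma fd_bdd:
  assumes "\<And>v. \<bar>v\<bar> \<le> M \<Longrightarrow> \<bar>f v\<bar> \<le> B" "0 < d" shows "\<bar>fd d t x\<bar> \<le> B"
  unfolding fd_def
  by (rule mollifier.mollify_abs_le[OF mollifier_kern[OF assms(2)] _ assms(1)[OF u_bdd]]) measurable

lemma Vd_lipschitz_t:
  assumes B: "\<And>v. \<bar>v\<bar> \<le> M \<Longrightarrow> \<bar>f v\<bar> \<le> B" and d: "0 < d" and st: "s \<in> {0..T}" "t \<in> {0..T}"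
  shows "\<bar>Vd d t x - Vd d s x\<bar> \<le> B * \<bar>t - s\<bar>"
proof -
  have *: "\<bar>Vd d t x - Vd d s x\<bar> \<le> B * (t - s)" if "0 \<le> s" "s \<le> t" "t \<le> T" for s t
  proof -
    have "norm (integral {s..t} (\<lambda>r. fd d r x)) \<le> B * (t - s)"
      using that fd_bdd[OF B d] continuous_fd_t[OF d] by (intro integral_bound) auto
    then show ?thesis using Vd_t[OF d that] by simp
  qed
  show ?thesis using *[of s t] *[of t s] st by (cases "s \<le> t") (auto simp: abs_minus_commute)
qed

lemma Vd_lipschitz_x: assumes d: "0 < d" shows "\<bar>Vd d t x - Vd d t y\<bar> \<le> M * \<bar>x - y\<bar>"
proof -
  have "norm (Vd d t x - Vd d t y) \<le> M * norm (x - y)"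
    by (rule field_differentiable_bound[of UNIV "Vd d t" "ud d t"]) (use Vd_x[OF d] ud_bdd[OF d] in auto)
  then show ?thesis by simp
qed

lemma V_lipschitz_t:
  assumes B: "\<And>v. \<bar>v\<bar> \<le> M \<Longrightarrow> \<bar>f v\<bar> \<le> B" and st: "s \<in> {0..T}" "t \<in> {0..T}"
  shows "\<bar>V t x - V s x\<bar> \<le> B * \<bar>t - s\<bar>"
proof (rule le_of_le_add_mult)
  fix d :: real assume d: "0 < d"
  show "\<bar>V t x - V s x\<bar> \<le> B * \<bar>t - s\<bar> + (2 * M) * d"
    using Vd_lipschitz_t[OF B d st, of x] Vd_V[OF d, of t x] Vd_V[OF d, of s x] by linarith
qed

lemma Vd_DERIV_t:
  assumes d: "0 < d" and t: "t \<in> {0<..<T}"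
  shows "((\<lambda>t. Vd d t x) has_real_derivative - fd d t x) (at t)"
proof -
  have "((\<lambda>t. Vd d 0 x - integral {0..t} (\<lambda>r. fd d r x)) has_real_derivative 0 - fd d t x) (at t within {0..T})"
    using t by (intro derivative_intros integral_has_real_derivative continuous_fd_t d) auto
  then have "((\<lambda>t. Vd d 0 x - integral {0..t} (\<lambda>r. fd d r x)) has_real_derivative - fd d t x) (at t)"
    using at_within_interior[of t "{0..T}"] t by simp
  then show ?thesis
  proof (rule has_field_derivative_transform_within_open[where S = "{0<..<T}"])
    show "Vd d 0 x - integral {0..r} (\<lambda>r. fd d r x) = Vd d r x" if "r \<in> {0<..<T}" for r
      using Vd_t[OF d, of 0 r x] that by simp
  qed (use t in auto)
qed

lemma Vd_grad:
  assumes d: "0 < d" and t: "t \<in> {0<..<T}"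
  shows "((\<lambda>(t, x). Vd d t x) has_derivative (\<lambda>h. - fd d t x * fst h + ud d t x * snd h)) (at (t, x))"
  using has_derivative_strip[OF t, of "\<lambda>(t, x). Vd d t x" "\<lambda>(t, x). - fd d t x" "\<lambda>(t, x). ud d t x" x]
    Vd_DERIV_t[OF d] Vd_x[OF d] continuous_on_subset[OF continuous_ud[OF d] subset_UNIV]
  by simp

text \<open>Along a line of slope \<open>a\<close> the potential grows at the rate
  \<open>a * u - f u\<close>, which Young's inequality bounds by \<open>L a\<close>. The computation
  is made for \<open>Vd\<close> with the mean value theorem, and \<open>d\<close> tends to 0 at the
  end.\<close>

lemma V_upper:
  assumes st: "0 \<le> s" "s \<le> t" "t \<le> T"
  shows "V t (x + a * (t - s)) \<le> V s x + (t - s) * L a"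
proof (cases "s = t")
  case False
  then have "s < t" using st by simp
  obtain B where B: "0 \<le> B" "\<And>v. \<bar>v\<bar> \<le> M \<Longrightarrow> \<bar>f v\<bar> \<le> B" using f_bdd by blast
  have "Vd d t (x + a * (t - s)) \<le> Vd d s x + (t - s) * L a" if d: "0 < d" for d
  proof -
    interpret mollifier "kern d" d by (rule mollifier_kern[OF d])
    define g where "g r = Vd d r (x + a * (r - s))" for r
    have cont: "continuous_on {s..t} g"
    proof (rule lipschitz_on_continuous_on[of "B + M * \<bar>a\<bar>"], rule lipschitz_onI)
      fix r r' assume r: "r \<in> {s..t}" "r' \<in> {s..t}"
      have 1: "\<bar>Vd d r (x + a * (r - s)) - Vd d r' (x + a * (r - s))\<bar> \<le> B * \<bar>r - r'\<bar>"
        by (rule Vd_lipschitz_t[OF B(2) d]) (use r st in auto)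
      have "\<bar>Vd d r' (x + a * (r - s)) - Vd d r' (x + a * (r' - s))\<bar> \<le> M * \<bar>(x + a * (r - s)) - (x + a * (r' - s))\<bar>"
        by (rule Vd_lipschitz_x[OF d])
      also have "(x + a * (r - s)) - (x + a * (r' - s)) = a * (r - r')" by (simp add: algebra_simps)
      finally show "dist (g r) (g r') \<le> (B + M * \<bar>a\<bar>) * dist r r'"
        using 1 unfolding g_def dist_real_def by (simp add: abs_mult distrib_right)
    qed (use B M_nonneg in auto)
    have D: "(g has_derivative (\<lambda>h. (- fd d r (x + a * (r - s)) + ud d r (x + a * (r - s)) * a) * h)) (at r)"
      if "s < r" "r < t" for r
    proof -
      have "((\<lambda>r. (r, x + a * (r - s))) has_derivative (\<lambda>h. (h, a * h))) (at r)"
        by (auto intro!: derivative_eq_intros)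
      from has_derivative_compose[OF this Vd_grad[OF d, of r "x + a * (r - s)"]] that st
      show ?thesis unfolding g_def by (simp add: algebra_simps)
    qed
    obtain r where r: "s < r" "r < t"
      "g t - g s = (- fd d r (x + a * (r - s)) + ud d r (x + a * (r - s)) * a) * (t - s)"
      using mvt[OF \<open>s < t\<close> cont D] by blast
    \<comment> \<open>Young's inequality survives averaging, as \<open>fd\<close> and
      \<open>ud\<close> use the same nonnegative kernel of mass 1.\<close>
    have "- fd d r y + ud d r y * a \<le> L a" for y
    proof -
      have i: "integrable lborel (\<lambda>z. f (u r z) * kern d (y - z))"
        by (rule integrable_mult_K[of _ B]) (use B u_bdd in auto)
      have "- fd d r y + ud d r y * a = (\<integral>z. (a * u r z - f (u r z)) * kern d (y - z) \<partial>lborel)"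
        unfolding fd_def ud_def using i integrable_mult_K[OF u_meas u_bdd, of r y]
        by (simp add: left_diff_distrib mult.assoc)
      also have "\<dots> \<le> (\<integral>z. L a * kern d (y - z) \<partial>lborel)"
      proof (rule integral_mono)
        show "integrable lborel (\<lambda>z. (a * u r z - f (u r z)) * kern d (y - z))"
          using i integrable_mult_K[OF u_meas u_bdd, of r y] by (simp add: left_diff_distrib mult.assoc)
        show "integrable lborel (\<lambda>z. L a * kern d (y - z))" using integrable_K by simp
      qed (intro mult_right_mono young K_nonneg)
      finally show ?thesis using K_int by simp
    qed
    then have "g t - g s \<le> L a * (t - s)" unfolding r(3) using \<open>s < t\<close> by (intro mult_right_mono) auto
    then show ?thesis by (simp add: g_def algebra_simps)
  qed
  then have "V t (x + a * (t - s)) \<le> V s x + (t - s) * L a + (2 * M) * d" if "0 < d" for d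
    using that Vd_V[OF that, of t "x + a * (t - s)"] Vd_V[OF that, of s x] by (smt (verit) left_diff_distrib distrib_right)
  then show ?thesis by (rule le_of_le_add_mult)
qed simp

text \<open>Used for \<open>h v = v\<close> and for \<open>h = f\<close>: the price for replacing
  \<open>u\<close> and \<open>f u\<close> by \<open>ud\<close> and \<open>fd\<close> vanishes in L^1
  over the whole time interval, slice by slice and then by dominated convergence in time.\<close>

lemma average_error_tendsto:
  assumes h: "continuous_on UNIV h" "\<And>v v'. \<bar>v\<bar> \<le> M \<Longrightarrow> \<bar>v'\<bar> \<le> M \<Longrightarrow> \<bar>h v - h v'\<bar> \<le> C * \<bar>v - v'\<bar>"
    and R: "0 \<le> R" and d: "\<And>n. 0 < d n" "d \<longlonglongrightarrow> 0"
  defines "e \<equiv> \<lambda>n t. \<integral>x. indicator {-R..R} x * \<bar>h (u t x) - (\<integral>y. h (u t y) * kern (d n) (x - y) \<partial>lborel)\<bar> \<partial>lborel"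
  shows "integrable lborel (\<lambda>t. indicator {0..T} t * e n t)"
    and "(\<lambda>n. \<integral>t. indicator {0..T} t * e n t \<partial>lborel) \<longlonglongrightarrow> 0"
    and "integrable lborel (\<lambda>x. indicator {-R..R} x * \<bar>h (u t x) - (\<integral>y. h (u t y) * kern (d n) (x - y) \<partial>lborel)\<bar>)"
proof -
  have [measurable]: "h \<in> borel_measurable borel" using h(1) by (rule borel_measurable_continuous_onI)
  obtain H0 where H0: "0 \<le> H0" "\<And>v. v \<in> {-M..M} \<Longrightarrow> \<bar>h v\<bar> \<le> H0"
    using continuous_on_compact_bdd[OF continuous_on_subset[OF h(1)] compact_Icc] by auto
  have H: "\<bar>h v\<bar> \<le> H0" if "\<bar>v\<bar> \<le> M" for v using that by (intro H0(2)) auto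
  define m where "m n t x = (\<integral>y. h (u t y) * kern (d n) (x - y) \<partial>lborel)" for n t x
  have mb: "\<bar>m n t x\<bar> \<le> H0" for n t x
    unfolding m_def by (rule mollifier.mollify_abs_le[OF mollifier_kern[OF d(1)] _ H[OF u_bdd]]) measurable
  have mc: "continuous_on UNIV (\<lambda>(t, x). m n t x)" for n
    unfolding m_def by (rule continuous_kern_average[OF d(1) h])
  have mx: "continuous_on UNIV (m n t)" for n t
    using continuous_on_compose2[OF mc continuous_on_Pair[OF continuous_on_const[where c = t] continuous_on_id]] by simp
  have [measurable]: "m n t \<in> borel_measurable borel" for n t
    using mx by (rule borel_measurable_continuous_onI)
  have hm: "\<bar>h (u t x) - m n t x\<bar> \<le> 2 * H0" for n t x using H[OF u_bdd[of t x]] mb[of n t x] by linarith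
  show i: "integrable lborel (\<lambda>x. indicator {-R..R} x * \<bar>h (u t x) - (\<integral>y. h (u t y) * kern (d n) (x - y) \<partial>lborel)\<bar>)" for n t
    unfolding m_def[symmetric]
    by (rule integrable_bounded_support[where B = "2 * H0" and R = R]) (use hm H0(1) in \<open>auto simp: indicator_def\<close>)
  have eb: "\<bar>e n t\<bar> \<le> 2 * H0 * (R - - R)" for n t
    unfolding e_def m_def[symmetric]
    by (rule abs_integral_bounded_support) (use hm H0(1) R in \<open>auto simp: indicator_def\<close>)
  have ec: "continuous_on UNIV (e n)" for n
    unfolding continuous_on_sequentially comp_def
  proof (intro allI ballI impI, elim conjE)
    fix s t assume s: "s \<longlonglongrightarrow> (t :: real)"
    show "(\<lambda>k. e n (s k)) \<longlonglongrightarrow> e n t"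
      unfolding e_def m_def[symmetric]
    proof (rule slice_tendsto[OF s, where \<Phi> = "\<lambda>k x v. indicator {-R..R} x * \<bar>h v - m n (s k) x\<bar>"
          and \<Psi> = "\<lambda>x v. indicator {-R..R} x * \<bar>h v - m n t x\<bar>" and C = "\<bar>C\<bar>" and B = "2 * H0" and R = R])
      show "\<bar>indicator {-R..R} x * \<bar>h v - m n (s k) x\<bar> - indicator {-R..R} x * \<bar>h v' - m n (s k) x\<bar>\<bar> \<le> \<bar>C\<bar> * \<bar>v - v'\<bar>"
        if "\<bar>v\<bar> \<le> M" "\<bar>v'\<bar> \<le> M" for k x v v'
      proof -
        have "C * \<bar>v - v'\<bar> \<le> \<bar>C\<bar> * \<bar>v - v'\<bar>" by (intro mult_right_mono) auto
        then have "\<bar>h v - h v'\<bar> \<le> \<bar>C\<bar> * \<bar>v - v'\<bar>" using h(2)[OF that] by linarith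
        then show ?thesis by (auto simp: indicator_def)
      qed
      show "\<bar>indicator {-R..R} x * \<bar>h v - m n (s k) x\<bar>\<bar> \<le> 2 * H0" if "\<bar>v\<bar> \<le> M" for k x v
        using H[OF that] mb[of n "s k" x] H0(1) by (auto simp: indicator_def)
      show "indicator {-R..R} x * \<bar>h v - m n (s k) x\<bar> = 0" if "R < \<bar>x\<bar>" for k x v
        using that by (auto simp: indicator_def)
      show "(\<lambda>k. indicator {-R..R} x * \<bar>h v - m n (s k) x\<bar>) \<longlonglongrightarrow> indicator {-R..R} x * \<bar>h v - m n t x\<bar>" for x v
      proof (intro tendsto_intros)
        have "(\<lambda>k. (s k, x)) \<longlonglongrightarrow> (t, x)" by (intro tendsto_intros s)
        from continuous_on_tendsto_compose[OF mc this] show "(\<lambda>k. m n (s k) x) \<longlonglongrightarrow> m n t x" by simp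
      qed
    qed measurable
  qed
  have [measurable]: "e n \<in> borel_measurable borel" for n using ec by (rule borel_measurable_continuous_onI)
  show "integrable lborel (\<lambda>t. indicator {0..T} t * e n t)"
    by (rule integrable_bounded_support[where B = "2 * H0 * (R - - R)" and R = T])
      (use eb H0(1) R in \<open>auto simp: indicator_def\<close>)
  have "(\<lambda>n. \<integral>t. indicator {0..T} t * e n t \<partial>lborel) \<longlonglongrightarrow> (\<integral>t. (0::real) \<partial>(lborel :: real measure))"
  proof (rule integral_tendsto_bounded_support[where g = "\<lambda>n t. indicator {0..T} t * e n t" and h = "\<lambda>_. 0"
        and B = "2 * H0 * (R - - R)" and R = T])
    have "(\<lambda>n. e n t) \<longlonglongrightarrow> 0" for t
      unfolding e_def by (rule mollify_tendsto_L1[OF _ H[OF u_bdd] R mollifier_kern[OF d(1)] d(2)]) measurable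
    then show "AE t in lborel. (\<lambda>n. indicator {0..T} t * e n t) \<longlonglongrightarrow> 0"
      by (intro AE_I2 tendsto_mult_right_zero)
  qed (use eb H0(1) R in \<open>auto simp: indicator_def\<close>)
  then show "(\<lambda>n. \<integral>t. indicator {0..T} t * e n t \<partial>lborel) \<longlonglongrightarrow> 0" by simp
qed

text \<open>The entropy is \<open>\<Lambda> * \<bar>u - k\<bar> + \<epsilon>\<close>. The added
  constant changes nothing, since \<open>p\<close> has integral 0, but for positive \<epsilon> it
  keeps the entropy away from 0 where \<open>u = k\<close>, as the cone argument requires.\<close>

lemma entropy_weighted:
  fixes k \<epsilon> \<Lambda> :: real
  assumes g: "has_C1_grad \<phi> p q" and K: "compact K" "K \<subseteq> {0<..<T} \<times> UNIV" "\<And>z. z \<notin> K \<Longrightarrow> \<phi> z = 0"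
    and pos: "\<And>z. 0 \<le> \<phi> z" and \<Lambda>: "0 \<le> \<Lambda>"
  defines "I \<equiv> \<lambda>t x. (\<Lambda> * \<bar>u t x - k\<bar> + \<epsilon>) * p (t, x) + \<Lambda> * (sgn (u t x - k) * (f (u t x) - f k)) * q (t, x)"
  shows "0 \<le> (\<integral>t. \<integral>x. I t x \<partial>lborel \<partial>lborel)" "integrable lborel (\<lambda>x. I t x)" "integrable lborel (\<lambda>t. \<integral>x. I t x \<partial>lborel)"
proof -
  have c: "continuous_on UNIV p" "continuous_on UNIV q" using g unfolding has_C1_grad_def by auto
  have 0: "p z = 0" "q z = 0" if "z \<notin> K" for z
    using has_C1_grad_eq_0[OF g compact_imp_closed[OF K(1)] K(3) that] by auto
  obtain \<Lambda>' where \<Lambda>': "0 < \<Lambda>'" "\<And>x. \<bar>x\<bar> \<le> max M \<bar>k\<bar> \<Longrightarrow> \<bar>deriv f x\<bar> \<le> \<Lambda>'" using f'_bdd by blast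
  have "continuous_on UNIV (\<lambda>v. \<bar>v - k\<bar>)" "continuous_on UNIV (\<lambda>v::real. 1::real)"
    by (intro continuous_intros)+
  note c1 = this
  have lip: "\<bar>\<bar>v - k\<bar> - \<bar>v' - k\<bar>\<bar> \<le> 1 * \<bar>v - v'\<bar>" for v v' :: real
    using abs_triangle_ineq3[of "v - k" "v' - k"] by simp
  have lipS: "\<bar>sgn (v - k) * (f v - f k) - sgn (v' - k) * (f v' - f k)\<bar> \<le> \<Lambda>' * \<bar>v - v'\<bar>"
    if "\<bar>v\<bar> \<le> M" "\<bar>v'\<bar> \<le> M" for v v'
    by (rule kruzkov_flux_lipschitz[where A = "max M \<bar>k\<bar>", OF _ _ _ \<Lambda>'(2)]) (use that in auto)
  note a = slice_continuous_mult[OF c(1) K(1) 0(1) c1(1) lip]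
  note s = slice_continuous_mult[OF c(2) K(1) 0(2) continuous_kruzkov_flux lipS]
  note o = slice_continuous_mult[OF c(1) K(1) 0(1) c1(2), of 1, simplified]
  have I: "I t x = \<Lambda> * (\<bar>u t x - k\<bar> * p (t, x) + sgn (u t x - k) * (f (u t x) - f k) * q (t, x)) + \<epsilon> * p (t, x)" for t x
    by (simp add: I_def algebra_simps)
  have ins: "(\<integral>x. I t x \<partial>lborel) = \<Lambda> * (\<integral>x. \<bar>u t x - k\<bar> * p (t, x) + sgn (u t x - k) * (f (u t x) - f k) * q (t, x) \<partial>lborel)
      + \<epsilon> * (\<integral>x. p (t, x) \<partial>lborel)" for t
    unfolding I using a(3)[of t] s(3)[of t] o(3)[of t] by simp
  have ins2: "(\<integral>x. \<bar>u t x - k\<bar> * p (t, x) + sgn (u t x - k) * (f (u t x) - f k) * q (t, x) \<partial>lborel)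
      = (\<integral>x. \<bar>u t x - k\<bar> * p (t, x) \<partial>lborel) + (\<integral>x. sgn (u t x - k) * (f (u t x) - f k) * q (t, x) \<partial>lborel)" for t
    using a(3)[of t] s(3)[of t] by simp
  have out: "integrable lborel (\<lambda>t. \<integral>x. \<bar>u t x - k\<bar> * p (t, x) + sgn (u t x - k) * (f (u t x) - f k) * q (t, x) \<partial>lborel)"
    unfolding ins2 using a(2) s(2) by (rule Bochner_Integration.integrable_add)
  show "integrable lborel (\<lambda>x. I t x)" unfolding I using a(3)[of t] s(3)[of t] o(3)[of t] by simp
  show "integrable lborel (\<lambda>t. \<integral>x. I t x \<partial>lborel)" unfolding ins using out o(2) by simp
  have "(\<integral>t. \<integral>x. I t x \<partial>lborel \<partial>lborel)
     = \<Lambda> * (\<integral>t. \<integral>x. \<bar>u t x - k\<bar> * p (t, x) + sgn (u t x - k) * (f (u t x) - f k) * q (t, x) \<partial>lborel \<partial>lborel)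
      + \<epsilon> * (\<integral>t. \<integral>x. p (t, x) \<partial>lborel \<partial>lborel)"
    unfolding ins using out o(2) by simp
  then show "0 \<le> (\<integral>t. \<integral>x. I t x \<partial>lborel \<partial>lborel)"
    using entropy[OF g K pos, of k] \<Lambda> iterated_integral_grad_eq_0(1)[OF g K(1,3)] by simp
qed

end

section \<open>Comparison with affine solutions in a cone\<close>

lemma pos_square_DERIV: "((\<lambda>x::real. (max 0 x)\<^sup>2) has_real_derivative 2 * max 0 x) (at x)"
proof -
  consider "x < 0" | "x = 0" | "0 < x" by linarith
  then show ?thesis
  proof cases
    case 1
    have "((\<lambda>x::real. (max 0 x)\<^sup>2) has_real_derivative 0) (at x)"
      by (rule has_field_derivative_transform_within_open[of "\<lambda>_. 0" 0 x "{..<0}"]) (use 1 in auto)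
    then show ?thesis using 1 by simp
  next
    case 2
    have "((\<lambda>h. ((max 0 h)\<^sup>2 - (max 0 0)\<^sup>2) / (h - 0)) \<longlongrightarrow> 0) (at (0::real))"
    proof (rule Lim_null_comparison)
      have "norm (((max 0 h)\<^sup>2 - (max 0 0)\<^sup>2) / (h - 0)) \<le> \<bar>h\<bar>" for h :: real
        by (cases "h > 0") (auto simp: power2_eq_square)
      then show "\<forall>\<^sub>F h in at (0::real). norm (((max 0 h)\<^sup>2 - (max 0 0)\<^sup>2) / (h - 0)) \<le> \<bar>h\<bar>"
        by (intro always_eventually allI)
    qed (auto intro!: tendsto_eq_intros)
    then show ?thesis using 2 unfolding has_field_derivative_iff by simp
  next
    case 3
    have "((\<lambda>x::real. (max 0 x)\<^sup>2) has_real_derivative 2 * x) (at x)"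
      by (rule has_field_derivative_transform_within_open[of "\<lambda>x. x\<^sup>2" _ x "{0<..}"])
        (use 3 in \<open>auto intro!: derivative_eq_intros\<close>)
    then show ?thesis using 3 by simp
  qed
qed

lemma pos_square_DERIV' [derivative_intros]:
  "(g has_real_derivative g') (at x within S) \<Longrightarrow>
    ((\<lambda>x. (max 0 (g x))\<^sup>2) has_real_derivative 2 * max 0 (g x) * g') (at x within S)"
  for g :: "real \<Rightarrow> real"
  using DERIV_chain2[OF pos_square_DERIV] .

text \<open>The terms with \<open>U\<close> and \<open>F\<close> cancel exactly, because \<open>S * (U - k) = \<eta> * (F - Fk)\<close> for
  Kruzkov's entropy pair: this is why the test function may be a function of the potential.\<close>

lemma kruzkov_cancellation:
  fixes \<eta> S U k F Fk G m \<Lambda> \<epsilon> \<theta>t \<theta>x :: real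
  assumes "0 \<le> \<eta>" "S * (U - k) = \<eta> * (F - Fk)" "\<bar>S\<bar> \<le> \<Lambda> * \<eta>" "\<bar>F - Fk\<bar> \<le> \<Lambda> * \<eta>"
    "\<Lambda> * \<bar>\<theta>x\<bar> + \<epsilon> \<le> \<theta>t" "0 \<le> \<epsilon>" "0 \<le> \<Lambda>"
  shows "- ((\<Lambda> * \<eta> + \<epsilon>) * \<bar>F - G\<bar> + \<Lambda> * (\<Lambda> * \<eta>) * \<bar>U - m\<bar>)
      \<le> (\<Lambda> * \<eta> + \<epsilon>) * (Fk - G + \<theta>t) + \<Lambda> * S * (m - k + \<theta>x)"
proof -
  \<comment> \<open>Everything is regrouped around the averaging errors \<open>F - G\<close> and
    \<open>m - U\<close>; the bracket \<open>S * (U - k) - \<eta> * (F - Fk)\<close> is the one that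
    vanishes.\<close>
  have eq: "(\<Lambda> * \<eta> + \<epsilon>) * (Fk - G + \<theta>t) + \<Lambda> * S * (m - k + \<theta>x)
    = (\<Lambda> * \<eta> + \<epsilon>) * (F - G) + \<Lambda> * (S * (m - U)) + \<Lambda> * (S * (U - k) - \<eta> * (F - Fk))
      + \<Lambda> * (\<eta> * \<theta>t + S * \<theta>x) + \<epsilon> * (Fk - F) + \<epsilon> * \<theta>t"
    by (simp add: algebra_simps)
  have 1: "- ((\<Lambda> * \<eta> + \<epsilon>) * \<bar>F - G\<bar>) \<le> (\<Lambda> * \<eta> + \<epsilon>) * (F - G)"
  proof -
    have "(\<Lambda> * \<eta> + \<epsilon>) * (- \<bar>F - G\<bar>) \<le> (\<Lambda> * \<eta> + \<epsilon>) * (F - G)"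
      using assms by (intro mult_left_mono) auto
    then show ?thesis by simp
  qed
  have Sle: "- (\<Lambda> * \<eta> * \<bar>r\<bar>) \<le> S * r" for r
  proof -
    have "\<bar>S * r\<bar> \<le> \<Lambda> * \<eta> * \<bar>r\<bar>" unfolding abs_mult by (intro mult_right_mono assms) auto
    then show ?thesis by linarith
  qed
  have 2: "- (\<Lambda> * (\<Lambda> * \<eta>) * \<bar>U - m\<bar>) \<le> \<Lambda> * (S * (m - U))"
  proof -
    have "\<Lambda> * (- (\<Lambda> * \<eta> * \<bar>m - U\<bar>)) \<le> \<Lambda> * (S * (m - U))"
      by (intro mult_left_mono Sle assms)
    then show ?thesis by (simp add: abs_minus_commute mult.assoc)
  qed
  \<comment> \<open>The slack \<epsilon> in the growth of the penalty yields
    \<open>\<Lambda> * (\<eta> * \<epsilon>)\<close>, exactly enough to pay for the term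
    \<open>\<epsilon> * (Fk - F)\<close> that the constant in the entropy causes.\<close>
  have "\<eta> * (\<Lambda> * \<bar>\<theta>x\<bar> + \<epsilon>) \<le> \<eta> * \<theta>t" by (intro mult_left_mono assms)
  with Sle[of \<theta>x] have "\<eta> * \<epsilon> \<le> \<eta> * \<theta>t + S * \<theta>x" by (simp add: algebra_simps)
  then have 3: "\<Lambda> * (\<eta> * \<epsilon>) \<le> \<Lambda> * (\<eta> * \<theta>t + S * \<theta>x)" using assms by (intro mult_left_mono)
  have 4: "- (\<epsilon> * (\<Lambda> * \<eta>)) \<le> \<epsilon> * (Fk - F)"
  proof -
    have "\<epsilon> * (- (\<Lambda> * \<eta>)) \<le> \<epsilon> * (Fk - F)" using assms by (intro mult_left_mono) auto
    then show ?thesis by simp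
  qed
  have "0 \<le> \<Lambda> * \<bar>\<theta>x\<bar>" using assms by simp
  then have 5: "0 \<le> \<epsilon> * \<theta>t" using assms by (intro mult_nonneg_nonneg) linarith+
  have 6: "\<epsilon> * (\<Lambda> * \<eta>) = \<Lambda> * (\<eta> * \<epsilon>)" by simp
  show ?thesis unfolding eq using 1 2 3 4 5 6 assms(2) by simp
qed

context entropy_slices
begin

text \<open>Suppose that the minorant fails at the tip. The set where the penalised difference
  \<open>Z\<close> is below \<open>- 2 * \<mu>\<close> is bounded and stays away from time
  \<open>s\<close>, but contains a box near the tip. A test function living on this set, with a
  weight that decreases to 0 at time \<open>t1\<close>, makes the entropy inequality bound a
  positive constant by averaging errors, which tend to 0.\<close>

lemma cone_comparison_interior:
  assumes s: "0 \<le> s" "s < t1" "t1 < T" and \<Lambda>: "0 < \<Lambda>"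
    and lipk: "\<And>v. \<bar>v\<bar> \<le> M \<Longrightarrow> \<bar>f v - f k\<bar> \<le> \<Lambda> * \<bar>v - k\<bar>"
    and H: "\<And>y. \<bar>y - x0\<bar> \<le> \<Lambda> * (t1 - s) \<Longrightarrow> k * y + c0 \<le> V s y"
  shows "k * x0 + c0 - f k * (t1 - s) \<le> V t1 x0"
proof (rule ccontr)
  assume neg: "\<not> ?thesis"
  define D where "D t x = V t x - k * x - c0 + f k * (t - s)" for t x
  \<comment> \<open>The depth \<open>5 * \<mu>\<close> at the tip is a budget: \<mu> goes to the
    drift \<open>\<epsilon> * (t - s)\<close>, \<open>\<mu> / 2\<close> to the size of the box and
    \<open>\<mu> / 4\<close> to averaging. What is left keeps \<open>Z\<close> below
    \<open>- 3 * \<mu>\<close> on the box, where the cutoff equals 1.\<close>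
  define \<mu> where "\<mu> = - D t1 x0 / 5"
  have \<mu>: "0 < \<mu>" using neg by (simp add: \<mu>_def D_def)
  obtain B where B: "0 \<le> B" "\<And>v. \<bar>v\<bar> \<le> M \<Longrightarrow> \<bar>f v\<bar> \<le> B" using f_bdd by blast
  define Cm where "Cm = M + \<bar>k\<bar> + B + \<bar>f k\<bar> + 1"
  have Cm: "1 \<le> Cm" using M_nonneg B by (simp add: Cm_def)
  have D_lip: "\<bar>D t x - D t' x'\<bar> \<le> Cm * \<bar>t - t'\<bar> + Cm * \<bar>x - x'\<bar>" if "t \<in> {0..T}" "t' \<in> {0..T}" for t t' x x'
  proof -
    have 1: "\<bar>V t x - V t' x\<bar> \<le> B * \<bar>t - t'\<bar>" by (rule V_lipschitz_t[OF B(2) that(2,1)])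
    have 2: "\<bar>V t' x - V t' x'\<bar> \<le> M * \<bar>x - x'\<bar>" by (rule V_lipschitz_x)
    have eq: "D t x - D t' x' = ((V t x - V t' x) + (V t' x - V t' x')) + (f k * (t - t') - k * (x - x'))"
      by (simp add: D_def algebra_simps)
    have "\<bar>D t x - D t' x'\<bar> \<le> (\<bar>V t x - V t' x\<bar> + \<bar>V t' x - V t' x'\<bar>) + (\<bar>f k * (t - t')\<bar> + \<bar>k * (x - x')\<bar>)"
      unfolding eq by (intro order_trans[OF abs_triangle_ineq] add_mono abs_triangle_ineq abs_triangle_ineq4)
    also have "\<dots> \<le> (B * \<bar>t - t'\<bar> + M * \<bar>x - x'\<bar>) + (\<bar>f k\<bar> * \<bar>t - t'\<bar> + \<bar>k\<bar> * \<bar>x - x'\<bar>)"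
      unfolding abs_mult by (intro add_mono 1 2 order_refl)
    also have "\<dots> = (B + \<bar>f k\<bar>) * \<bar>t - t'\<bar> + (M + \<bar>k\<bar>) * \<bar>x - x'\<bar>" by (simp add: distrib_right)
    also have "\<dots> \<le> Cm * \<bar>t - t'\<bar> + Cm * \<bar>x - x'\<bar>"
    proof -
      have "B + \<bar>f k\<bar> \<le> Cm" "M + \<bar>k\<bar> \<le> Cm" unfolding Cm_def using M_nonneg B(1) by linarith+
      then show ?thesis by (intro add_mono mult_right_mono) simp_all
    qed
    finally show ?thesis .
  qed
  \<comment> \<open>The drift over the whole time interval costs at most \<mu>.\<close>
  define \<epsilon> where "\<epsilon> = \<mu> / T"
  have \<epsilon>: "0 < \<epsilon>" using \<mu> T_pos by (simp add: \<epsilon>_def)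
  \<comment> \<open>With this stiffness the minimum of \<open>N * r\<^sup>2 - Cm * r\<close> over
    \<open>r\<close> is \<open>- \<mu> / 4\<close>: outside the base of the cone the penalty makes
    up for what the Lipschitz bound on \<open>D\<close> allows to be lost.\<close>
  define N where "N = Cm\<^sup>2 / \<mu>"
  have N: "0 < N" using Cm \<mu> by (simp add: N_def)
  \<comment> \<open>The distances by which \<open>x\<close> leaves the backward cone of the tip, to
    the right and to the left. They are kept apart because the square of each positive part is C^1.
    The cone shrinks with speed \<Lambda> as \<open>t\<close> grows, which yields
    \<open>\<theta>_ineq\<close>.\<close>
  define r1 where "r1 t x = max 0 (x - x0 - \<Lambda> * (t1 - t))" for t x
  define r2 where "r2 t x = max 0 (x0 - x - \<Lambda> * (t1 - t))" for t x
  define \<theta> where "\<theta> t x = \<epsilon> * (t - s) + N * ((r1 t x)\<^sup>2 + (r2 t x)\<^sup>2)" for t x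
  define \<theta>t where "\<theta>t t x = \<epsilon> + N * (2 * r1 t x * \<Lambda> + 2 * r2 t x * \<Lambda>)" for t x
  define \<theta>x where "\<theta>x t x = N * (2 * r1 t x - 2 * r2 t x)" for t x
  have r0: "0 \<le> r1 t x" "0 \<le> r2 t x" for t x by (simp_all add: r1_def r2_def)
  have \<theta>_ineq: "\<Lambda> * \<bar>\<theta>x t x\<bar> + \<epsilon> \<le> \<theta>t t x" for t x
  proof -
    have "\<bar>\<theta>x t x\<bar> \<le> N * (2 * r1 t x + 2 * r2 t x)"
      unfolding \<theta>x_def abs_mult using N r0[of t x] by (intro mult_mono) auto
    then have "\<Lambda> * \<bar>\<theta>x t x\<bar> \<le> \<Lambda> * (N * (2 * r1 t x + 2 * r2 t x))" using \<Lambda> by (intro mult_left_mono) auto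
    then show ?thesis by (simp add: \<theta>t_def algebra_simps)
  qed
  \<comment> \<open>A point outside the base is compared with the nearest end point
    \<open>y\<close>, where the minorant holds.\<close>
  have init: "- Cm * max 0 (\<bar>x - x0\<bar> - \<Lambda> * (t1 - s)) \<le> D s x" for x
  proof (cases "\<bar>x - x0\<bar> \<le> \<Lambda> * (t1 - s)")
    case True
    then show ?thesis using H[of x] by (simp add: D_def)
  next
    case False
    define y where "y = x0 + sgn (x - x0) * (\<Lambda> * (t1 - s))"
    have pos: "0 \<le> \<Lambda> * (t1 - s)" using \<Lambda> s by simp
    have "\<bar>y - x0\<bar> \<le> \<Lambda> * (t1 - s)" using pos by (auto simp: y_def sgn_if)
    then have "0 \<le> D s y" using H[of y] by (simp add: D_def)
    moreover have "\<bar>x - y\<bar> = \<bar>x - x0\<bar> - \<Lambda> * (t1 - s)" using False pos by (auto simp: y_def sgn_if)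
    ultimately show ?thesis using D_lip[of s s x y] s False by simp
  qed
  have \<theta>s: "N * (max 0 (\<bar>x - x0\<bar> - \<Lambda> * (t1 - s)))\<^sup>2 \<le> \<theta> s x" for x
  proof (cases "x0 \<le> x")
    case True
    then have "max 0 (\<bar>x - x0\<bar> - \<Lambda> * (t1 - s)) = r1 s x" by (simp add: r1_def)
    then show ?thesis using N by (simp add: \<theta>_def)
  next
    case False
    then have "max 0 (\<bar>x - x0\<bar> - \<Lambda> * (t1 - s)) = r2 s x" by (simp add: r2_def abs_if)
    then show ?thesis using N by (simp add: \<theta>_def)
  qed
  have init1: "- \<mu> / 4 \<le> D s x + \<theta> s x" for x
  proof -
    define r where "r = max 0 (\<bar>x - x0\<bar> - \<Lambda> * (t1 - s))"
    have "0 \<le> N * (r - Cm / (2 * N))\<^sup>2" using N by simp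
    also have "N * (r - Cm / (2 * N))\<^sup>2 = N * r\<^sup>2 - Cm * r + Cm\<^sup>2 / (4 * N)"
      using N by (simp add: power2_eq_square field_simps)
    also have "Cm\<^sup>2 / (4 * N) = \<mu> / 4" using Cm \<mu> by (simp add: N_def)
    finally show ?thesis using init[of x] \<theta>s[of x] unfolding r_def[symmetric] by simp
  qed
  \<comment> \<open>Beyond this radius the quadratic penalty exceeds every loss: the linear one in
    \<open>init\<close>, \<open>Cm * T\<close> for the passage of time, and \<open>M\<close> for
    averaging with \<open>d n \<le> 1\<close>.\<close>
  define R0 where "R0 = \<Lambda> * T + (Cm + Cm * T + M) / N + 1"
  have init2: "Cm * T + M \<le> D s x + \<theta> s x" if "R0 < \<bar>x - x0\<bar>" for x
  proof -
    define r where "r = max 0 (\<bar>x - x0\<bar> - \<Lambda> * (t1 - s))"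
    have "\<Lambda> * (t1 - s) \<le> \<Lambda> * T" using \<Lambda> s by (intro mult_left_mono) auto
    then have r: "(Cm + Cm * T + M) / N + 1 \<le> r" using that by (simp add: r_def R0_def)
    have nn: "0 \<le> (Cm + Cm * T + M) / N" using Cm T_pos M_nonneg N by (intro divide_nonneg_nonneg) auto
    have "(Cm + Cm * T + M) / N \<le> r" using r by linarith
    then have "Cm + Cm * T + M \<le> N * r" using N by (simp add: pos_divide_le_eq mult.commute)
    moreover have r1': "1 \<le> r" using r nn by linarith
    ultimately have "(Cm + Cm * T + M) * r \<le> N * r * r" by (intro mult_right_mono) auto
    moreover have "(Cm * T + M) * 1 \<le> (Cm * T + M) * r"
      using r1' Cm T_pos M_nonneg by (intro mult_left_mono) auto
    ultimately have "Cm * T + M \<le> N * r\<^sup>2 - Cm * r" by (simp add: power2_eq_square algebra_simps)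
    then show ?thesis using init[of x] \<theta>s[of x] unfolding r_def[symmetric] by simp
  qed
  have \<theta>_mono: "\<theta> s x \<le> \<theta> t x" if "s \<le> t" for t x
  proof -
    have "\<Lambda> * (t1 - t) \<le> \<Lambda> * (t1 - s)" using \<Lambda> that by (intro mult_left_mono) auto
    then have "r1 s x \<le> r1 t x" "r2 s x \<le> r2 t x" by (auto simp: r1_def r2_def)
    then have "(r1 s x)\<^sup>2 \<le> (r1 t x)\<^sup>2" "(r2 s x)\<^sup>2 \<le> (r2 t x)\<^sup>2" using r0 by (auto intro: power_mono)
    then have "N * ((r1 s x)\<^sup>2 + (r2 s x)\<^sup>2) \<le> N * ((r1 t x)\<^sup>2 + (r2 t x)\<^sup>2)" using N by (intro mult_left_mono) auto
    moreover have "0 \<le> \<epsilon> * (t - s)" using \<epsilon> that by simp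
    ultimately show ?thesis by (simp add: \<theta>_def)
  qed
  define Z where "Z d t x = Vd d t x - k * x - c0 + f k * (t - s) + \<theta> t x" for d t x
  have ZD: "\<bar>Z d t x - (D t x + \<theta> t x)\<bar> \<le> M * d" if "0 < d" for d t x
    using Vd_V[OF that, of t x] by (simp add: Z_def D_def)
  have Zlow: "D s x + \<theta> s x - Cm * (t - s) - M * d \<le> Z d t x" if "0 < d" "t \<in> {s..t1}" for d t x
    using ZD[OF that(1), of t x] \<theta>_mono[of t x] D_lip[of t s x x] that s by auto
  \<comment> \<open>The thickness of an initial layer in which \<open>Z\<close> cannot yet have
    dropped below \<open>- 2 * \<mu>\<close>; the compact support starts after it.\<close>
  define \<sigma>1 where "\<sigma>1 = \<mu> / (4 * Cm)"
  have \<sigma>1: "0 < \<sigma>1" "Cm * \<sigma>1 = \<mu> / 4" using Cm \<mu> by (simp_all add: \<sigma>1_def)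
  define d where "d n = min 1 (\<mu> / (4 * (M + 1))) / real (Suc n)" for n
  have d: "0 < d n" "M * d n \<le> \<mu> / 4" "d n \<le> 1" for n
  proof -
    show 1: "0 < d n" using \<mu> M_nonneg by (simp add: d_def)
    have "d n \<le> min 1 (\<mu> / (4 * (M + 1))) / 1"
      unfolding d_def using \<mu> M_nonneg by (intro divide_left_mono) auto
    then have 2: "d n \<le> \<mu> / (4 * (M + 1))" "d n \<le> 1" by auto
    then show "d n \<le> 1" by simp
    have "(M + 1) * d n \<le> \<mu> / 4" using 2 M_nonneg by (simp add: field_simps)
    then show "M * d n \<le> \<mu> / 4" using 1 by (simp add: algebra_simps)
  qed
  have d0: "d \<longlonglongrightarrow> 0" unfolding d_def by (rule LIMSEQ_Suc[OF lim_const_over_n])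
  \<comment> \<open>Small against \<open>t1 - s\<close>, so that the box fits, and against \<mu>, so
    that \<open>Z\<close> stays low on it. The box ends at time \<open>t1 - \<sigma>\<close> because
    the weight and its derivative vanish at \<open>t1\<close>.\<close>
  define \<sigma> where "\<sigma> = min (min 1 ((t1 - s) / 3)) (\<mu> / (2 * (3 * Cm + 2 * N)))"
  have \<sigma>: "0 < \<sigma>" "\<sigma> \<le> 1" "2 * \<sigma> < t1 - s" "3 * Cm * \<sigma> + 2 * N * \<sigma>\<^sup>2 \<le> \<mu> / 2"
  proof -
    have pos: "0 < 3 * Cm + 2 * N" using Cm N by simp
    show 0: "0 < \<sigma>" using s \<mu> pos by (simp add: \<sigma>_def)
    show 1: "\<sigma> \<le> 1" by (simp add: \<sigma>_def)
    have "\<sigma> \<le> (t1 - s) / 3" unfolding \<sigma>_def by (intro min.coboundedI1 min.cobounded2)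
    then have "3 * \<sigma> \<le> t1 - s" by simp
    then show "2 * \<sigma> < t1 - s" using 0 by simp
    have "\<sigma>\<^sup>2 \<le> \<sigma>" using 0 1 by (simp add: power2_eq_square mult_left_le)
    then have "2 * N * \<sigma>\<^sup>2 \<le> 2 * N * \<sigma>" using N by (intro mult_left_mono) auto
    moreover have "\<sigma> \<le> \<mu> / (2 * (3 * Cm + 2 * N))" unfolding \<sigma>_def by (rule min.cobounded2)
    then have "(3 * Cm + 2 * N) * \<sigma> \<le> \<mu> / 2" using pos by (simp add: field_simps)
    ultimately show "3 * Cm * \<sigma> + 2 * N * \<sigma>\<^sup>2 \<le> \<mu> / 2" by (simp add: algebra_simps)
  qed
  define Box where "Box = {t1 - 2 * \<sigma>..t1 - \<sigma>} \<times> {x0 - \<sigma>..x0 + \<sigma>}"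
  have Zbox: "Z (d n) t x \<le> - 3 * \<mu>" if "(t, x) \<in> Box" for n t x
  proof -
    have tx: "t1 - 2 * \<sigma> \<le> t" "t \<le> t1 - \<sigma>" "\<bar>x - x0\<bar> \<le> \<sigma>" using that by (auto simp: Box_def)
    have "\<bar>D t x - D t1 x0\<bar> \<le> Cm * \<bar>t - t1\<bar> + Cm * \<bar>x - x0\<bar>"
      by (rule D_lip) (use s \<sigma> tx in auto)
    moreover have "Cm * \<bar>t - t1\<bar> \<le> Cm * (2 * \<sigma>)" "Cm * \<bar>x - x0\<bar> \<le> Cm * \<sigma>"
      using Cm tx \<sigma> by (auto intro!: mult_left_mono)
    moreover have "D t1 x0 = - 5 * \<mu>" by (simp add: \<mu>_def)
    ultimately have 1: "D t x \<le> - 5 * \<mu> + 3 * Cm * \<sigma>" by linarith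
    have "0 \<le> \<Lambda> * (t1 - t)" using \<Lambda> tx \<sigma> by simp
    then have "r1 t x \<le> \<sigma>" "r2 t x \<le> \<sigma>" using tx \<sigma> by (auto simp: r1_def r2_def)
    then have "(r1 t x)\<^sup>2 \<le> \<sigma>\<^sup>2" "(r2 t x)\<^sup>2 \<le> \<sigma>\<^sup>2" using r0 by (auto intro: power_mono)
    then have "N * ((r1 t x)\<^sup>2 + (r2 t x)\<^sup>2) \<le> N * (2 * \<sigma>\<^sup>2)" using N by (intro mult_left_mono) auto
    moreover have "\<epsilon> * (t - s) \<le> \<epsilon> * T" using \<epsilon> s tx \<sigma> by (intro mult_left_mono) auto
    then have "\<epsilon> * (t - s) \<le> \<mu>" using T_pos by (simp add: \<epsilon>_def)
    ultimately have "\<theta> t x \<le> \<mu> + 2 * N * \<sigma>\<^sup>2" by (simp add: \<theta>_def)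
    with 1 \<sigma>(4) ZD[OF d(1), of n t x] d(2)[of n] show ?thesis by linarith
  qed
  have Zfar: "0 \<le> Z (d n) t x" if "t \<in> {s..t1}" "R0 < \<bar>x - x0\<bar>" for n t x
  proof -
    have "Cm * (t - s) \<le> Cm * T" using Cm that s by (intro mult_left_mono) auto
    moreover have "M * d n \<le> M * 1" using M_nonneg d by (intro mult_left_mono) auto
    ultimately show ?thesis using Zlow[OF d(1) that(1), of x n] init2[OF that(2)] by linarith
  qed
  have Zinit: "- 2 * \<mu> \<le> Z (d n) t x" if "t \<in> {s..t1}" "t \<le> s + \<sigma>1" for n t x
  proof -
    have "Cm * (t - s) \<le> Cm * \<sigma>1" using Cm that by (intro mult_left_mono) auto
    then show ?thesis using Zlow[OF d(1) that(1), of x n] init1[of x] d(2)[of n] \<sigma>1 \<mu> by linarith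
  qed
  define R1 where "R1 = \<bar>x0\<bar> + R0"
  have R0: "1 \<le> R0" using \<Lambda> T_pos Cm M_nonneg N by (simp add: R0_def)
  \<comment> \<open>\<open>A0\<close> bounds \<open>Af\<close>: the weight is at most
    \<open>T\<^sup>2\<close>, \<open>bump\<close> is at most 2, and the argument of the cutoff is
    scaled by \<open>1 / \<mu>\<close>. Likewise \<open>C2\<close> collects the constants of the
    averaging errors, and \<open>a\<close> is the gain per unit area on the box.\<close>
  define A0 where "A0 = 2 * T\<^sup>2 / \<mu>"
  have A0: "0 \<le> A0" using \<mu> by (simp add: A0_def)
  define C2 where "C2 = A0 * ((\<Lambda> * (M + \<bar>k\<bar>) + \<epsilon>) + \<Lambda> * (\<Lambda> * (M + \<bar>k\<bar>)))"
  define a where "a = 2 * \<epsilon> * \<sigma>"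
  define e1 where "e1 n t = (\<integral>x. indicator {-R1..R1} x * \<bar>u t x - ud (d n) t x\<bar> \<partial>lborel)" for n t
  define e2 where "e2 n t = (\<integral>x. indicator {-R1..R1} x * \<bar>f (u t x) - fd (d n) t x\<bar> \<partial>lborel)" for n t
  have R1: "0 \<le> R1" using R0 by (simp add: R1_def)
  obtain \<Lambda>' where "0 < \<Lambda>'" and \<Lambda>': "\<And>v v'. \<bar>v\<bar> \<le> M \<Longrightarrow> \<bar>v'\<bar> \<le> M \<Longrightarrow> \<bar>f v - f v'\<bar> \<le> \<Lambda>' * \<bar>v - v'\<bar>"
    using f_lip by blast
  note err1 = average_error_tendsto[where h = "\<lambda>v. v" and C = 1, OF continuous_on_id _ R1 d(1) d0, simplified,
      folded ud_def, folded e1_def]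
  note err2 = average_error_tendsto[OF continuous_f[OF continuous_on_id] \<Lambda>' R1 d(1) d0, folded fd_def, folded e2_def]
  have key: "a * (\<sigma> * (2 * \<sigma>)) \<le> C2 * ((\<integral>t. indicator {0..T} t * e1 n t \<partial>lborel) + (\<integral>t. indicator {0..T} t * e2 n t \<partial>lborel))" for n
  proof -
    let ?d = "d n"
    define \<Omega> where "\<Omega> = {s<..<T} \<times> (UNIV :: real set)"
    define K where "K = {s + \<sigma>1..t1} \<times> {x0 - R0..x0 + R0}"
    define w where "w z = (max 0 (t1 - fst z))\<^sup>2" for z :: "real \<times> real"
    define be where "be z = step ((- 2 * \<mu> - Z ?d (fst z) (snd z)) / \<mu>)" for z
    \<comment> \<open>The weight times minus the derivative of the cutoff with respect to
      \<open>Z\<close>. Through this factor the derivatives of the potential enter the entropy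
      inequality.\<close>
    define Af where "Af z = w z * bump ((- 2 * \<mu> - Z ?d (fst z) (snd z)) / \<mu>) / \<mu>" for z
    define \<phi> where "\<phi> z = w z * be z" for z
    define p where "p z = - 2 * max 0 (t1 - fst z) * be z - Af z * (f k - fd ?d (fst z) (snd z) + \<theta>t (fst z) (snd z))" for z
    define q where "q z = - Af z * (ud ?d (fst z) (snd z) - k + \<theta>x (fst z) (snd z))" for z
    have s\<Omega>: "{s<..<T} \<subseteq> {0<..<T}" using s by auto
    have \<Omega>: "open \<Omega>" "compact K" "K \<subseteq> \<Omega>"
      using s \<sigma>1 by (auto simp: \<Omega>_def K_def intro: open_Times compact_Times)
    \<comment> \<open>Off \<open>K\<close> either the time is past \<open>t1\<close>, where the
      weight vanishes with its derivative, or it lies in the initial layer, or \<open>x\<close> is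
      far away. In the last two cases the cutoff vanishes with its derivative.\<close>
    have off: "be z = 0 \<and> Af z = 0 \<or> w z = 0 \<and> max 0 (t1 - fst z) = 0 \<and> Af z = 0" if "z \<in> \<Omega> - K" for z
    proof (cases "t1 < fst z")
      case False
      have "- 2 * \<mu> \<le> Z ?d (fst z) (snd z)"
      proof (cases "fst z \<le> s + \<sigma>1")
        case True
        then show ?thesis using that False by (intro Zinit) (auto simp: \<Omega>_def)
      next
        case F2: False
        then have "R0 < \<bar>snd z - x0\<bar>" using that False by (auto simp: K_def \<Omega>_def)
        then have "0 \<le> Z ?d (fst z) (snd z)" using that False by (intro Zfar) (auto simp: \<Omega>_def)
        then show ?thesis using \<mu> by simp
      qed
      then have "(- 2 * \<mu> - Z ?d (fst z) (snd z)) / \<mu> \<le> 0" using \<mu> by (simp add: divide_le_0_iff)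
      then have "be z = 0" "bump ((- 2 * \<mu> - Z ?d (fst z) (snd z)) / \<mu>) = 0"
        by (auto simp: be_def step_eq_0 bump_def clamp01_def)
      then show ?thesis by (simp add: Af_def)
    qed (auto simp: w_def Af_def)
    have cr: "continuous_on S (\<lambda>z. r1 (fst z) (snd z))" "continuous_on S (\<lambda>z. r2 (fst z) (snd z))" for S
      unfolding r1_def r2_def by (intro continuous_intros)+
    have "continuous_on \<Omega> (\<lambda>(t, x). Vd ?d t x)"
      unfolding continuous_on_eq_continuous_within
    proof (rule ballI, rule continuous_at_imp_continuous_within)
      fix z assume "z \<in> \<Omega>"
      then have "((\<lambda>(t, x). Vd ?d t x) has_derivative
          (\<lambda>h. - fd ?d (fst z) (snd z) * fst h + ud ?d (fst z) (snd z) * snd h)) (at (fst z, snd z))"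
        using s\<Omega> by (intro Vd_grad[OF d(1)]) (auto simp: \<Omega>_def)
      then show "isCont (\<lambda>(t, x). Vd ?d t x) z" by (metis has_derivative_continuous prod.collapse)
    qed
    then have cV: "continuous_on \<Omega> (\<lambda>z. Vd ?d (fst z) (snd z))" by (simp add: split_beta')
    have cu: "continuous_on \<Omega> (\<lambda>z. ud ?d (fst z) (snd z))" and cf: "continuous_on \<Omega> (\<lambda>z. fd ?d (fst z) (snd z))"
      using continuous_ud[OF d(1)] continuous_fd[OF d(1)] by (auto simp: split_beta' intro: continuous_on_subset)
    have cZ: "continuous_on \<Omega> (\<lambda>z. Z ?d (fst z) (snd z))"
      unfolding Z_def \<theta>_def by (intro continuous_intros cV cr)
    have \<mu>0: "\<mu> \<noteq> 0" using \<mu> by simp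
    have cA: "continuous_on \<Omega> Af" unfolding Af_def w_def using \<mu>0 by (intro continuous_intros cZ) auto
    have cb: "continuous_on \<Omega> be" unfolding be_def using \<mu>0 by (intro continuous_intros cZ) auto
    have cp: "continuous_on \<Omega> p" unfolding p_def \<theta>t_def by (intro continuous_intros cA cb cf cr)
    have cq: "continuous_on \<Omega> q" unfolding q_def \<theta>x_def by (intro continuous_intros cA cu cr)
    have der: "(\<phi> has_derivative (\<lambda>h. p z * fst h + q z * snd h)) (at z)" if "z \<in> \<Omega>" for z
    proof -
      have Zt: "((\<lambda>t. Z ?d t x) has_real_derivative - fd ?d t x + f k + \<theta>t t x) (at t)" if "t \<in> {s<..<T}" for t x
      proof -
        have "((\<lambda>t. - k * x - c0 + f k * (t - s) + \<theta> t x) has_real_derivative f k + \<theta>t t x) (at t)"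
          unfolding \<theta>_def \<theta>t_def r1_def r2_def
          by (auto intro!: derivative_eq_intros simp: algebra_simps)
        from DERIV_add[OF Vd_DERIV_t[OF d(1)] this] show ?thesis
          using that s unfolding Z_def by (simp add: algebra_simps)
      qed
      have Zx: "((\<lambda>x. Z ?d t x) has_real_derivative ud ?d t x - k + \<theta>x t x) (at x)" for t x
      proof -
        have "((\<lambda>x. - k * x - c0 + f k * (t - s) + \<theta> t x) has_real_derivative - k + \<theta>x t x) (at x)"
          unfolding \<theta>_def \<theta>x_def r1_def r2_def
          by (auto intro!: derivative_eq_intros simp: algebra_simps)
        from DERIV_add[OF Vd_x[OF d(1)] this] show ?thesis
          unfolding Z_def by (simp add: algebra_simps)
      qed
      have "(\<phi> has_derivative (\<lambda>h. p (fst z, snd z) * fst h + q (fst z, snd z) * snd h)) (at (fst z, snd z))"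
      proof (rule has_derivative_strip)
        show "fst z \<in> {s<..<T}" using that by (auto simp: \<Omega>_def)
        show "((\<lambda>t. \<phi> (t, x)) has_real_derivative p (t, x)) (at t)" if "t \<in> {s<..<T}" for t x
        proof -
          have "((\<lambda>t. (- 2 * \<mu> - Z ?d t x) / \<mu>) has_real_derivative (0 - (- fd ?d t x + f k + \<theta>t t x)) / \<mu>) (at t)"
            by (intro DERIV_cdivide DERIV_diff DERIV_const Zt that)
          from DERIV_mult[OF pos_square_DERIV'[of "\<lambda>t. t1 - t" "-1"] step_DERIV[OF this]]
          show ?thesis unfolding \<phi>_def p_def w_def be_def Af_def fst_conv snd_conv
            by (rule DERIV_cong) (auto intro!: derivative_eq_intros simp: field_simps \<mu>0)
        qed
        show "((\<lambda>x. \<phi> (t, x)) has_real_derivative q (t, x)) (at x)" for t x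
        proof -
          have "((\<lambda>x. (- 2 * \<mu> - Z ?d t x) / \<mu>) has_real_derivative (0 - (ud ?d t x - k + \<theta>x t x)) / \<mu>) (at x)"
            by (intro DERIV_cdivide DERIV_diff DERIV_const Zx)
          from DERIV_cmult[OF step_DERIV[OF this], of "(max 0 (t1 - t))\<^sup>2"]
          show ?thesis unfolding \<phi>_def q_def w_def be_def Af_def fst_conv snd_conv
            by (rule DERIV_cong) (auto simp: field_simps \<mu>0)
        qed
        show "continuous_on ({s<..<T} \<times> UNIV) q" using cq by (simp add: \<Omega>_def)
      qed
      then show ?thesis by simp
    qed
    have offs: "\<phi> z = 0 \<and> p z = 0 \<and> q z = 0" if "z \<in> \<Omega> - K" for z
      using off[OF that] by (auto simp: \<phi>_def p_def q_def)
    define P where "P z = (if z \<in> \<Omega> then p z else 0)" for z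
    define Q where "Q z = (if z \<in> \<Omega> then q z else 0)" for z
    have grad: "has_C1_grad (\<lambda>z. if z \<in> \<Omega> then \<phi> z else 0) P Q"
      unfolding P_def Q_def by (rule has_C1_grad_extend_by_0[OF \<Omega> der cp cq offs])
    have KT: "K \<subseteq> {0<..<T} \<times> UNIV" using \<Omega>(3) s\<Omega> by (auto simp: \<Omega>_def)
    have \<phi>0: "(if z \<in> \<Omega> then \<phi> z else 0) = 0" if "z \<notin> K" for z using that offs by auto
    have \<phi>p: "0 \<le> (if z \<in> \<Omega> then \<phi> z else 0)" for z
      using step_range by (auto simp: \<phi>_def w_def be_def)
    define I where "I t x = (\<Lambda> * \<bar>u t x - k\<bar> + \<epsilon>) * P (t, x) + \<Lambda> * (sgn (u t x - k) * (f (u t x) - f k)) * Q (t, x)" for t x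
    note ew = entropy_weighted[where k = k and \<epsilon> = \<epsilon> and \<Lambda> = \<Lambda>, OF grad \<Omega>(2) KT]
    have ent1: "0 \<le> (\<integral>t. \<integral>x. I t x \<partial>lborel \<partial>lborel)"
      unfolding I_def by (rule ew(1)) (use \<phi>0 \<phi>p \<Lambda> in auto)
    have ent2: "integrable lborel (\<lambda>x. I t x)" for t
      unfolding I_def by (rule ew(2)) (use \<phi>0 \<phi>p \<Lambda> in auto)
    have ent3: "integrable lborel (\<lambda>t. \<integral>x. I t x \<partial>lborel)"
      unfolding I_def by (rule ew(3)) (use \<phi>0 \<phi>p \<Lambda> in auto)
    \<comment> \<open>A fixed loss on the box plus averaging errors. It dominates \<open>I\<close>
      pointwise and can be integrated explicitly.\<close>
    define J where "J t x = - a * (indicator {t1 - 2 * \<sigma>..t1 - \<sigma>} t * indicator {x0 - \<sigma>..x0 + \<sigma>} x)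
      + C2 * (indicator {0..T} t * (indicator {-R1..R1} x * \<bar>u t x - ud ?d t x\<bar> + indicator {-R1..R1} x * \<bar>f (u t x) - fd ?d t x\<bar>))" for t x
    have IJ: "I t x \<le> J t x" for t x
    proof (cases "(t, x) \<in> K")
      case False
      have "P (t, x) = 0" "Q (t, x) = 0" using offs[of "(t, x)"] False by (auto simp: P_def Q_def)
      then have "I t x = 0" by (simp add: I_def)
      moreover have "(t, x) \<notin> Box"
      proof
        assume bx: "(t, x) \<in> Box"
        then have "(t, x) \<in> \<Omega>" using \<sigma> s by (auto simp: Box_def \<Omega>_def)
        then have "be (t, x) = 0 \<or> max 0 (t1 - t) = 0" using off[of "(t, x)"] False by auto
        moreover have "be (t, x) = 1" unfolding be_def using Zbox[OF bx, of n] \<mu> by (intro step_eq_1) (simp add: le_divide_eq)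
        ultimately show False using bx \<sigma> by (auto simp: Box_def)
      qed
      then have "indicator {t1 - 2 * \<sigma>..t1 - \<sigma>} t * indicator {x0 - \<sigma>..x0 + \<sigma>} x = (0 :: real)"
        by (auto simp: Box_def indicator_def)
      moreover have "0 \<le> C2" unfolding C2_def using A0 \<Lambda> \<epsilon> M_nonneg by simp
      then have "0 \<le> C2 * (indicator {0..T} t * (indicator {-R1..R1} x * \<bar>u t x - ud ?d t x\<bar> + indicator {-R1..R1} x * \<bar>f (u t x) - fd ?d t x\<bar>))"
        by (intro mult_nonneg_nonneg add_nonneg_nonneg) auto
      ultimately show ?thesis unfolding J_def by (simp only: mult_zero_right add_0_left)
    next
      case True
      then have in\<Omega>: "(t, x) \<in> \<Omega>" using \<Omega>(3) by blast
      have t: "t \<in> {0..T}" using in\<Omega> s by (auto simp: \<Omega>_def)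
      have x: "x \<in> {-R1..R1}" using True by (auto simp: K_def R1_def)
      define \<eta> where "\<eta> = \<bar>u t x - k\<bar>"
      define S where "S = sgn (u t x - k) * (f (u t x) - f k)"
      have \<eta>: "0 \<le> \<eta>" "\<eta> \<le> M + \<bar>k\<bar>" using u_bdd[of t x] by (auto simp: \<eta>_def)
      have flx: "\<bar>f (u t x) - f k\<bar> \<le> \<Lambda> * \<eta>" unfolding \<eta>_def by (rule lipk[OF u_bdd])
      have Sl: "\<bar>S\<bar> \<le> \<Lambda> * \<eta>"
        unfolding S_def abs_mult using flx using \<Lambda> \<eta> by (auto simp: abs_sgn_eq)
      have Seq: "S * (u t x - k) = \<eta> * (f (u t x) - f k)"
        by (auto simp: S_def \<eta>_def sgn_if abs_if)
      have A: "0 \<le> Af (t, x)" "Af (t, x) \<le> A0"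
      proof -
        show "0 \<le> Af (t, x)" unfolding Af_def w_def using bump_nonneg \<mu> by simp
        have "(max 0 (t1 - t))\<^sup>2 \<le> T\<^sup>2" using t s by (intro power_mono) auto
        then have "w (t, x) * bump ((- 2 * \<mu> - Z ?d t x) / \<mu>) \<le> T\<^sup>2 * 2"
          unfolding w_def by (intro mult_mono bump_le bump_nonneg) auto
        then show "Af (t, x) \<le> A0" unfolding Af_def A0_def using \<mu> by (simp add: divide_right_mono mult.commute)
      qed
      let ?E1 = "\<bar>u t x - ud ?d t x\<bar>" and ?E2 = "\<bar>f (u t x) - fd ?d t x\<bar>"
      let ?Bq = "(\<Lambda> * \<eta> + \<epsilon>) * (f k - fd ?d t x + \<theta>t t x) + \<Lambda> * S * (ud ?d t x - k + \<theta>x t x)"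
      \<comment> \<open>Here \<open>F\<close>, \<open>U\<close> are \<open>f u\<close>,
        \<open>u\<close> and \<open>G\<close>, \<open>m\<close> are their averages: the derivatives
        of \<open>Z\<close> are those of the averaged potential minus the affine solution, plus
        those of the penalty.\<close>
      have "- ((\<Lambda> * \<eta> + \<epsilon>) * ?E2 + \<Lambda> * (\<Lambda> * \<eta>) * ?E1) \<le> ?Bq"
        by (rule kruzkov_cancellation[OF \<eta>(1) Seq Sl flx \<theta>_ineq]) (use \<epsilon> \<Lambda> in auto)
      then have "- ?Bq \<le> (\<Lambda> * \<eta> + \<epsilon>) * ?E2 + \<Lambda> * (\<Lambda> * \<eta>) * ?E1" by linarith
      then have "Af (t, x) * (- ?Bq) \<le> Af (t, x) * ((\<Lambda> * \<eta> + \<epsilon>) * ?E2 + \<Lambda> * (\<Lambda> * \<eta>) * ?E1)"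
        by (rule mult_left_mono[OF _ A(1)])
      also have "\<dots> \<le> A0 * ((\<Lambda> * (M + \<bar>k\<bar>) + \<epsilon>) * ?E2 + \<Lambda> * (\<Lambda> * (M + \<bar>k\<bar>)) * ?E1)"
        using A A0 \<eta> \<epsilon> \<Lambda> by (intro mult_mono add_mono mult_right_mono mult_left_mono) auto
      also have "\<dots> \<le> C2 * (?E1 + ?E2)"
      proof -
        have nn: "0 \<le> \<Lambda> * (M + \<bar>k\<bar>) + \<epsilon>" "0 \<le> \<Lambda> * (\<Lambda> * (M + \<bar>k\<bar>))" using \<epsilon> \<Lambda> M_nonneg by auto
        then have "0 \<le> (\<Lambda> * (M + \<bar>k\<bar>) + \<epsilon>) * ?E1 + \<Lambda> * (\<Lambda> * (M + \<bar>k\<bar>)) * ?E2"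
          using mult_nonneg_nonneg[OF nn(1), of ?E1] mult_nonneg_nonneg[OF nn(2), of ?E2] by linarith
        then have "(\<Lambda> * (M + \<bar>k\<bar>) + \<epsilon>) * ?E2 + \<Lambda> * (\<Lambda> * (M + \<bar>k\<bar>)) * ?E1
            \<le> ((\<Lambda> * (M + \<bar>k\<bar>) + \<epsilon>) + \<Lambda> * (\<Lambda> * (M + \<bar>k\<bar>))) * (?E1 + ?E2)"
          unfolding distrib_right distrib_left by linarith
        then show ?thesis unfolding C2_def mult.assoc[of A0] using A0 by (intro mult_left_mono)
      qed
      finally have part: "Af (t, x) * (- ?Bq) \<le> C2 * (?E1 + ?E2)" .
      have Ieq: "I t x = - ((\<Lambda> * \<eta> + \<epsilon>) * (2 * max 0 (t1 - t) * be (t, x))) + Af (t, x) * (- ?Bq)"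
        unfolding I_def S_def[symmetric] \<eta>_def[symmetric] P_def Q_def using in\<Omega>
        by (simp add: p_def q_def algebra_simps)
      have bn: "0 \<le> be (t, x)" unfolding be_def by (rule step_range)
      \<comment> \<open>The decrease of the weight in time is the source of the strict sign; without
        \<epsilon> it would be lost where \<open>u t x = k\<close>.\<close>
      have "- ((\<Lambda> * \<eta> + \<epsilon>) * (2 * max 0 (t1 - t) * be (t, x))) \<le> - a * indicator Box (t, x)"
      proof (cases "(t, x) \<in> Box")
        case True
        have "be (t, x) = 1" unfolding be_def using Zbox[OF True, of n] \<mu> by (intro step_eq_1) (simp add: le_divide_eq)
        moreover have "\<sigma> \<le> max 0 (t1 - t)" using True by (auto simp: Box_def)
        then have "\<epsilon> * (2 * \<sigma>) \<le> (\<Lambda> * \<eta> + \<epsilon>) * (2 * max 0 (t1 - t))"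
          using \<epsilon> \<Lambda> \<eta> \<sigma> by (intro mult_mono) auto
        ultimately show ?thesis using True by (simp add: a_def mult.commute mult.left_commute)
      next
        case False
        then show ?thesis using bn \<epsilon> \<Lambda> \<eta> by simp
      qed
      moreover have "indicator Box (t, x) = (indicator {t1 - 2 * \<sigma>..t1 - \<sigma>} t * indicator {x0 - \<sigma>..x0 + \<sigma>} x :: real)"
        by (auto simp: Box_def indicator_def)
      ultimately show ?thesis using part Ieq t x by (simp add: J_def)
    qed
    have iJ: "integrable lborel (J t)" for t
      unfolding J_def using err1(3)[of t n] err2(3)[of t n]
      by (intro Bochner_Integration.integrable_add integrable_mult_right integrable_indicator_Icc)
    have Jint: "(\<integral>x. J t x \<partial>lborel) = - a * (2 * \<sigma>) * indicator {t1 - 2 * \<sigma>..t1 - \<sigma>} t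
        + C2 * (indicator {0..T} t * e1 n t + indicator {0..T} t * e2 n t)" for t
    proof -
      have "(\<integral>x. J t x \<partial>lborel) = - a * (indicator {t1 - 2 * \<sigma>..t1 - \<sigma>} t * (\<integral>x. indicator {x0 - \<sigma>..x0 + \<sigma>} x \<partial>lborel))
        + C2 * (indicator {0..T} t * (e1 n t + e2 n t))"
        unfolding J_def e1_def e2_def using err1(3)[of t n] err2(3)[of t n]
        by simp
      then show ?thesis using \<sigma> by (simp add: distrib_left)
    qed
    have "0 \<le> (\<integral>t. \<integral>x. I t x \<partial>lborel \<partial>lborel)" by (rule ent1)
    also have "\<dots> \<le> (\<integral>t. \<integral>x. J t x \<partial>lborel \<partial>lborel)"
    proof (rule integral_mono[OF ent3])
      show "integrable lborel (\<lambda>t. \<integral>x. J t x \<partial>lborel)"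
        unfolding Jint using err1(1)[of n] err2(1)[of n]
        by (intro Bochner_Integration.integrable_add integrable_mult_right integrable_indicator_Icc)
      show "(\<integral>x. I t x \<partial>lborel) \<le> (\<integral>x. J t x \<partial>lborel)" for t
        by (rule integral_mono[OF ent2 iJ IJ])
    qed
    also have "\<dots> = - a * (2 * \<sigma>) * \<sigma> + C2 * ((\<integral>t. indicator {0..T} t * e1 n t \<partial>lborel) + (\<integral>t. indicator {0..T} t * e2 n t \<partial>lborel))"
      unfolding Jint using err1(1)[of n] err2(1)[of n] \<sigma> by simp
    finally show ?thesis by (simp add: algebra_simps)
  qed
  have "(\<lambda>n. C2 * ((\<integral>t. indicator {0..T} t * e1 n t \<partial>lborel) + (\<integral>t. indicator {0..T} t * e2 n t \<partial>lborel))) \<longlonglongrightarrow> C2 * (0 + 0)"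
    by (intro tendsto_intros err1(2) err2(2))
  from LIMSEQ_le_const[OF this, of "a * (\<sigma> * (2 * \<sigma>))"] key have "a * (\<sigma> * (2 * \<sigma>)) \<le> 0" by auto
  moreover have "0 < a * (\<sigma> * (2 * \<sigma>))" using \<epsilon> \<sigma> by (simp add: a_def)
  ultimately show False by linarith
qed

end

section \<open>The Hopf-Lax formula\<close>

context convex_flux
begin

text \<open>By convexity the slopes at the two end points control everything in between. This admits
  a \<open>k\<close> outside \<open>{- M..M}\<close>, as may occur for \<open>k = b a\<close> with
  \<open>\<bar>a\<bar> \<le> \<Lambda>\<close>.\<close>

lemma f_lipschitz_slopes:
  assumes "\<bar>deriv f x\<bar> \<le> \<Lambda>" "\<bar>deriv f y\<bar> \<le> \<Lambda>"
  shows "\<bar>f x - f y\<bar> \<le> \<Lambda> * \<bar>x - y\<bar>"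
proof -
  have *: "f x - f y \<le> \<Lambda> * \<bar>x - y\<bar>" if "\<bar>deriv f x\<bar> \<le> \<Lambda>" for x y
  proof -
    have "f x - f y \<le> deriv f x * (x - y)" using f_above_tangent[of x y] by (simp add: algebra_simps)
    also have "\<dots> \<le> \<bar>deriv f x\<bar> * \<bar>x - y\<bar>" by (metis abs_ge_self abs_mult)
    also have "\<dots> \<le> \<Lambda> * \<bar>x - y\<bar>" using that by (intro mult_right_mono) auto
    finally show ?thesis .
  qed
  show ?thesis using *[OF assms(1), of y] *[OF assms(2), of x] by (simp add: abs_minus_commute abs_le_iff)
qed

text \<open>Of the four slopes, \<open>A\<close> is the smallest, \<open>D\<close> the largest, and
  \<open>A + D = B + C\<close>; strict convexity of \<open>L\<close> favours the middle pair. For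
  straight lines from time 0 to time \<open>T\<close> this says that uncrossing two of them lowers
  the total cost.\<close>

lemma L_crossing:
  assumes "x < x'" "y' < y" "0 < T"
  shows "L ((x - y') / T) + L ((x' - y) / T) < L ((x - y) / T) + L ((x' - y') / T)"
proof -
  define A B C D where "A = (x - y) / T" "B = (x - y') / T" "C = (x' - y) / T" "D = (x' - y') / T"
  note defs = this
  have ne: "B \<noteq> D" "C \<noteq> A" "C \<noteq> D" "B \<noteq> A" using assms by (auto simp: defs)
  have DB: "D - B = (x' - x) / T" "C - A = (x' - x) / T" "D - C = (y - y') / T" "B - A = (y - y') / T"
    by (simp_all add: defs flip: diff_divide_distrib)
  show ?thesis
  \<comment> \<open>The tangent at the larger middle slope is used towards \<open>D\<close>, the one
    at the smaller towards \<open>A\<close>.\<close>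
  proof (cases "C \<le> B")
    case True
    have "b C * (D - B) \<le> b B * (D - B)" using True assms unfolding DB by (intro mult_right_mono) auto
    moreover have "L B + b B * (D - B) < L D" by (rule L_strict[OF ne(1)])
    moreover have "L C + b C * (A - C) < L A" by (rule L_strict[OF ne(2)])
    moreover have "b C * (A - C) = - (b C * (D - B))" using DB by (simp add: algebra_simps)
    ultimately show ?thesis unfolding defs[symmetric] by linarith
  next
    case False
    have "b B * (D - C) \<le> b C * (D - C)" using False assms unfolding DB by (intro mult_right_mono) auto
    moreover have "L C + b C * (D - C) < L D" by (rule L_strict[OF ne(3)])
    moreover have "L B + b B * (A - B) < L A" by (rule L_strict[OF ne(4)])
    moreover have "b B * (A - B) = - (b B * (D - C))" using DB by (simp add: algebra_simps)
    ultimately show ?thesis unfolding defs[symmetric] by linarith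
  qed
qed

end

context entropy_slices
begin

text \<open>Test functions vanish near time \<open>T\<close>, so
  \<open>cone_comparison_interior\<close> stops short of it. The tip is now reached from the times
  \<open>t1 - h\<close>, by the Lipschitz bound in time.\<close>

lemma cone_comparison:
  assumes s: "0 \<le> s" "s < t1" "t1 \<le> T" and \<Lambda>: "0 < \<Lambda>"
    and lipk: "\<And>v. \<bar>v\<bar> \<le> M \<Longrightarrow> \<bar>f v - f k\<bar> \<le> \<Lambda> * \<bar>v - k\<bar>"
    and H: "\<And>y. \<bar>y - x0\<bar> \<le> \<Lambda> * (t1 - s) \<Longrightarrow> k * y + c0 \<le> V s y"
  shows "k * x0 + c0 - f k * (t1 - s) \<le> V t1 x0"
proof -
  obtain B where B: "0 \<le> B" "\<And>v. \<bar>v\<bar> \<le> M \<Longrightarrow> \<bar>f v\<bar> \<le> B" using f_bdd by blast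
  show ?thesis
  proof (rule le_of_le_add_mult)
    fix d :: real assume d: "0 < d"
    define h where "h = min d ((t1 - s) / 2)"
    have h: "0 < h" "h \<le> d" "h \<le> (t1 - s) / 2"
      using d s by (simp add: h_def) (simp_all only: h_def min.cobounded1 min.cobounded2)
    have "\<Lambda> * (t1 - h - s) \<le> \<Lambda> * (t1 - s)" using \<Lambda> h by (intro mult_left_mono) auto
    then have "k * x0 + c0 - f k * (t1 - h - s) \<le> V (t1 - h) x0"
      using h s by (intro cone_comparison_interior[OF s(1) _ _ \<Lambda> lipk H]) auto
    moreover have "\<bar>V (t1 - h) x0 - V t1 x0\<bar> \<le> B * \<bar>(t1 - h) - t1\<bar>"
      using s h by (intro V_lipschitz_t[OF B(2)]) auto
    moreover have "B * \<bar>(t1 - h) - t1\<bar> \<le> B * d" using h B by (intro mult_left_mono) auto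
    moreover have "f k * (t1 - h - s) = f k * (t1 - s) - f k * h" by (simp add: algebra_simps)
    moreover have "f k * h \<ge> - (\<bar>f k\<bar> * d)"
    proof -
      have "\<bar>f k * h\<bar> \<le> \<bar>f k\<bar> * d" unfolding abs_mult using h by (intro mult_left_mono) auto
      then show ?thesis by linarith
    qed
    ultimately show "k * x0 + c0 - f k * (t1 - s) \<le> V t1 x0 + (B + \<bar>f k\<bar>) * d"
      unfolding distrib_right by linarith
  qed
qed

text \<open>The lower bound at time \<open>s\<close> is concave in \<open>y\<close>. Its tangent at
  the foot \<open>y1\<close> of the line through \<open>y0\<close> at time \<open>t\<close> and
  \<open>x0\<close> at time \<open>T\<close> is affine, so the cone comparison can carry it to time
  \<open>t\<close>. Along that line the Hopf-Lax expression is transported exactly; only the gap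
  between the concave function and its tangent is lost.\<close>

lemma hopf_lax_step:
  assumes \<Lambda>: "0 < \<Lambda>" "\<And>v. \<bar>v\<bar> \<le> M \<Longrightarrow> \<bar>deriv f v\<bar> \<le> \<Lambda>"
    and s: "0 \<le> s" "s < t" "t \<le> T - \<eta>" and \<eta>: "0 < \<eta>"
    and E: "\<And>y. \<bar>y - x0\<bar> \<le> \<Lambda> * (T - s) \<Longrightarrow> U - (T - s) * L ((x0 - y) / (T - s)) - e \<le> V s y"
    and y0: "\<bar>y0 - x0\<bar> \<le> \<Lambda> * (T - t)"
  shows "U - (T - t) * L ((x0 - y0) / (T - t)) - (e + (2 * \<Lambda> * (t - s))\<^sup>2 / (c * \<eta>)) \<le> V t y0"
proof -
  define a where "a = (x0 - y0) / (T - t)"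
  define k where "k = b a"
  define y1 where "y1 = y0 - a * (t - s)"
  define err where "err = (2 * \<Lambda> * (t - s))\<^sup>2 / (c * \<eta>)"
  have Tt: "0 < T - t" "0 < T - s" "\<eta> \<le> T - s" using s \<eta> by auto
  have a: "\<bar>a\<bar> \<le> \<Lambda>"
    using y0 Tt by (simp add: a_def divide_le_eq abs_divide abs_minus_commute mult.commute)
  have xa: "x0 - y0 = a * (T - t)" using Tt by (simp add: a_def)
  then have x1: "x0 - y1 = a * (T - s)" by (simp add: y1_def algebra_simps)
  have "k * y0 + (U - (T - s) * L a - k * y1 - e - err) - f k * (t - s) \<le> V t y0"
  proof (rule cone_comparison[OF s(1,2) _ \<Lambda>(1)])
    show "t \<le> T" using s \<eta> by simp
    show "\<bar>f v - f k\<bar> \<le> \<Lambda> * \<bar>v - k\<bar>" if "\<bar>v\<bar> \<le> M" for v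
      using \<Lambda>(2)[OF that] a by (intro f_lipschitz_slopes) (auto simp: k_def)
    fix y assume y: "\<bar>y - y0\<bar> \<le> \<Lambda> * (t - s)"
    have "\<bar>y - x0\<bar> \<le> \<bar>y - y0\<bar> + \<bar>y0 - x0\<bar>" by linarith
    also have "\<dots> \<le> \<Lambda> * (t - s) + \<Lambda> * (T - t)" by (rule add_mono[OF y y0])
    also have "\<dots> = \<Lambda> * (T - s)" by (simp add: algebra_simps)
    finally have V: "U - (T - s) * L ((x0 - y) / (T - s)) - e \<le> V s y" by (rule E)
    define a' where "a' = (x0 - y) / (T - s)"
    have a'a: "a' - a = (y1 - y) / (T - s)" using x1 Tt by (simp add: a'_def field_simps)
    have "(T - s) * L a' \<le> (T - s) * (L a + b a * (a' - a) + (a' - a)\<^sup>2 / c)"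
      using Tt by (intro mult_left_mono L_below_parabola) auto
    also have "\<dots> = (T - s) * L a + k * (y1 - y) + (y1 - y)\<^sup>2 / (c * (T - s))"
    proof -
      have "r * (A + B * (q / r) + (q / r)\<^sup>2 / c) = r * A + B * q + q\<^sup>2 / (c * r)" if "0 < r" for r A B q :: real
        using that c_pos by (simp add: field_simps power2_eq_square)
      from this[OF Tt(2)] show ?thesis unfolding a'a k_def .
    qed
    \<comment> \<open>Both \<open>y1\<close> and \<open>y\<close> lie within
      \<open>\<Lambda> * (t - s)\<close> of \<open>y0\<close>. The gap also contains
      \<open>1 / (T - s)\<close>, which is why the step has to end at a distance \<eta> from
      \<open>T\<close>.\<close>
    also have "(y1 - y)\<^sup>2 / (c * (T - s)) \<le> err"
    proof -
      have "\<bar>a * (t - s)\<bar> \<le> \<Lambda> * (t - s)" unfolding abs_mult using a s by (intro mult_mono) auto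
      then have "\<bar>y1 - y\<bar> \<le> 2 * \<Lambda> * (t - s)" using y by (simp add: y1_def)
      then have "(y1 - y)\<^sup>2 \<le> (2 * \<Lambda> * (t - s))\<^sup>2" by (metis abs_ge_zero power2_abs power_mono)
      moreover have "c * \<eta> \<le> c * (T - s)" using Tt c_pos by (intro mult_left_mono) auto
      ultimately show ?thesis unfolding err_def using c_pos \<eta> by (intro frac_le) auto
    qed
    finally have "(T - s) * L a' \<le> (T - s) * L a + k * (y1 - y) + err" by simp
    then show "k * y + (U - (T - s) * L a - k * y1 - e - err) \<le> V s y"
      using V unfolding a'_def[symmetric] by (simp add: algebra_simps)
  qed
  moreover have "k * y0 + (U - (T - s) * L a - k * y1 - e - err) - f k * (t - s) = U - (T - t) * L a - (e + err)"
    unfolding L_def y1_def k_def by (simp add: algebra_simps)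
  ultimately show ?thesis unfolding a_def err_def by simp
qed

text \<open>The error of \<open>n\<close> steps is \<open>n\<close> times a multiple of
  \<open>1 / n\<^sup>2\<close>, which tends to 0. The stepping ends at \<open>T - \<eta>\<close>,
  since the constant contains \<open>1 / \<eta>\<close>; the Lipschitz bound in time covers the
  rest.\<close>

lemma hopf_lax_lower:
  assumes \<Lambda>: "0 < \<Lambda>" "\<And>v. \<bar>v\<bar> \<le> M \<Longrightarrow> \<bar>deriv f v\<bar> \<le> \<Lambda>"
    and U: "\<And>y. \<bar>y - x0\<bar> \<le> \<Lambda> * T \<Longrightarrow> U \<le> V 0 y + T * L ((x0 - y) / T)"
  shows "U \<le> V T x0"
proof -
  obtain B where B: "0 \<le> B" "\<And>v. \<bar>v\<bar> \<le> M \<Longrightarrow> \<bar>f v\<bar> \<le> B" using f_bdd by blast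
  have 1: "U \<le> V (T - \<eta>) x0" if \<eta>: "0 < \<eta>" "\<eta> < T" for \<eta>
  proof -
    have "U - real n * ((2 * \<Lambda> * ((T - \<eta>) / real n))\<^sup>2 / (c * \<eta>)) \<le> V (T - \<eta>) x0" if n: "0 < n" for n :: nat
    proof -
      define \<tau> where "\<tau> = (T - \<eta>) / real n"
      have \<tau>: "0 < \<tau>" "real n * \<tau> = T - \<eta>" using n \<eta> by (simp_all add: \<tau>_def)
      have "\<forall>y. \<bar>y - x0\<bar> \<le> \<Lambda> * (T - real j * \<tau>) \<longrightarrow>
          U - (T - real j * \<tau>) * L ((x0 - y) / (T - real j * \<tau>)) - real j * ((2 * \<Lambda> * \<tau>)\<^sup>2 / (c * \<eta>)) \<le> V (real j * \<tau>) y"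
        if "j \<le> n" for j
        using that
      proof (induction j)
        case 0
        then show ?case using U by (auto simp: algebra_simps)
      next
        case (Suc j)
        have le: "real (Suc j) * \<tau> \<le> real n * \<tau>" using Suc.prems \<tau> by (intro mult_right_mono) auto
        have eqS: "real (Suc j) * ((2 * \<Lambda> * \<tau>)\<^sup>2 / (c * \<eta>)) = real j * ((2 * \<Lambda> * \<tau>)\<^sup>2 / (c * \<eta>)) + (2 * \<Lambda> * \<tau>)\<^sup>2 / (c * \<eta>)"
          by (simp only: of_nat_Suc distrib_right mult_1)
        have diff: "real (Suc j) * \<tau> - real j * \<tau> = \<tau>" by (simp add: algebra_simps)
        show ?case
        proof (intro allI impI)
          fix y assume y: "\<bar>y - x0\<bar> \<le> \<Lambda> * (T - real (Suc j) * \<tau>)"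
          have "U - (T - real (Suc j) * \<tau>) * L ((x0 - y) / (T - real (Suc j) * \<tau>))
            - (real j * ((2 * \<Lambda> * \<tau>)\<^sup>2 / (c * \<eta>)) + (2 * \<Lambda> * (real (Suc j) * \<tau> - real j * \<tau>))\<^sup>2 / (c * \<eta>)) \<le> V (real (Suc j) * \<tau>) y"
          proof (rule hopf_lax_step[OF \<Lambda> _ _ _ \<eta>(1) _ y])
            show "U - (T - real j * \<tau>) * L ((x0 - y) / (T - real j * \<tau>)) - real j * ((2 * \<Lambda> * \<tau>)\<^sup>2 / (c * \<eta>)) \<le> V (real j * \<tau>) y"
              if "\<bar>y - x0\<bar> \<le> \<Lambda> * (T - real j * \<tau>)" for y
              using Suc.IH Suc.prems that by auto
          qed (use \<tau> le in auto)
          then show "U - (T - real (Suc j) * \<tau>) * L ((x0 - y) / (T - real (Suc j) * \<tau>))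
            - real (Suc j) * ((2 * \<Lambda> * \<tau>)\<^sup>2 / (c * \<eta>)) \<le> V (real (Suc j) * \<tau>) y"
            unfolding diff eqS .
        qed
      qed
      \<comment> \<open>After the last step the remaining time is \<eta>; at \<open>y = x0\<close>
        the slope is 0 and \<open>L 0 = 0\<close>, so the bound is \<open>U\<close> up to the
        error.\<close>
      from spec[OF this[OF order_refl], of x0] have "U - \<eta> * L 0 - real n * ((2 * \<Lambda> * \<tau>)\<^sup>2 / (c * \<eta>)) \<le> V (T - \<eta>) x0"
        unfolding \<tau>(2) using \<eta> \<Lambda>(1) by simp
      then show ?thesis by (simp add: \<tau>_def)
    qed
    moreover have "(\<lambda>n. U - real n * ((2 * \<Lambda> * ((T - \<eta>) / real n))\<^sup>2 / (c * \<eta>))) \<longlonglongrightarrow> U - 0"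
    proof (intro tendsto_intros)
      have "(\<lambda>n. ((2 * \<Lambda> * (T - \<eta>))\<^sup>2 / (c * \<eta>)) / real n) \<longlonglongrightarrow> 0" by (rule lim_const_over_n)
      moreover have "\<forall>\<^sub>F n in sequentially. ((2 * \<Lambda> * (T - \<eta>))\<^sup>2 / (c * \<eta>)) / real n = real n * ((2 * \<Lambda> * ((T - \<eta>) / real n))\<^sup>2 / (c * \<eta>))"
        using eventually_gt_at_top[of 0]
      proof eventually_elim
        case (elim n)
        have "(2 * \<Lambda> * ((T - \<eta>) / real n))\<^sup>2 = (2 * \<Lambda> * (T - \<eta>))\<^sup>2 / (real n * real n)"
          by (simp add: power2_eq_square)
        then show ?case using elim by simp
      qed
      ultimately show "(\<lambda>n. real n * ((2 * \<Lambda> * ((T - \<eta>) / real n))\<^sup>2 / (c * \<eta>))) \<longlonglongrightarrow> 0"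
        by (rule Lim_transform_eventually)
    qed
    ultimately show ?thesis
      by (intro LIMSEQ_le_const2[of _ "U"]) (auto intro!: exI[of _ 1])
  qed
  show ?thesis
  proof (rule le_of_le_add_mult)
    fix d :: real assume d: "0 < d"
    define h where "h = min d (T / 2)"
    have h: "0 < h" "h \<le> d" "h < T" using d T_pos by (auto simp: h_def min_def)
    have "\<bar>V (T - h) x0 - V T x0\<bar> \<le> B * \<bar>(T - h) - T\<bar>"
      using h by (intro V_lipschitz_t[OF B(2)]) auto
    moreover have "B * \<bar>(T - h) - T\<bar> \<le> B * d" using h B by (intro mult_left_mono) auto
    ultimately show "U \<le> V T x0 + B * d" using 1[OF h(1,3)] by linarith
  qed
qed

lemma hopf_lax_upper: "V T x \<le> V 0 y + T * L ((x - y) / T)"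
  using V_upper[of 0 T y "(x - y) / T"] T_pos by simp

text \<open>\<open>hopf_lax_lower\<close> asks for comparison only with \<open>y\<close> in the base
  of the cone, so the minimum over this compact interval is attained and equals
  \<open>V T x\<close>.\<close>

lemma hopf_lax_attained: "\<exists>y. V T x = V 0 y + T * L ((x - y) / T)"
proof -
  obtain \<Lambda> where \<Lambda>: "0 < \<Lambda>" "\<And>v. \<bar>v\<bar> \<le> M \<Longrightarrow> \<bar>deriv f v\<bar> \<le> \<Lambda>" using f'_bdd by blast
  have "continuous_on S (V 0)" for S
    by (rule lipschitz_on_continuous_on[of M], rule lipschitz_onI)
      (use V_lipschitz_x M_nonneg in \<open>auto simp: dist_real_def\<close>)
  moreover have "continuous_on S (\<lambda>y. L ((x - y) / T))" for S
  proof (rule continuous_on_compose2[OF DERIV_continuous_on[OF has_field_derivative_at_within[OF L_DERIV]] _ subset_UNIV])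
    show "continuous_on S (\<lambda>y. (x - y) / T)" using T_pos by (intro continuous_intros) simp
  qed
  ultimately have "continuous_on {x - \<Lambda> * T..x + \<Lambda> * T} (\<lambda>y. V 0 y + T * L ((x - y) / T))"
    by (intro continuous_intros)
  moreover have "{x - \<Lambda> * T..x + \<Lambda> * T} \<noteq> {}" using \<Lambda> T_pos by simp
  ultimately obtain y where y: "\<And>z. z \<in> {x - \<Lambda> * T..x + \<Lambda> * T} \<Longrightarrow> V 0 y + T * L ((x - y) / T) \<le> V 0 z + T * L ((x - z) / T)"
    using continuous_attains_inf[OF compact_Icc, of "x - \<Lambda> * T" "x + \<Lambda> * T" "\<lambda>y. V 0 y + T * L ((x - y) / T)"] by blast
  have "V 0 y + T * L ((x - y) / T) \<le> V T x"
    by (rule hopf_lax_lower[OF \<Lambda>]) (use y in \<open>auto simp: abs_le_iff\<close>)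
  with hopf_lax_upper[of x y] show ?thesis by (intro exI[of _ y]) simp
qed

text \<open>\<open>Y\<close> picks a minimiser of the Hopf-Lax formula for each \<open>x\<close>; if
  it decreased somewhere, uncrossing would beat two minimal values. Where \<open>Y\<close> is
  continuous, \<open>b ((x - Y x) / T)\<close> is the derivative of \<open>V T\<close>, hence the
  state up to a null set, and then \<open>x - T * deriv f (v x)\<close> is
  \<open>Y x\<close>.\<close>

lemma oleinik:
  "\<exists>v. (AE x in lborel. u T x = v x) \<and> (\<forall>x. \<forall>y>0. deriv f (v (x + y)) - deriv f (v x) \<le> y / T)"
proof -
  obtain Y where Y: "\<And>x. V T x = V 0 (Y x) + T * L ((x - Y x) / T)"
    using hopf_lax_attained by metis
  have mono: "mono Y"
  proof (rule monoI, rule ccontr)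
    fix x x' assume "x \<le> x'" and n: "\<not> Y x \<le> Y x'"
    then have "x < x'" by (cases "x = x'") auto
    have "T * (L ((x - Y x') / T) + L ((x' - Y x) / T)) < T * (L ((x - Y x) / T) + L ((x' - Y x') / T))"
      using n T_pos by (intro mult_strict_left_mono L_crossing \<open>x < x'\<close>) auto
    then show False
      using hopf_lax_upper[of x "Y x'"] hopf_lax_upper[of x' "Y x"] Y[of x] Y[of x'] by (simp add: distrib_left)
  qed
  define v where "v x = b ((x - Y x) / T)" for x
  have [measurable]: "Y \<in> borel_measurable borel" using mono by (rule borel_measurable_mono)
  have vm: "v \<in> borel_measurable borel" unfolding v_def by measurable
  have der: "(V T has_real_derivative v x) (at x)" if "isCont Y x" for x
  proof -
    \<comment> \<open>The minimiser of one point is a competitor for the other. This squeezes the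
      difference quotient between two slopes that both tend to \<open>v x\<close>.\<close>
    have bnd: "\<bar>(V T x' - V T x) / (x' - x) - v x\<bar> \<le> \<bar>b ((x - Y x') / T) - v x\<bar> + \<bar>b ((x' - Y x) / T) - v x\<bar>"
      if "x' \<noteq> x" for x'
    proof -
      have 1: "V T x' - V T x \<le> b ((x' - Y x) / T) * (x' - x)"
      proof -
        have "V T x' - V T x \<le> T * (L ((x' - Y x) / T) - L ((x - Y x) / T))"
          using hopf_lax_upper[of x' "Y x"] Y[of x] by (simp add: algebra_simps)
        also have "\<dots> \<le> T * (b ((x' - Y x) / T) * ((x' - Y x) / T - (x - Y x) / T))"
          using L_above_tangent[of "(x' - Y x) / T" "(x - Y x) / T"] T_pos
          by (intro mult_left_mono) (auto simp: algebra_simps)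
        also have "\<dots> = b ((x' - Y x) / T) * (x' - x)"
          using T_pos by (simp flip: diff_divide_distrib)
        finally show ?thesis .
      qed
      have 2: "b ((x - Y x') / T) * (x' - x) \<le> V T x' - V T x"
      proof -
        have "b ((x - Y x') / T) * (x' - x) = T * (b ((x - Y x') / T) * ((x' - Y x') / T - (x - Y x') / T))"
          using T_pos by (simp flip: diff_divide_distrib)
        also have "\<dots> \<le> T * (L ((x' - Y x') / T) - L ((x - Y x') / T))"
          using L_above_tangent[of "(x - Y x') / T" "(x' - Y x') / T"] T_pos
          by (intro mult_left_mono) (auto simp: algebra_simps)
        also have "\<dots> \<le> V T x' - V T x"
          using hopf_lax_upper[of x "Y x'"] Y[of x'] by (simp add: algebra_simps)
        finally show ?thesis .
      qed
      let ?q = "(V T x' - V T x) / (x' - x)"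
      have "b ((x - Y x') / T) \<le> ?q \<and> ?q \<le> b ((x' - Y x) / T) \<or> b ((x' - Y x) / T) \<le> ?q \<and> ?q \<le> b ((x - Y x') / T)"
        using 1 2 that by (cases "x < x'") (auto simp: pos_le_divide_eq pos_divide_le_eq neg_le_divide_eq neg_divide_le_eq)
      then show ?thesis by linarith
    qed
    have bc: "isCont b z" for z using continuous_b[OF continuous_on_id, of UNIV] by (simp add: continuous_on_eq_continuous_at)
    have Yx: "(Y \<longlongrightarrow> Y x) (at x)" using that by (simp add: isCont_def)
    have l1: "((\<lambda>x'. b ((x - Y x') / T)) \<longlongrightarrow> b ((x - Y x) / T)) (at x)"
      using T_pos by (intro isCont_tendsto_compose[OF bc] tendsto_intros Yx) auto
    have l2: "((\<lambda>x'. b ((x' - Y x) / T)) \<longlongrightarrow> b ((x - Y x) / T)) (at x)"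
      using T_pos by (intro isCont_tendsto_compose[OF bc] tendsto_intros) auto
    have "((\<lambda>x'. \<bar>b ((x - Y x') / T) - v x\<bar> + \<bar>b ((x' - Y x) / T) - v x\<bar>) \<longlongrightarrow> \<bar>b ((x - Y x) / T) - v x\<bar> + \<bar>b ((x - Y x) / T) - v x\<bar>) (at x)"
      by (intro tendsto_intros l1 l2)
    then have l0: "((\<lambda>x'. \<bar>b ((x - Y x') / T) - v x\<bar> + \<bar>b ((x' - Y x) / T) - v x\<bar>) \<longlongrightarrow> 0) (at x)"
      by (simp add: v_def)
    have "((\<lambda>x'. (V T x' - V T x) / (x' - x) - v x) \<longlongrightarrow> 0) (at x)"
      by (rule Lim_null_comparison[OF _ l0]) (auto simp: eventually_at_filter intro!: always_eventually bnd)
    then show ?thesis unfolding has_field_derivative_iff by (simp add: LIM_zero_iff)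
  qed
  have "AE x in lborel. u T x = v x"
  proof (rule AE_eq_derivative_of_primitive[OF u_meas vm u_bdd V_diff])
    have "countable {x. \<not> isCont Y x}" using mono by (rule mono_ctble_discont)
    then have "AE x in lborel. x \<notin> {x. \<not> isCont Y x}"
      by (intro AE_not_in countable_imp_null_set_lborel)
    then show "AE x in lborel. (V T has_real_derivative v x) (at x)"
      by eventually_elim (use der in auto)
  qed
  moreover have "deriv f (v (x + y)) - deriv f (v x) \<le> y / T" if "0 < y" for x y
  proof -
    have "Y x \<le> Y (x + y)" using that monoD[OF mono] by simp
    then show ?thesis using T_pos by (simp add: v_def divide_right_mono flip: diff_divide_distrib)
  qed
  ultimately show ?thesis by blast
qed

end

text \<open>The Hopf-Lax formula depends neither on the bounds \<open>M1\<close> and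
  \<open>M2\<close> nor on what happens between the times 0 and \<open>T\<close>. \<open>V 0\<close>
  is a weighted integral of the datum, as \<open>base 0\<close> is 0, and the increments of
  \<open>V T\<close> determine \<open>u T\<close>.\<close>

lemma entropy_slices_unique:
  assumes "entropy_slices f c u1 M1 T" "entropy_slices f c u2 M2 T"
    and eq: "AE x in lborel. u1 0 x = u2 0 x"
  shows "AE x in lborel. u1 T x = u2 T x"
proof -
  interpret s1: entropy_slices f c u1 M1 T by fact
  interpret s2: entropy_slices f c u2 M2 T by fact
  have V0: "s1.V 0 x = s2.V 0 x" for x
  proof -
    have "(\<integral>y. u1 0 y * (indicator {..<x} y - step (- y)) \<partial>lborel) = (\<integral>y. u2 0 y * (indicator {..<x} y - step (- y)) \<partial>lborel)"
      by (intro integral_cong_AE) (use eq in \<open>auto elim!: eventually_mono\<close>)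
    then show ?thesis unfolding s1.V_def s2.V_def s1.base_def s2.base_def by simp
  qed
  have VT: "s1.V T x = s2.V T x" for x
  proof -
    obtain y1 y2 where "s1.V T x = s1.V 0 y1 + T * s1.L ((x - y1) / T)" "s2.V T x = s2.V 0 y2 + T * s1.L ((x - y2) / T)"
      using s1.hopf_lax_attained s2.hopf_lax_attained by metis
    then show ?thesis
      using s1.hopf_lax_upper[of x y2] s2.hopf_lax_upper[of x y1] V0[of y1] V0[of y2] by linarith
  qed
  show ?thesis
  proof (rule AE_eq_of_interval_integrals[where M = "max M1 M2"])
    show "\<bar>u1 T x\<bar> \<le> max M1 M2" "\<bar>u2 T x\<bar> \<le> max M1 M2" for x
      using s1.u_bdd[of T x] s2.u_bdd[of T x] by auto
    show "(\<integral>x. indicator {a..z} x * u1 T x \<partial>lborel) = (\<integral>x. indicator {a..z} x * u2 T x \<partial>lborel)" if "a \<le> z" for a z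
      using s1.V_diff[OF that, of T] s2.V_diff[OF that, of T] VT by simp
  qed auto
qed

section \<open>From weak entropy solutions to bounded slices\<close>

lemma AE_lborel_ex_in_interval:
  assumes "AE t in lborel. P t" "a < (z :: real)"
  shows "\<exists>t\<in>{a<..<z}. P t"
proof (rule ccontr)
  assume "\<not> ?thesis"
  then have "AE t in lborel. t \<notin> {a<..<z}" using assms(1) by (auto elim!: eventually_mono)
  then have "emeasure lborel {a<..<z} = 0"
    by (subst (asm) AE_iff_measurable[of "{a<..<z}"]) auto
  then show False using assms(2) by simp
qed

lemma has_C1_grad_in_C1c:
  assumes "has_C1_grad \<phi> p q" "compact K" "K \<subseteq> \<Omega>" "\<And>z. z \<notin> K \<Longrightarrow> \<phi> z = 0"
  shows "\<phi> \<in> C1c \<Omega>"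
  using assms C1c_iff_grad by blast

lemma AE_lborel_completion: "(AE x in lebesgue. P x) \<longleftrightarrow> (AE x in lborel. P x)"
  by (rule AE_completion_iff)

context convex_flux
begin

text \<open>The L^\<infinity> bound is known only almost everywhere in the plane, whereas single
  times matter, 0 and \<open>T\<close> among them. Almost every slice is bounded, such times
  accumulate at every \<open>t\<close>, and the bound survives the limit in L^1_loc. Fubini moves
  the entropy inequality to the new representatives.\<close>

lemma solution_slices:
  assumes sol: "weak_entropy_solution f T u" and T: "0 < T"
  shows "\<exists>v M. entropy_slices f c v M T \<and> (\<forall>t\<in>{0..T}. AE x in lborel. v t x = u t x)"
proof -
  define S where "S = {0..T} \<times> (UNIV :: real set)"
  have Sc: "closed S" unfolding S_def by (intro closed_Times) auto
  then have Sm: "S \<in> sets lebesgue" "S \<in> sets lborel" by auto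
  have L1: "(\<lambda>(t, x). u t x) \<in> borel_measurable (lebesgue_on S)"
    and L2: "\<exists>C. AE z in lebesgue_on S. \<bar>case z of (t, x) \<Rightarrow> u t x\<bar> \<le> C"
    and C0: "u \<in> C0_L1loc T"
    and ent: "\<And>k \<phi>. \<phi> \<in> C1c ({0<..<T} \<times> UNIV) \<Longrightarrow> (\<And>z. 0 \<le> \<phi> z) \<Longrightarrow>
        0 \<le> (LINT (t, x)|lebesgue_on S. \<bar>u t x - k\<bar> * deriv (\<lambda>s. \<phi> (s, x)) t
              + sgn (u t x - k) * (f (u t x) - f k) * deriv (\<lambda>y. \<phi> (t, y)) x)"
    using sol unfolding weak_entropy_solution_def Linf_def S_def by auto
  have um: "u t \<in> borel_measurable lebesgue" if "t \<in> {0..T}" for t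
    using C0 that unfolding C0_L1loc_def by blast
  have ui: "set_integrable lebesgue K (u t)" if "t \<in> {0..T}" "compact K" for t K
    using C0 that unfolding C0_L1loc_def by blast
  have uc: "((\<lambda>t. LINT x:K|lebesgue. \<bar>u t x - u s x\<bar>) \<longlongrightarrow> 0) (at s within {0..T})"
    if "s \<in> {0..T}" "compact K" for s K
    using C0 that unfolding C0_L1loc_def by blast
  obtain C where C: "AE z in lebesgue_on S. \<bar>case z of (t, x) \<Rightarrow> u t x\<bar> \<le> C" using L2 by blast
  define M where "M = max 0 C"
  define F where "F z = (if z \<in> S then u (fst z) (snd z) else 0)" for z
  have Fm: "F \<in> borel_measurable lebesgue"
    using borel_measurable_if_I[OF L1 Sm(1)] unfolding F_def split_beta' .
  have "AE z in lebesgue. z \<in> S \<longrightarrow> \<bar>u (fst z) (snd z)\<bar> \<le> C"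
    using C Sm(1) by (subst (asm) AE_restrict_space_iff) (auto simp: split_beta')
  then have Fb: "AE z in lborel. \<bar>F z\<bar> \<le> M"
    unfolding AE_lborel_completion by eventually_elim (auto simp: F_def M_def)
  obtain G0 where G0 [measurable]: "G0 \<in> borel_measurable lborel" and FG0: "AE z in lborel. F z = G0 z"
    using completion_ex_borel_measurable_real[OF Fm] by blast
  \<comment> \<open>Truncation changes nothing almost everywhere and gives a bound at every
    point.\<close>
  define G where "G z = max (- M) (min M (G0 z))" for z
  have M0: "0 \<le> M" by (simp add: M_def)
  have Gm [measurable]: "G \<in> borel_measurable borel" using G0 unfolding G_def by simp
  have Gb: "\<bar>G z\<bar> \<le> M" for z using M0 by (auto simp: G_def)
  have FG: "AE z in lborel. F z = G z"
    using FG0 Fb by eventually_elim (auto simp: G_def)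
  have slice: "AE t in lborel. AE x in lborel. F (t, x) = G (t, x)"
    using FG unfolding lborel_prod[symmetric] by (rule lborel_pair.AE_pair)
  have ub: "AE x in lborel. \<bar>u t x\<bar> \<le> M" if t: "t \<in> {0..T}" for t
  proof -
    \<comment> \<open>Times with a good slice, distinct from \<open>t\<close> and inside
      \<open>{0..T}\<close>, also when \<open>t\<close> is an end point.\<close>
    have "\<exists>r\<in>{max 0 (t - 1 / real (Suc n))<..<min T (t + 1 / real (Suc n))}. r \<noteq> t \<and> (AE x in lborel. F (r, x) = G (r, x))" for n
    proof (rule AE_lborel_ex_in_interval)
      show "AE r in lborel. r \<noteq> t \<and> (AE x in lborel. F (r, x) = G (r, x))"
        using slice AE_lborel_singleton[of t] by eventually_elim auto
      show "max 0 (t - 1 / real (Suc n)) < min T (t + 1 / real (Suc n))"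
      proof -
        have "0 < 1 / real (Suc n)" by simp
        then show ?thesis using t T unfolding atLeastAtMost_iff max_less_iff_conj min_less_iff_conj by linarith
      qed
    qed
    then obtain r where r: "\<And>n. r n \<in> {max 0 (t - 1 / real (Suc n))<..<min T (t + 1 / real (Suc n))}"
      "\<And>n. r n \<noteq> t" "\<And>n. AE x in lborel. F (r n, x) = G (r n, x)" by metis
    have rT: "r n \<in> {0..T}" for n using r(1)[of n] by auto
    have "r \<longlonglongrightarrow> t"
    proof (rule tendsto_sandwich)
      show "(\<lambda>n. t - 1 / real (Suc n)) \<longlonglongrightarrow> t" "(\<lambda>n. t + 1 / real (Suc n)) \<longlonglongrightarrow> t"
        by (rule tendsto_eq_intros LIMSEQ_Suc[OF lim_1_over_n] | simp)+
    qed (use r(1) in \<open>auto intro!: always_eventually less_imp_le\<close>)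
    have urb: "AE x in lborel. \<bar>u (r n) x\<bar> \<le> M" for n
      using r(3)[of n]
    proof eventually_elim
      case (elim x)
      then have "u (r n) x = G (r n, x)" using rT[of n] by (simp add: F_def S_def)
      then show ?case using Gb by simp
    qed
    have "AE x in lborel. x \<in> {-real m..real m} \<longrightarrow> \<bar>u t x\<bar> \<le> M" for m :: nat
    proof -
      let ?I = "indicator {-real m..real m} :: real \<Rightarrow> real"
      have i0: "integrable lebesgue (\<lambda>x. ?I x * u s x)" if "s \<in> {0..T}" for s
        using ui[OF that compact_Icc, of "- real m" "real m"] by (simp add: set_integrable_def)
      have int: "integrable lebesgue (\<lambda>x. ?I x * \<bar>u s x - u t x\<bar>)" if "s \<in> {0..T}" for s
      proof -
        have "integrable lebesgue (\<lambda>x. \<bar>?I x * u s x - ?I x * u t x\<bar>)"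
          by (intro Bochner_Integration.integrable_abs Bochner_Integration.integrable_diff i0 that t)
        moreover have "\<bar>?I x * u s x - ?I x * u t x\<bar> = ?I x * \<bar>u s x - u t x\<bar>" for x
          by (simp add: indicator_def)
        ultimately show ?thesis by simp
      qed
      have [measurable]: "u t \<in> borel_measurable lebesgue" by (rule um[OF t])
      \<comment> \<open>The excess of \<open>\<bar>u t\<bar>\<close> over \<open>M\<close>. It is at
        most \<open>\<bar>u (r n) x - u t x\<bar>\<close> almost everywhere, because the slice at
        time \<open>r n\<close> has no excess; so its integral is 0.\<close>
      define g where "g x = ?I x * max 0 (\<bar>u t x\<bar> - M)" for x
      have gi: "integrable lebesgue g"
      proof (rule Bochner_Integration.integrable_bound[OF i0[OF t]])
        have "?I \<in> borel_measurable lebesgue" by (rule measurable_completion) simp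
        then show "g \<in> borel_measurable lebesgue"
          unfolding g_def by (intro borel_measurable_times borel_measurable_max borel_measurable_diff
            borel_measurable_abs borel_measurable_const um[OF t])
        show "AE x in lebesgue. norm (g x) \<le> norm (?I x * u t x)"
          using M0 by (intro AE_I2) (auto simp: g_def indicator_def)
      qed
      have le: "(\<integral>x. g x \<partial>lebesgue) \<le> (LINT x:{-real m..real m}|lebesgue. \<bar>u (r n) x - u t x\<bar>)" for n
        unfolding set_lebesgue_integral_def real_scaleR_def
      proof (rule integral_mono_AE[OF gi int[OF rT]])
        show "AE x in lebesgue. g x \<le> ?I x * \<bar>u (r n) x - u t x\<bar>"
          unfolding AE_lborel_completion using urb[of n] by eventually_elim (auto simp: g_def indicator_def)
      qed
      have "(\<lambda>n. LINT x:{-real m..real m}|lebesgue. \<bar>u (r n) x - u t x\<bar>) \<longlonglongrightarrow> 0"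
        using uc[OF t compact_Icc, of "- real m" "real m"] \<open>r \<longlonglongrightarrow> t\<close> rT r(2)
        unfolding tendsto_at_iff_sequentially comp_def by blast
      then have "(\<integral>x. g x \<partial>lebesgue) \<le> 0" using le by (intro LIMSEQ_le_const) auto
      moreover have g0: "0 \<le> g x" for x by (simp add: g_def)
      then have "0 \<le> (\<integral>x. g x \<partial>lebesgue)" by simp
      ultimately have "(\<integral>x. g x \<partial>lebesgue) = 0" by linarith
      then have "AE x in lebesgue. g x = 0"
        using g0 by (subst (asm) integral_nonneg_eq_0_iff_AE[OF gi]) auto
      then show ?thesis unfolding AE_lborel_completion by eventually_elim (auto simp: g_def)
    qed
    then have "AE x in lborel. \<forall>m::nat. x \<in> {-real m..real m} \<longrightarrow> \<bar>u t x\<bar> \<le> M"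
      unfolding AE_all_countable by blast
    then show ?thesis
    proof eventually_elim
      case (elim x)
      obtain m :: nat where "\<bar>x\<bar> \<le> real m" using real_arch_simple by blast
      then have "x \<in> {-real m..real m}" by auto
      then show ?case using elim by blast
    qed
  qed
  \<comment> \<open>Clamping the time extends the slices to all real times and preserves
    continuity.\<close>
  define ct where "ct t = max 0 (min T t)" for t
  have ct: "ct t \<in> {0..T}" for t using T by (auto simp: ct_def)
  have ct_id: "ct t = t" if "t \<in> {0..T}" for t using that by (auto simp: ct_def)
  have "\<exists>g. g \<in> borel_measurable lborel \<and> (AE x in lborel. u (ct t) x = g x)" for t
    using completion_ex_borel_measurable_real[OF um[OF ct]] by blast
  then obtain g where g: "\<And>t. g t \<in> borel_measurable lborel" "\<And>t. AE x in lborel. u (ct t) x = g t x" by metis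
  define v where "v t x = max (- M) (min M (g t x))" for t x
  have vm [measurable]: "v t \<in> borel_measurable borel" for t using g(1)[of t] unfolding v_def by simp
  have vb: "\<bar>v t x\<bar> \<le> M" for t x using M0 by (auto simp: v_def)
  have vu: "AE x in lborel. v t x = u (ct t) x" for t
    using g(2)[of t] ub[OF ct, of t] by eventually_elim (auto simp: v_def)
  have sl: "slices v M"
  proof
    fix s :: "nat \<Rightarrow> real" and t R assume s: "s \<longlonglongrightarrow> t"
    let ?h = "\<lambda>r. LINT x:{-R..R}|lebesgue. \<bar>u r x - u (ct t) x\<bar>"
    have eq: "(\<integral>x. indicator {-R..R} x * \<bar>v (s n) x - v t x\<bar> \<partial>lborel) = ?h (ct (s n))" for n
    proof -
      have "(\<integral>x. indicator {-R..R} x * \<bar>v (s n) x - v t x\<bar> \<partial>lborel) = (\<integral>x. indicator {-R..R} x * \<bar>v (s n) x - v t x\<bar> \<partial>lebesgue)"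
        by (rule integral_completion[symmetric]) measurable
      also have "\<dots> = ?h (ct (s n))"
        unfolding set_lebesgue_integral_def real_scaleR_def
      proof (rule integral_cong_AE)
        show "(\<lambda>x. indicator {-R..R} x * \<bar>v (s n) x - v t x\<bar>) \<in> borel_measurable lebesgue"
          by (rule measurable_completion) measurable
        have "(indicator {-R..R} :: real \<Rightarrow> real) \<in> borel_measurable lebesgue" by (rule measurable_completion) simp
        then show "(\<lambda>x. indicator {-R..R} x * \<bar>u (ct (s n)) x - u (ct t) x\<bar>) \<in> borel_measurable lebesgue"
          by (intro borel_measurable_times borel_measurable_diff borel_measurable_abs um[OF ct])
        show "AE x in lebesgue. indicator {-R..R} x * \<bar>v (s n) x - v t x\<bar> = indicator {-R..R} x * \<bar>u (ct (s n)) x - u (ct t) x\<bar>"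
          unfolding AE_lborel_completion using vu[of "s n"] vu[of t] by eventually_elim auto
      qed
      finally show ?thesis .
    qed
    have "continuous (at (ct t) within {0..T}) ?h"
      unfolding continuous_within using uc[OF ct[of t] compact_Icc[of "-R" R]] by simp
    moreover have "\<forall>\<^sub>F n in sequentially. ct (s n) \<in> {0..T}" using ct by simp
    moreover have "(\<lambda>n. ct (s n)) \<longlonglongrightarrow> ct t" unfolding ct_def by (intro tendsto_intros s)
    ultimately have "(\<lambda>n. ?h (ct (s n))) \<longlonglongrightarrow> ?h (ct t)" by (rule continuous_within_tendsto_compose)
    then show "(\<lambda>n. \<integral>x. indicator {-R..R} x * \<bar>v (s n) x - v t x\<bar> \<partial>lborel) \<longlonglongrightarrow> 0"
      unfolding eq by simp
  qed (use vb in auto)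
  interpret slices v M by (rule sl)
  have "entropy_slices f c v M T"
  proof (intro entropy_slices.intro entropy_slices_axioms.intro convex_flux_axioms sl T)
    fix \<phi> p q :: "real \<times> real \<Rightarrow> real" and K k
    assume grad: "has_C1_grad \<phi> p q" and K: "compact K" "K \<subseteq> {0<..<T} \<times> UNIV" "\<And>z. z \<notin> K \<Longrightarrow> \<phi> z = 0"
      and pos: "\<And>z. 0 \<le> \<phi> z"
    have c: "continuous_on UNIV p" "continuous_on UNIV q" using grad unfolding has_C1_grad_def by auto
    have [measurable]: "p \<in> borel_measurable borel" "q \<in> borel_measurable borel"
      using c by (auto intro: borel_measurable_continuous_onI)
    have 0: "p z = 0" "q z = 0" if "z \<notin> K" for z
      using has_C1_grad_eq_0[OF grad compact_imp_closed[OF K(1)] K(3) that] by auto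
    have KS: "K \<subseteq> S" using K(2) by (auto simp: S_def)
    define E where "E w z = \<bar>w - k\<bar> * p z + sgn (w - k) * (f w - f k) * q z" for w z
    have E0: "E w z = 0" if "z \<notin> K" for w z using 0[OF that] by (simp add: E_def)
    have fk: "(\<lambda>w. sgn (w - k) * (f w - f k)) \<in> borel_measurable borel"
      by (rule borel_measurable_continuous_onI[OF continuous_kruzkov_flux])
    have Em: "(\<lambda>z. E (w z) z) \<in> borel_measurable N"
      if "w \<in> borel_measurable N" "p \<in> borel_measurable N" "q \<in> borel_measurable N" for w and N :: "(real \<times> real) measure"
      unfolding E_def
      by (intro borel_measurable_add borel_measurable_times[OF measurable_compose[OF that(1) fk] that(3)]
          borel_measurable_times[OF _ that(2)] borel_measurable_abs borel_measurable_diff borel_measurable_const that(1))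
    have EG: "(\<lambda>z. E (G z) z) \<in> borel_measurable lborel" by (rule Em) simp_all
    have "0 \<le> (LINT (t, x)|lebesgue_on S. E (u t x) (t, x))"
      using ent[OF has_C1_grad_in_C1c[OF grad K] pos, of k]
      unfolding E_def DERIV_imp_deriv[OF has_C1_grad_partials(1)[OF grad]] DERIV_imp_deriv[OF has_C1_grad_partials(2)[OF grad]] .
    also have "\<dots> = (LINT z|lebesgue. (if z \<in> S then E (u (fst z) (snd z)) z else 0))"
      using Lebesgue_Measure.integral_restrict_UNIV[OF Sm(1), of "\<lambda>z. E (u (fst z) (snd z)) z"] by (simp add: split_beta')
    also have "\<dots> = (LINT z|lebesgue. E (F z) z)"
      using KS E0 by (intro Bochner_Integration.integral_cong) (auto simp: F_def)
    also have "\<dots> = (LINT z|lebesgue. E (G z) z)"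
    proof (rule integral_cong_AE)
      have *: "p \<in> borel_measurable lebesgue" "q \<in> borel_measurable lebesgue" "G \<in> borel_measurable lebesgue"
        by (auto intro: measurable_completion)
      show "(\<lambda>z. E (F z) z) \<in> borel_measurable lebesgue" by (rule Em[OF Fm *(1,2)])
      show "(\<lambda>z. E (G z) z) \<in> borel_measurable lebesgue" by (rule Em[OF *(3,1,2)])
      show "AE z in lebesgue. E (F z) z = E (G z) z"
        unfolding AE_lborel_completion using FG by eventually_elim simp
    qed
    also have "\<dots> = (LINT z|lborel. E (G z) z)"
      by (rule integral_completion[OF EG])
    also have "\<dots> = (\<integral>t. \<integral>x. E (G (t, x)) (t, x) \<partial>lborel \<partial>lborel)"
    proof -
      obtain B where B: "integrable lborel (\<lambda>z. B * indicator K z)"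
        "\<And>w z. \<bar>w\<bar> \<le> M \<Longrightarrow> \<bar>\<bar>w - k\<bar> * p z + sgn (w - k) * (f w - f k) * q z\<bar> \<le> B * indicator K z"
        using kruzkov_integrand_bdd[OF c K(1) 0] by blast
      have "integrable lborel (\<lambda>z. E (G z) z)"
      proof (rule Bochner_Integration.integrable_bound[OF B(1) EG AE_I2])
        show "norm (E (G z) z) \<le> norm (B * indicator K z)" for z
          unfolding E_def real_norm_def by (rule order_trans[OF B(2)[OF Gb] abs_ge_self])
      qed
      then show ?thesis
        unfolding lborel_prod[symmetric] by (subst lborel_pair.integral_fst) (auto simp: split_beta')
    qed
    \<comment> \<open>For almost every \<open>t\<close> in \<open>{0..T}\<close> the slice of
      \<open>G\<close> agrees with \<open>v t\<close> almost everywhere; for other times the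
      integrand vanishes with the test function.\<close>
    also have "\<dots> = (\<integral>t. \<integral>x. E (v t x) (t, x) \<partial>lborel \<partial>lborel)"
    proof (rule integral_cong_AE)
      have "(\<lambda>z. E (G z) z) \<in> borel_measurable (lborel \<Otimes>\<^sub>M lborel)" unfolding lborel_prod by (rule EG)
      then show "(\<lambda>t. \<integral>x. E (G (t, x)) (t, x) \<partial>lborel) \<in> borel_measurable lborel"
        by (intro lborel.borel_measurable_lebesgue_integral) (simp add: split_beta')
      obtain \<Lambda>' where \<Lambda>': "0 < \<Lambda>'" "\<And>x. \<bar>x\<bar> \<le> max M \<bar>k\<bar> \<Longrightarrow> \<bar>deriv f x\<bar> \<le> \<Lambda>'" using f'_bdd by blast
      have lip: "\<bar>\<bar>w - k\<bar> - \<bar>w' - k\<bar>\<bar> \<le> 1 * \<bar>w - w'\<bar>" for w w' :: real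
        using abs_triangle_ineq3[of "w - k" "w' - k"] by simp
      have lipS: "\<bar>sgn (w - k) * (f w - f k) - sgn (w' - k) * (f w' - f k)\<bar> \<le> \<Lambda>' * \<bar>w - w'\<bar>"
        if "\<bar>w\<bar> \<le> M" "\<bar>w'\<bar> \<le> M" for w w'
        by (rule kruzkov_flux_lipschitz[where A = "max M \<bar>k\<bar>", OF _ _ _ \<Lambda>'(2)]) (use that in auto)
      have ca: "continuous_on UNIV (\<lambda>w. \<bar>w - k\<bar>)" by (intro continuous_intros)
      note a = slice_continuous_mult[OF c(1) K(1) 0(1) ca lip]
      note s = slice_continuous_mult[OF c(2) K(1) 0(2) continuous_kruzkov_flux lipS]
      have "(\<integral>x. E (v t x) (t, x) \<partial>lborel) = (\<integral>x. \<bar>v t x - k\<bar> * p (t, x) \<partial>lborel) + (\<integral>x. sgn (v t x - k) * (f (v t x) - f k) * q (t, x) \<partial>lborel)" for t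
        unfolding E_def using a(3)[of t] s(3)[of t] by simp
      then show "(\<lambda>t. \<integral>x. E (v t x) (t, x) \<partial>lborel) \<in> borel_measurable lborel"
        using a(1) s(1) by (simp add: borel_measurable_continuous_onI continuous_on_add)
      show "AE t in lborel. (\<integral>x. E (G (t, x)) (t, x) \<partial>lborel) = (\<integral>x. E (v t x) (t, x) \<partial>lborel)"
        using slice
      proof eventually_elim
        case (elim t)
        show ?case
        proof (cases "t \<in> {0..T}")
          case True
          have Eq: "AE x in lborel. G (t, x) = v t x"
            using elim vu[of t] by eventually_elim (use True in \<open>auto simp: F_def S_def ct_id\<close>)
          have [measurable]: "(\<lambda>x. G (t, x)) \<in> borel_measurable borel" "(\<lambda>x. p (t, x)) \<in> borel_measurable borel" "(\<lambda>x. q (t, x)) \<in> borel_measurable borel"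
            by measurable
          show ?thesis
          proof (rule integral_cong_AE)
            show "AE x in lborel. E (G (t, x)) (t, x) = E (v t x) (t, x)" using Eq by eventually_elim simp
          qed (simp_all add: E_def)
        next
          case False
          then have "(t, x) \<notin> K" for x using K(2) by auto
          then show ?thesis by (simp add: E0)
        qed
      qed
    qed
    finally show "0 \<le> (\<integral>t. \<integral>x. \<bar>v t x - k\<bar> * p (t, x) + sgn (v t x - k) * (f (v t x) - f k) * q (t, x) \<partial>lborel \<partial>lborel)"
      unfolding E_def .
  qed
  moreover have "AE x in lborel. v t x = u t x" if "t \<in> {0..T}" for t using vu[of t] ct_id[OF that] by simp
  ultimately show ?thesis by blast
qed

end

section \<open>Solutions with a prescribed monotone backward characteristic map\<close>

text \<open>As \<open>g\<close> takes its value at \<open>z0\<close> nowhere else, it is strictly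
  smaller at \<open>z0 - e\<close> and strictly larger at \<open>z0 + e\<close>. For large
  \<open>n\<close> the same holds for \<open>G n\<close> relative to \<open>y n\<close>, which traps
  \<open>z n\<close>. This serves both for continuity in time of the label of a characteristic and
  for smooth approximations.\<close>

lemma mono_inverse_tendsto:
  fixes g :: "real \<Rightarrow> real" and G :: "nat \<Rightarrow> real \<Rightarrow> real"
  assumes G: "\<And>n. mono (G n)" "\<And>z. (\<lambda>n. G n z) \<longlonglongrightarrow> g z"
    and y: "\<And>n. G n (z n) = y n" "y \<longlonglongrightarrow> g z0"
    and g: "mono g" "\<And>z. g z = g z0 \<Longrightarrow> z = z0"
  shows "z \<longlonglongrightarrow> z0"
proof (rule LIMSEQ_I)
  fix e :: real assume "0 < e"
  have "g (z0 - e) \<le> g z0" "g z0 \<le> g (z0 + e)" using \<open>0 < e\<close> by (auto intro: monoD[OF g(1)])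
  moreover have "g (z0 - e) \<noteq> g z0" "g (z0 + e) \<noteq> g z0" using g(2)[of "z0 - e"] g(2)[of "z0 + e"] \<open>0 < e\<close> by auto
  ultimately have lt: "g (z0 - e) < g z0" "g z0 < g (z0 + e)" by auto
  have "(\<lambda>n. y n - G n (z0 - e)) \<longlonglongrightarrow> g z0 - g (z0 - e)" "(\<lambda>n. G n (z0 + e) - y n) \<longlonglongrightarrow> g (z0 + e) - g z0"
    by (intro tendsto_intros G y)+
  note lims = this
  have "\<forall>\<^sub>F n in sequentially. 0 < y n - G n (z0 - e)" "\<forall>\<^sub>F n in sequentially. 0 < G n (z0 + e) - y n"
    by (rule order_tendstoD(1)[OF lims(1)] order_tendstoD(1)[OF lims(2)]; use lt in simp)+
  then have "\<forall>\<^sub>F n in sequentially. norm (z n - z0) < e"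
  proof eventually_elim
    case (elim n)
    have "z0 - e < z n"
    proof (rule ccontr)
      assume "\<not> z0 - e < z n"
      then have "G n (z n) \<le> G n (z0 - e)" by (intro monoD[OF G(1)]) simp
      then show False using elim(1) y(1)[of n] by simp
    qed
    moreover have "z n < z0 + e"
    proof (rule ccontr)
      assume "\<not> z n < z0 + e"
      then have "G n (z0 + e) \<le> G n (z n)" by (intro monoD[OF G(1)]) simp
      then show False using elim(2) y(1)[of n] by simp
    qed
    ultimately show ?case by auto
  qed
  then show "\<exists>no. \<forall>n\<ge>no. norm (z n - z0) < e" by (simp add: eventually_sequentially)
qed

text \<open>Each such level is the value at a rational point of its flat piece.\<close>

lemma countable_nonunique_levels:
  fixes g :: "real \<Rightarrow> real"
  assumes "mono g"
  shows "countable {y. \<exists>z z'. z < z' \<and> g z = y \<and> g z' = y}"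
proof (rule countable_subset)
  show "{y. \<exists>z z'. z < z' \<and> g z = y \<and> g z' = y} \<subseteq> g ` \<rat>"
  proof safe
    fix z z' assume "z < z'" "g z' = g z"
    then obtain r where r: "r \<in> \<rat>" "z < r" "r < z'" using Rats_dense_in_real by blast
    then have "g z \<le> g r" "g r \<le> g z'" using monoD[OF assms] by simp_all
    then have "g z = g r" using \<open>g z' = g z\<close> by simp
    then show "g z \<in> g ` \<rat>" using r(1) by blast
  qed
  show "countable (g ` \<rat>)" by (intro countable_image countable_rat)
qed

text \<open>The two growth conditions confine the slopes of \<open>xx\<close> to the range from 0 to
  2, which says that the end position \<open>xx z\<close> and the starting position
  \<open>2 * z - xx z\<close> are both nondecreasing. \<open>xx_near\<close> bounds the
  speeds.\<close>

locale char_param = convex_flux f c for f c +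
  fixes T S :: real and xx :: "real \<Rightarrow> real"
  assumes T_pos: "0 < T" and xx_mono: "z \<le> z' \<Longrightarrow> xx z \<le> xx z'"
    and xx_lip: "z \<le> z' \<Longrightarrow> xx z' \<le> xx z + 2 * (z' - z)"
    and xx_near: "\<bar>xx z - z\<bar> \<le> S"
begin

text \<open>The characteristic with parameter \<open>z\<close> runs from \<open>2 * z - xx z\<close> at time \<open>0\<close> to \<open>xx z\<close> at
  time \<open>T\<close>; in this parameter (its position at time \<open>T / 2\<close>) the monotone graph of the
  datum becomes a pair of Lipschitz functions, shocks and rarefactions included.\<close>

definition speed :: "real \<Rightarrow> real" where "speed z = 2 * (xx z - z) / T"
definition X :: "real \<Rightarrow> real \<Rightarrow> real" where "X t z = 2 * z - xx z + t * speed z"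
text \<open>The label of the characteristic through \<open>y\<close> at time \<open>t\<close>. It is
  unique for \<open>0 < t < T\<close>; at the two end times many characteristics may meet in one
  point, and then one of them is chosen arbitrarily.\<close>

definition Z :: "real \<Rightarrow> real \<Rightarrow> real" where "Z t y = (SOME z. X t z = y)"
definition u :: "real \<Rightarrow> real \<Rightarrow> real" where "u t y = b (speed (Z (max 0 (min T t)) y))"
definition Mu :: real where "Mu = max \<bar>b (- (2 * S / T))\<bar> \<bar>b (2 * S / T)\<bar>"

lemma S_nonneg: "0 \<le> S" using xx_near[of 0] by linarith

lemma xx_lipschitz: "\<bar>xx z - xx z'\<bar> \<le> 2 * \<bar>z - z'\<bar>"
  using xx_mono[of z z'] xx_mono[of z' z] xx_lip[of z z'] xx_lip[of z' z] by (cases "z \<le> z'") auto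

lemma continuous_xx [continuous_intros]: assumes "continuous_on A g" shows "continuous_on A (\<lambda>z. xx (g z))"
proof -
  have "2-lipschitz_on UNIV xx"
    using xx_lipschitz by (intro lipschitz_onI) (auto simp: dist_real_def)
  then show ?thesis by (intro continuous_on_compose2[OF lipschitz_on_continuous_on assms]) auto
qed

lemma continuous_speed [continuous_intros]: "continuous_on A g \<Longrightarrow> continuous_on A (\<lambda>z. speed (g z))"
  unfolding speed_def using T_pos by (intro continuous_intros) auto

lemma continuous_X [continuous_intros]:
  "continuous_on A h \<Longrightarrow> continuous_on A g \<Longrightarrow> continuous_on A (\<lambda>z. X (h z) (g z))"
  unfolding X_def by (intro continuous_intros)

lemma X_convex_comb: "X t z = (t / T) * xx z + (1 - t / T) * (2 * z - xx z)"
  using T_pos by (simp add: X_def speed_def field_simps)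

lemma X_mono: assumes "t \<in> {0..T}" "z \<le> z'" shows "X t z \<le> X t z'"
proof -
  have "t / T * xx z \<le> t / T * xx z'" using assms T_pos xx_mono[of z z'] by (intro mult_left_mono) auto
  moreover have "(1 - t / T) * (2 * z - xx z) \<le> (1 - t / T) * (2 * z' - xx z')"
    using assms T_pos xx_lip[of z z'] by (intro mult_left_mono) auto
  ultimately show ?thesis unfolding X_convex_comb by linarith
qed

lemma mono_X: "t \<in> {0..T} \<Longrightarrow> mono (X t)"
  by (intro monoI X_mono)

text \<open>For \<open>0 < t < T\<close> both weights in \<open>X_convex_comb\<close> are positive,
  and the two end positions add up to \<open>2 * z\<close>, so they cannot both stay
  constant.\<close>

lemma X_strict: assumes t: "t \<in> {0<..<T}" "z < z'" shows "X t z < X t z'"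
proof (rule ccontr)
  assume "\<not> X t z < X t z'"
  moreover have p: "0 < t / T" "0 < 1 - t / T" using t by auto
  have 1: "t / T * xx z \<le> t / T * xx z'" using p xx_mono[of z z'] t by (intro mult_left_mono) auto
  have 2: "(1 - t / T) * (2 * z - xx z) \<le> (1 - t / T) * (2 * z' - xx z')"
    using p xx_lip[of z z'] t by (intro mult_left_mono) auto
  ultimately have "t / T * xx z = t / T * xx z'" "(1 - t / T) * (2 * z - xx z) = (1 - t / T) * (2 * z' - xx z')"
    using 1 2 unfolding X_convex_comb by linarith+
  then have "xx z = xx z'" "2 * z - xx z = 2 * z' - xx z'" using p by auto
  then show False using t by simp
qed

lemma X_near: assumes "t \<in> {0..T}" shows "\<bar>X t z - z\<bar> \<le> S"
proof -
  have "X t z - z = (2 * t / T - 1) * (xx z - z)" using T_pos by (simp add: X_def speed_def field_simps)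
  moreover have "\<bar>2 * t / T - 1\<bar> \<le> 1" using assms T_pos by (auto simp: abs_le_iff field_simps)
  ultimately show ?thesis using mult_mono[of "\<bar>2 * t / T - 1\<bar>" 1 "\<bar>xx z - z\<bar>" S] xx_near[of z] by (simp add: abs_mult)
qed

lemma X_Z: assumes t: "t \<in> {0..T}" shows "X t (Z t y) = y"
proof -
  have "continuous_on {y - S..y + S} (X t)" by (intro continuous_intros)
  moreover have "X t (y - S) \<le> y" "y \<le> X t (y + S)" using X_near[OF t, of "y - S"] X_near[OF t, of "y + S"] by linarith+
  ultimately have "\<exists>z. X t z = y" using IVT'[of "X t" "y - S" y "y + S"] S_nonneg by auto
  then show ?thesis unfolding Z_def by (rule someI_ex)
qed

lemma Z_X: "t \<in> {0<..<T} \<Longrightarrow> Z t (X t z) = z"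
  using X_strict[of t z "Z t (X t z)"] X_strict[of t "Z t (X t z)" z] X_Z[of t "X t z"] by (cases z "Z t (X t z)" rule: linorder_cases) auto

lemma mono_Z: assumes "t \<in> {0..T}" shows "mono (Z t)"
proof (rule monoI, rule ccontr)
  fix y y' assume "y \<le> y'" "\<not> Z t y \<le> Z t y'"
  then have "X t (Z t y') \<le> X t (Z t y)" using X_mono[OF assms] by simp
  then have "y' \<le> y" using X_Z[OF assms] by simp
  then show False using \<open>y \<le> y'\<close> \<open>\<not> Z t y \<le> Z t y'\<close> by simp
qed

lemma X_tendsto: "t \<longlonglongrightarrow> t0 \<Longrightarrow> (\<lambda>n. X (t n) z) \<longlonglongrightarrow> X t0 z"
  unfolding X_def by (intro tendsto_intros)

lemma Z_tendsto:
  assumes "\<And>n. t n \<in> {0..T}" "t \<longlonglongrightarrow> t0" "y \<longlonglongrightarrow> y0" "t0 \<in> {0..T}"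
    and un: "\<And>z. X t0 z = y0 \<Longrightarrow> z = Z t0 y0"
  shows "(\<lambda>n. Z (t n) (y n)) \<longlonglongrightarrow> Z t0 y0"
  by (rule mono_inverse_tendsto[where G = "\<lambda>n. X (t n)" and g = "X t0" and y = y])
    (use assms X_Z mono_X X_tendsto in auto)

lemma ct: "max 0 (min T t) \<in> {0..T}" using T_pos by auto

lemma speed_le: "\<bar>speed z\<bar> \<le> 2 * S / T"
  unfolding speed_def using xx_near[of z] T_pos by (simp add: abs_mult abs_divide divide_right_mono)

lemma b_speed_le: "\<bar>b (speed z)\<bar> \<le> Mu"
proof -
  have "- (2 * S / T) \<le> speed z" "speed z \<le> 2 * S / T" using speed_le[of z] by linarith+
  then have "b (- (2 * S / T)) \<le> b (speed z)" "b (speed z) \<le> b (2 * S / T)" by simp_all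
  then show ?thesis unfolding Mu_def by linarith
qed

lemma u_bdd: "\<bar>u t y\<bar> \<le> Mu"
  unfolding u_def by (rule b_speed_le)

lemma measurable_u: "u t \<in> borel_measurable borel"
proof -
  have "Z (max 0 (min T t)) \<in> borel_measurable borel" by (intro borel_measurable_mono mono_Z ct)
  moreover have "(\<lambda>z. b (speed z)) \<in> borel_measurable borel"
    by (intro borel_measurable_continuous_onI continuous_intros)
  ultimately show ?thesis unfolding u_def by (rule measurable_compose)
qed

lemma isCont_b_speed: "isCont (\<lambda>z. b (speed z)) z"
proof -
  have "continuous_on UNIV (\<lambda>z. b (speed z))" by (intro continuous_intros)
  then show ?thesis by (simp add: continuous_on_eq_continuous_at)
qed

lemma u_tendsto:
  assumes "t \<longlonglongrightarrow> t0" "y \<longlonglongrightarrow> y0"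
    and un: "\<And>z. X (max 0 (min T t0)) z = y0 \<Longrightarrow> z = Z (max 0 (min T t0)) y0"
  shows "(\<lambda>n. u (t n) (y n)) \<longlonglongrightarrow> u t0 y0"
proof -
  have "(\<lambda>n. max 0 (min T (t n))) \<longlonglongrightarrow> max 0 (min T t0)" by (intro tendsto_intros assms)
  then have "(\<lambda>n. Z (max 0 (min T (t n))) (y n)) \<longlonglongrightarrow> Z (max 0 (min T t0)) y0"
    by (intro Z_tendsto ct assms)
  then show ?thesis unfolding u_def by (rule isCont_tendsto_compose[OF isCont_b_speed])
qed

lemma continuous_u: "continuous_on ({0<..<T} \<times> UNIV) (\<lambda>z. u (fst z) (snd z))"
  unfolding continuous_on_sequentially comp_def
proof (intro allI ballI impI, elim conjE)
  fix x :: "nat \<Rightarrow> real \<times> real" and a assume a: "a \<in> {0<..<T} \<times> UNIV" and x: "x \<longlonglongrightarrow> a"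
  have "fst a \<in> {0<..<T}" using a by auto
  then have c: "max 0 (min T (fst a)) = fst a" by auto
  show "(\<lambda>n. u (fst (x n)) (snd (x n))) \<longlonglongrightarrow> u (fst a) (snd a)"
  proof (rule u_tendsto[OF tendsto_fst[OF x] tendsto_snd[OF x]])
    fix z assume "X (max 0 (min T (fst a))) z = snd a"
    then show "z = Z (max 0 (min T (fst a))) (snd a)"
      using Z_X[OF \<open>fst a \<in> {0<..<T}\<close>, of z] unfolding c by metis
  qed
qed

text \<open>Of interest at the times 0 and \<open>T\<close>, where \<open>X t\<close> may have flat
  pieces: only countably many \<open>y\<close> are values on them.\<close>

lemma AE_unique_Z:
  assumes "t \<in> {0..T}"
  shows "AE y in lborel. \<forall>z. X t z = y \<longrightarrow> z = Z t y"
proof -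
  have "AE y in lborel. y \<notin> {y. \<exists>z z'. z < z' \<and> X t z = y \<and> X t z' = y}"
    by (intro AE_not_in countable_imp_null_set_lborel countable_nonunique_levels mono_X assms)
  then show ?thesis
  proof eventually_elim
    case (elim y)
    have "z = Z t y" if "X t z = y" for z
      using that elim X_Z[OF assms, of y] by (cases z "Z t y" rule: linorder_cases) blast+
    then show ?case by blast
  qed
qed

section \<open>The Kruzkov integrand of the constructed solution\<close>

definition E :: "real \<Rightarrow> (real \<times> real \<Rightarrow> real) \<Rightarrow> (real \<times> real \<Rightarrow> real) \<Rightarrow> real \<times> real \<Rightarrow> real" where
  "E k p q z = \<bar>u (fst z) (snd z) - k\<bar> * p z + sgn (u (fst z) (snd z) - k) * (f (u (fst z) (snd z)) - f k) * q z"

lemma E_eq_0: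
  assumes "has_C1_grad \<phi> p q" "compact K" "\<And>z. z \<notin> K \<Longrightarrow> \<phi> z = 0" "z \<notin> K"
  shows "E k p q z = 0"
  using has_C1_grad_eq_0[OF assms(1) compact_imp_closed[OF assms(2)] assms(3,4)] by (simp add: E_def)

lemma continuous_E:
  assumes g: "has_C1_grad \<phi> p q" and K: "compact K" "K \<subseteq> {0<..<T} \<times> UNIV" "\<And>z. z \<notin> K \<Longrightarrow> \<phi> z = 0"
  shows "continuous_on UNIV (E k p q)"
proof -
  have "continuous_on ({0<..<T} \<times> UNIV \<union> - K) (E k p q)"
  proof (rule continuous_on_open_Un)
    show "open ({0<..<T} \<times> (UNIV :: real set))" by (intro open_Times) auto
    show "open (- K)" using K(1) by (simp add: compact_imp_closed open_Compl)
    have "continuous_on ({0<..<T} \<times> UNIV) p" "continuous_on ({0<..<T} \<times> UNIV) q"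
      using g unfolding has_C1_grad_def by (auto intro: continuous_on_subset)
    then show "continuous_on ({0<..<T} \<times> UNIV) (E k p q)"
      unfolding E_def
      by (intro continuous_intros continuous_u continuous_on_compose2[OF continuous_kruzkov_flux[of UNIV] continuous_u]) auto
    show "continuous_on (- K) (E k p q)"
      by (rule continuous_on_eq[of _ "\<lambda>_. 0"]) (use E_eq_0[OF g K(1,3)] in auto)
  qed
  moreover have "{0<..<T} \<times> UNIV \<union> - K = UNIV" using K(2) by auto
  ultimately show ?thesis by simp
qed

end

lemma integral_derivative_eq_0:
  fixes g :: "real \<Rightarrow> real"
  assumes g: "\<And>x. (g has_real_derivative g' x) (at x)" "continuous_on UNIV g'"
    and R: "\<And>x. R < \<bar>x\<bar> \<Longrightarrow> g x = 0" "\<And>x. R < \<bar>x\<bar> \<Longrightarrow> g' x = 0"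
  shows "(\<integral>x. g' x \<partial>lborel) = 0"
proof -
  let ?r = "\<bar>R\<bar> + 1"
  have "(\<integral>x. indicator {-?r..?r} x *\<^sub>R g' x \<partial>lborel) = g ?r - g (-?r)"
    using g by (intro integral_FTC_atLeastAtMost)
      (auto simp: has_real_derivative_iff_has_vector_derivative[symmetric] intro: has_field_derivative_at_within continuous_on_subset)
  moreover have "indicator {-?r..?r} x *\<^sub>R g' x = g' x" for x
  proof (cases "x \<in> {-?r..?r}")
    case False
    then have "R < \<bar>x\<bar>" unfolding atLeastAtMost_iff by linarith
    then show ?thesis by (simp add: R(2))
  qed simp
  then have "(\<lambda>x. indicator {-?r..?r} x *\<^sub>R g' x) = g'" by (rule ext)
  moreover have "g ?r = 0" "g (-?r) = 0" by (rule R(1); simp)+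
  ultimately show ?thesis by simp
qed

context convex_flux
begin

text \<open>With \<open>g \<sigma> = L \<sigma> - \<sigma> * k + f k\<close> the expression is minus
  \<open>sgn (b \<sigma> - k) * g \<sigma>\<close>, and \<open>g\<close> has the derivative
  \<open>b \<sigma> - k\<close>. The sign jumps at \<open>deriv f k\<close>, where \<open>g\<close>
  vanishes together with its derivative, so no kink remains.\<close>

lemma kruzkov_potential_DERIV:
  "((\<lambda>\<sigma>. sgn (b \<sigma> - k) * (f (b \<sigma>) - f k) - \<sigma> * \<bar>b \<sigma> - k\<bar>) has_real_derivative - \<bar>b \<sigma> - k\<bar>) (at \<sigma>)"
proof -
  define g where "g \<sigma> = L \<sigma> - \<sigma> * k + f k" for \<sigma>
  have gd: "(g has_real_derivative b \<sigma> - k) (at \<sigma>)" for \<sigma>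
    unfolding g_def by (auto intro!: derivative_eq_intros L_DERIV)
  have eq: "sgn (b \<sigma> - k) * (f (b \<sigma>) - f k) - \<sigma> * \<bar>b \<sigma> - k\<bar> = - (sgn (b \<sigma> - k) * g \<sigma>)" for \<sigma>
  proof -
    have *: "\<bar>b \<sigma> - k\<bar> = sgn (b \<sigma> - k) * (b \<sigma> - k)" by (simp add: abs_sgn mult.commute)
    show ?thesis unfolding * g_def L_def by (simp add: algebra_simps)
  qed
  define a where "a = deriv f k"
  have ba: "b a = k" by (simp add: a_def)
  have g0: "g a = 0" by (simp add: g_def L_def ba)
  have blt: "b x < b y \<longleftrightarrow> x < y" for x y using b_le_iff[of y x] by (simp add: not_le[symmetric])
  show ?thesis unfolding eq
  proof (cases \<sigma> a rule: linorder_cases)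
    case less
    have "((\<lambda>\<sigma>. - (sgn (b \<sigma> - k) * g \<sigma>)) has_real_derivative b \<sigma> - k) (at \<sigma>)"
    proof (rule has_field_derivative_transform_within_open[OF gd, of "{..<a}"])
      show "g r = - (sgn (b r - k) * g r)" if "r \<in> {..<a}" for r
        using blt[of r a] that ba by simp
    qed (use less in auto)
    then show "((\<lambda>\<sigma>. - (sgn (b \<sigma> - k) * g \<sigma>)) has_real_derivative - \<bar>b \<sigma> - k\<bar>) (at \<sigma>)"
      using blt[of \<sigma> a] less ba by simp
  next
    case greater
    have "((\<lambda>\<sigma>. - (sgn (b \<sigma> - k) * g \<sigma>)) has_real_derivative - (b \<sigma> - k)) (at \<sigma>)"
    proof (rule has_field_derivative_transform_within_open[OF DERIV_minus[OF gd], of "{a<..}"])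
      show "- g r = - (sgn (b r - k) * g r)" if "r \<in> {a<..}" for r
        using blt[of a r] that ba by simp
    qed (use greater in auto)
    then show "((\<lambda>\<sigma>. - (sgn (b \<sigma> - k) * g \<sigma>)) has_real_derivative - \<bar>b \<sigma> - k\<bar>) (at \<sigma>)"
      using blt[of a \<sigma>] greater ba by simp
  next
    case equal
    have "((\<lambda>h. (g h - g a) / (h - a)) \<longlongrightarrow> 0) (at a)"
      using gd[of a] unfolding has_field_derivative_iff by (simp add: ba)
    then have lim: "((\<lambda>h. \<bar>(g h - g a) / (h - a)\<bar>) \<longlongrightarrow> 0) (at a)" by (rule tendsto_rabs_zero)
    have "((\<lambda>h. (- (sgn (b h - k) * g h) - - (sgn (b a - k) * g a)) / (h - a)) \<longlongrightarrow> 0) (at a)"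
    proof (rule Lim_null_comparison[OF always_eventually lim], rule allI)
      fix h
      show "norm ((- (sgn (b h - k) * g h) - - (sgn (b a - k) * g a)) / (h - a)) \<le> \<bar>(g h - g a) / (h - a)\<bar>"
        using g0 by (auto simp: abs_mult abs_divide sgn_if)
    qed
    then show "((\<lambda>\<sigma>. - (sgn (b \<sigma> - k) * g \<sigma>)) has_real_derivative - \<bar>b \<sigma> - k\<bar>) (at \<sigma>)"
      unfolding has_field_derivative_iff equal by (simp add: ba)
  qed
qed

end

context char_param
begin

text \<open>The substitution \<open>y = X t z\<close> turns the Kruzkov integrand into the sum of a
  \<open>t\<close>-derivative and a \<open>z\<close>-derivative of compactly supported functions, so
  its integral is 0: a smooth family of characteristics that do not cross conserves Kruzkov's
  entropies.\<close>

lemma smooth_entropy_equality: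
  assumes xx': "\<And>z. (xx has_real_derivative xx' z) (at z)" "continuous_on UNIV xx'" "\<And>z. 0 \<le> xx' z" "\<And>z. xx' z \<le> 2"
    and g: "has_C1_grad \<phi> p q" and K: "compact K" "K \<subseteq> {0<..<T} \<times> UNIV" "\<And>z. z \<notin> K \<Longrightarrow> \<phi> z = 0"
  shows "(\<integral>t. \<integral>y. E k p q (t, y) \<partial>lborel \<partial>lborel) = 0"
proof -
  define \<eta> where "\<eta> z = \<bar>b (speed z) - k\<bar>" for z
  define Q where "Q z = sgn (b (speed z) - k) * (f (b (speed z)) - f k)" for z
  define W where "W z = Q z - speed z * \<eta> z" for z
  define sp where "sp z = 2 * (xx' z - 1) / T" for z
  define Xz where "Xz t z = 2 - xx' z + t * sp z" for t z
  \<comment> \<open>\<open>A\<close> is the \<open>t\<close>-derivative of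
    \<open>\<eta> z * Xz t z * \<phi> (t, X t z)\<close>, and \<open>Bf\<close> is the
    \<open>z\<close>-derivative of \<open>W z * \<phi> (t, X t z)\<close>. Since
    \<open>Q z = W z + speed z * \<eta> z\<close>, they add up to the transformed integrand.\<close>
  define A where "A w = \<eta> (snd w) * (sp (snd w) * \<phi> (fst w, X (fst w) (snd w))
      + Xz (fst w) (snd w) * (p (fst w, X (fst w) (snd w)) + speed (snd w) * q (fst w, X (fst w) (snd w))))" for w
  define Bf where "Bf t z = - \<eta> z * sp z * \<phi> (t, X t z) + W z * (q (t, X t z) * Xz t z)" for t z
  obtain R where R: "0 \<le> R" "K \<subseteq> {-R..R} \<times> {-R..R}" using compact_subset_box[OF K(1)] .
  have c: "continuous_on UNIV p" "continuous_on UNIV q" using g unfolding has_C1_grad_def by auto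
  have c\<phi>: "continuous_on UNIV \<phi>"
    using g unfolding has_C1_grad_def by (auto intro!: has_derivative_continuous simp: continuous_on_eq_continuous_at)
  have z0: "\<phi> w = 0" "p w = 0" "q w = 0" if "w \<notin> K" for w
    using has_C1_grad_eq_0[OF g compact_imp_closed[OF K(1)] K(3) that] K(3) that by auto
  have tz: "(t, y) \<notin> K" if "t \<notin> {0<..<T}" for t y using that K(2) by auto
  have xz: "(t, X t z) \<notin> K" if "R + S < \<bar>z\<bar>" for t z
  proof (cases "t \<in> {0<..<T}")
    case True
    then have "\<bar>X t z - z\<bar> \<le> S" by (intro X_near) auto
    then have "R < \<bar>X t z\<bar>" using that by linarith
    show ?thesis
    proof
      assume "(t, X t z) \<in> K"
      then have "(t, X t z) \<in> {-R..R} \<times> {-R..R}" using R(2) by blast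
      then show False using \<open>R < \<bar>X t z\<bar>\<close> by auto
    qed
  qed (use tz in auto)
  have sd: "(speed has_real_derivative sp z) (at z)" for z
    unfolding speed_def sp_def using T_pos by (auto intro!: derivative_eq_intros xx'(1))
  have Xd: "(X t has_real_derivative Xz t z) (at z)" for t z
    unfolding X_def Xz_def by (auto intro!: derivative_eq_intros xx'(1) sd)
  have Xt: "((\<lambda>t. X t z) has_real_derivative speed z) (at t)" for t z
    unfolding X_def by (auto intro!: derivative_eq_intros)
  have cs: "continuous_on D (\<lambda>w. sp (h w))" "continuous_on D (\<lambda>w. \<eta> (h w))" "continuous_on D (\<lambda>w. W (h w))"
    if "continuous_on D h" for D and h :: "_ \<Rightarrow> real"
  proof -
    have x': "continuous_on D (\<lambda>w. xx' (h w))" by (rule continuous_on_compose2[OF xx'(2) that]) simp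
    show s: "continuous_on D (\<lambda>w. sp (h w))" unfolding sp_def using T_pos by (intro continuous_intros x') auto
    show e: "continuous_on D (\<lambda>w. \<eta> (h w))" unfolding \<eta>_def by (intro continuous_intros that)
    have "continuous_on D (\<lambda>w. b (speed (h w)))" by (intro continuous_intros that)
    then have "continuous_on D (\<lambda>w. Q (h w))"
      unfolding Q_def by (rule continuous_on_compose2[OF continuous_kruzkov_flux[of UNIV k]]) simp
    then show "continuous_on D (\<lambda>w. W (h w))" unfolding W_def by (intro continuous_intros e that)
  qed
  have cXz: "continuous_on D (\<lambda>w. Xz (h' w) (h w))"
    if "continuous_on D h" "continuous_on D h'" for D and h h' :: "_ \<Rightarrow> real"
    unfolding Xz_def by (intro continuous_intros cs that continuous_on_compose2[OF xx'(2) that(1)]) simp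
  have cx: "continuous_on D (\<lambda>w. r (h' w, X (h' w) (h w)))"
    if "continuous_on D h" "continuous_on D h'" "continuous_on UNIV r" for D and h h' :: "_ \<Rightarrow> real" and r :: "real \<times> real \<Rightarrow> real"
    by (rule continuous_on_compose2[OF that(3)]) (auto intro!: continuous_intros that)
  have cA: "continuous_on UNIV A"
    unfolding A_def by (intro continuous_intros cs cXz cx c c\<phi>)
  have A0: "A w = 0" if "w \<notin> {0..T} \<times> {- (R + S)..R + S}" for w
  proof -
    have "(fst w, X (fst w) (snd w)) \<notin> K"
    proof (cases "fst w \<in> {0<..<T}")
      case True
      then have "R + S < \<bar>snd w\<bar>" using that by (cases w) auto
      then show ?thesis by (rule xz)
    qed (use tz in auto)
    then show ?thesis using z0 by (simp add: A_def)
  qed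
  have iA: "integrable (lborel \<Otimes>\<^sub>M lborel) A"
    by (rule integrable_compact_support_pair[OF cA, of "{0..T} \<times> {- (R + S)..R + S}"]) (use A0 in \<open>auto intro: compact_Times\<close>)
  have iAx: "integrable lborel (\<lambda>z. A (t, z))" for t
  proof (rule integrable_continuous_support[where R = "R + S"])
    show "continuous_on UNIV (\<lambda>z. A (t, z))" by (rule continuous_on_compose2[OF cA]) (auto intro!: continuous_intros)
    show "A (t, z) = 0" if "R + S < \<bar>z\<bar>" for z using that by (intro A0) auto
  qed
  have cB: "continuous_on UNIV (Bf t)" for t
    unfolding Bf_def by (intro continuous_intros cs cXz cx c c\<phi>)
  have B0: "Bf t z = 0" if "R + S < \<bar>z\<bar>" for t z using z0[OF xz[OF that]] by (simp add: Bf_def)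
  have iB: "integrable lborel (Bf t)" for t by (rule integrable_continuous_support[OF cB B0])
  have Bint: "(\<integral>z. Bf t z \<partial>lborel) = 0" for t
  proof (rule integral_derivative_eq_0[OF _ cB _ B0])
    fix z
    have "((\<lambda>\<sigma>. sgn (b \<sigma> - k) * (f (b \<sigma>) - f k) - \<sigma> * \<bar>b \<sigma> - k\<bar>) has_real_derivative - \<eta> z) (at (speed z))"
      unfolding \<eta>_def by (rule kruzkov_potential_DERIV)
    from DERIV_chain2[OF this sd] have Wd: "(W has_real_derivative - \<eta> z * sp z) (at z)"
      unfolding W_def Q_def \<eta>_def .
    have pd: "((\<lambda>z. \<phi> (t, X t z)) has_real_derivative q (t, X t z) * Xz t z) (at z)"
      by (rule DERIV_chain2[OF has_C1_grad_partials(2)[OF g] Xd])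
    show "((\<lambda>z. W z * \<phi> (t, X t z)) has_real_derivative Bf t z) (at z)"
      using DERIV_mult[OF Wd pd] by (simp add: Bf_def mult_ac)
    show "W z * \<phi> (t, X t z) = 0" if "R + S < \<bar>z\<bar>" using z0(1)[OF xz[OF that]] by simp
  qed
  have Aint: "(\<integral>t. A (t, z) \<partial>lborel) = 0" for z
  proof (rule integral_derivative_eq_0[where R = T and g = "\<lambda>t. \<eta> z * (Xz t z * \<phi> (t, X t z))"])
    show "continuous_on UNIV (\<lambda>t. A (t, z))" by (rule continuous_on_compose2[OF cA]) (auto intro!: continuous_intros)
    show "A (t, z) = 0" if "T < \<bar>t\<bar>" for t using that by (intro A0) auto
    show "\<eta> z * (Xz t z * \<phi> (t, X t z)) = 0" if "T < \<bar>t\<bar>" for t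
    proof -
      have "t \<notin> {0<..<T}" using that by auto
      then show ?thesis by (simp add: z0(1)[OF tz])
    qed
    fix t
    have "((\<lambda>t. (t, X t z)) has_derivative (\<lambda>h. (h, speed z * h))) (at t)"
      using Xt[of z t] unfolding has_field_derivative_def by (intro has_derivative_Pair has_derivative_ident)
    from has_derivative_compose[OF this] g
    have "((\<lambda>t. \<phi> (t, X t z)) has_derivative (\<lambda>h. p (t, X t z) * fst (h, speed z * h) + q (t, X t z) * snd (h, speed z * h))) (at t)"
      unfolding has_C1_grad_def by blast
    then have pd: "((\<lambda>t. \<phi> (t, X t z)) has_real_derivative p (t, X t z) + speed z * q (t, X t z)) (at t)"
      unfolding has_field_derivative_def by (rule has_derivative_eq_rhs) (auto simp: algebra_simps)
    have xd: "((\<lambda>t. Xz t z) has_real_derivative sp z) (at t)"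
      unfolding Xz_def by (auto intro!: derivative_eq_intros)
    show "((\<lambda>t. \<eta> z * (Xz t z * \<phi> (t, X t z))) has_real_derivative A (t, z)) (at t)"
      using DERIV_cmult[OF DERIV_mult[OF xd pd], of "\<eta> z"] by (simp add: A_def algebra_simps)
  qed
  have subst: "(\<integral>y. E k p q (t, y) \<partial>lborel) = (\<integral>z. A (t, z) + Bf t z \<partial>lborel)" for t
  proof (cases "t \<in> {0<..<T}")
    case False
    have "E k p q (t, y) = 0" for y using z0[OF tz[OF False]] by (simp add: E_def)
    moreover have "A (t, z) = 0" "Bf t z = 0" for z using z0[OF tz[OF False]] by (simp_all add: A_def Bf_def)
    ultimately show ?thesis by simp
  next
    case True
    define a where "a = R + S + 1"
    have cE: "continuous_on D (\<lambda>y. E k p q (t, y))" for D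
      by (rule continuous_on_compose2[OF continuous_E[OF g K]]) (auto intro!: continuous_intros)
    have a0: "0 \<le> a" using R(1) S_nonneg by (simp add: a_def)
    have t01: "t \<in> {0..T}" using True by auto
    have Xa: "X t (-a) \<le> - R" "R \<le> X t a"
      using X_near[OF t01, of "-a"] X_near[OF t01, of a] by (auto simp: a_def)
    have "(LBINT y. E k p q (t, y) * indicator {X t (-a)..X t a} y) = (LBINT z. E k p q (t, X t z) * Xz t z * indicator {-a..a} z)"
    proof (rule integral_substitution(2))
      show "set_integrable lborel {X t (- a)..X t a} (\<lambda>y. E k p q (t, y))"
        by (rule borel_integrable_atLeastAtMost'[OF cE])
      show "(X t has_real_derivative Xz t z) (at z)" for z by (rule Xd)
      show "continuous_on {- a..a} (Xz t)" by (intro cXz continuous_intros)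
      show "0 \<le> Xz t z" for z
      proof -
        have "Xz t z = (t / T) * xx' z + (1 - t / T) * (2 - xx' z)"
          using T_pos by (simp add: Xz_def sp_def field_simps)
        moreover have "0 \<le> (t / T) * xx' z" "0 \<le> (1 - t / T) * (2 - xx' z)"
          using True xx'(3,4)[of z] by (auto intro!: mult_nonneg_nonneg)
        ultimately show ?thesis by linarith
      qed
    qed (use a0 in simp)
    also have "(\<lambda>y. E k p q (t, y) * indicator {X t (-a)..X t a} y) = (\<lambda>y. E k p q (t, y))"
    proof
      fix y
      show "E k p q (t, y) * indicator {X t (-a)..X t a} y = E k p q (t, y)"
      proof (cases "(t, y) \<in> K")
        case True
        then have "y \<in> {X t (-a)..X t a}" using Xa R(2) by auto
        then show ?thesis by simp
      qed (simp add: E_def z0)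
    qed
    also have "(\<lambda>z. E k p q (t, X t z) * Xz t z * indicator {-a..a} z) = (\<lambda>z. A (t, z) + Bf t z)"
    proof
      fix z
      \<comment> \<open>The state is constant along a characteristic; its label is recovered because
        \<open>0 < t < T\<close>.\<close>
      have uX: "u t (X t z) = b (speed z)" using True Z_X[OF True] by (simp add: u_def max_def min_def)
      have "E k p q (t, X t z) * Xz t z = A (t, z) + Bf t z"
        unfolding E_def A_def Bf_def W_def fst_conv snd_conv uX \<eta>_def[symmetric] Q_def[symmetric] by (simp add: algebra_simps)
      moreover have "A (t, z) + Bf t z = 0" if "z \<notin> {-a..a}"
        using z0[OF xz, of z t] that by (auto simp: A_def Bf_def a_def)
      ultimately show "E k p q (t, X t z) * Xz t z * indicator {-a..a} z = A (t, z) + Bf t z"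
        by (cases "z \<in> {-a..a}") auto
    qed
    finally show ?thesis .
  qed
  have "(\<integral>t. \<integral>y. E k p q (t, y) \<partial>lborel \<partial>lborel) = (\<integral>t. \<integral>z. A (t, z) \<partial>lborel \<partial>lborel)"
    unfolding subst using iAx iB Bint by simp
  also have "\<dots> = (\<integral>z. \<integral>t. A (t, z) \<partial>lborel \<partial>lborel)"
    using lborel_pair.Fubini_integral[of "\<lambda>t z. A (t, z)"] iA by simp
  finally show ?thesis unfolding Aint by simp
qed

text \<open>Averaging over \<open>{z..z + h}\<close> makes \<open>xx\<close> continuously
  differentiable and keeps monotonicity and the slope bound 2. Values move by at most
  \<open>2 * h\<close>, hence \<open>S + 2\<close> serves for all \<open>h \<le> 1\<close>.\<close>

lemma average_char_param:
  assumes h: "0 < h" "h \<le> 1"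
  defines "xh \<equiv> \<lambda>z. integral {z..z + h} xx / h" and "xh' \<equiv> \<lambda>z. (xx (z + h) - xx z) / h"
  shows "(xh has_real_derivative xh' z) (at z)" "continuous_on UNIV xh'" "0 \<le> xh' z" "xh' z \<le> 2"
    "\<bar>xh z - xx z\<bar> \<le> 2 * h" "char_param f c T (S + 2) xh"
proof -
  have xc: "continuous_on D xx" for D using continuous_xx[OF continuous_on_id] .
  show d: "(xh has_real_derivative xh' z) (at z)" for z
  proof -
    define F where "F y = integral {z - 1..y} xx" for y
    have Fd: "(F has_real_derivative xx y) (at y)" if "y \<in> {z - 1<..<z + h + 1}" for y
    proof -
      have "(F has_real_derivative xx y) (at y within {z - 1..z + h + 1})"
        unfolding F_def using that by (intro integral_has_real_derivative xc) auto
      then show ?thesis using at_within_interior[of y "{z - 1..z + h + 1}"] that by simp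
    qed
    have "((\<lambda>y. (F (y + h) - F y) / h) has_real_derivative (xx (z + h) * 1 - xx z) / h) (at z)"
      using h by (intro DERIV_cdivide DERIV_diff DERIV_chain2[OF Fd] Fd) (auto intro!: derivative_eq_intros)
    then have "((\<lambda>y. (F (y + h) - F y) / h) has_real_derivative xh' z) (at z)" by (simp add: xh'_def)
    then show ?thesis
    proof (rule has_field_derivative_transform_within_open[where S = "{z - 1<..}"])
      show "(F (y + h) - F y) / h = xh y" if "y \<in> {z - 1<..}" for y
      proof -
        have "F y + integral {y..y + h} xx = F (y + h)"
          unfolding F_def using that h by (intro Henstock_Kurzweil_Integration.integral_combine integrable_continuous_real xc) auto
        then show ?thesis by (simp add: xh_def)
      qed
    qed auto
  qed
  show "continuous_on UNIV xh'" unfolding xh'_def using h by (intro continuous_intros) auto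
  show p: "0 \<le> xh' z" for z using h xx_mono[of z "z + h"] by (simp add: xh'_def)
  show p2: "xh' z \<le> 2" for z using h xx_lip[of z "z + h"] by (simp add: xh'_def divide_le_eq)
  have near: "\<bar>xh z - xx z\<bar> \<le> 2 * h" for z
  proof -
    have "integral {z..z + h} (\<lambda>_. xx z) \<le> integral {z..z + h} xx"
      by (intro integral_le integrable_continuous_real xc continuous_intros) (auto intro: xx_mono)
    moreover have "integral {z..z + h} xx \<le> integral {z..z + h} (\<lambda>_. xx z + 2 * h)"
    proof (intro integral_le integrable_continuous_real xc continuous_intros)
      show "xx y \<le> xx z + 2 * h" if "y \<in> {z..z + h}" for y using that xx_lip[of z y] by auto
    qed
    ultimately have "xx z * h \<le> integral {z..z + h} xx" "integral {z..z + h} xx \<le> (xx z + 2 * h) * h"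
      using h by (simp_all add: mult.commute)
    then have "xx z \<le> xh z" "xh z \<le> xx z + 2 * h" using h by (simp_all add: xh_def le_divide_eq divide_le_eq)
    then show ?thesis by simp
  qed
  then show "\<bar>xh z - xx z\<bar> \<le> 2 * h" .
  show "char_param f c T (S + 2) xh"
  proof (intro char_param.intro char_param_axioms.intro convex_flux_axioms T_pos)
    fix z z' :: real assume "z \<le> z'"
    then show "xh z \<le> xh z'" using DERIV_nonneg_imp_nondecreasing[of z z' xh] d p by blast
    have "((\<lambda>z. 2 * z - xh z) has_real_derivative 2 - xh' z) (at z)" for z
      by (auto intro!: derivative_eq_intros d)
    then have "2 * z - xh z \<le> 2 * z' - xh z'"
      using DERIV_nonneg_imp_nondecreasing[of z z' "\<lambda>z. 2 * z - xh z"] \<open>z \<le> z'\<close> p2 by (smt (verit, best))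
    then show "xh z' \<le> xh z + 2 * (z' - z)" by simp
  next
    fix z show "\<bar>xh z - z\<bar> \<le> S + 2" using near[of z] xx_near[of z] h by linarith
  qed
qed

text \<open>For a fixed interior time the labels converge by \<open>mono_inverse_tendsto\<close>;
  the common Lipschitz constant 2 then allows \<open>xn n\<close> to be evaluated at the moving
  labels.\<close>

lemma u_approx:
  assumes cp: "\<And>n. char_param f c T S' (xn n)" and lim: "\<And>z. (\<lambda>n. xn n z) \<longlonglongrightarrow> xx z"
    and t: "t \<in> {0<..<T}"
  shows "(\<lambda>n. char_param.u f T (xn n) t y) \<longlonglongrightarrow> u t y"
proof -
  have t01: "t \<in> {0..T}" and ctt: "max 0 (min T t) = t" using t by auto
  define zn where "zn n = char_param.Z T (xn n) t y" for n
  have sl: "(\<lambda>n. char_param.speed T (xn n) z) \<longlonglongrightarrow> speed z" for z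
    unfolding char_param.speed_def[OF cp] speed_def using T_pos by (intro tendsto_intros lim) auto
  have zl: "zn \<longlonglongrightarrow> Z t y"
  proof (rule mono_inverse_tendsto[where G = "\<lambda>n. char_param.X T (xn n) t" and g = "X t" and y = "\<lambda>_. y"])
    show "mono (char_param.X T (xn n) t)" for n by (rule char_param.mono_X[OF cp t01])
    show "(\<lambda>n. char_param.X T (xn n) t z) \<longlonglongrightarrow> X t z" for z
      unfolding char_param.X_def[OF cp] X_def by (intro tendsto_intros lim sl)
    show "char_param.X T (xn n) t (zn n) = y" for n unfolding zn_def by (rule char_param.X_Z[OF cp t01])
    show "(\<lambda>_. y) \<longlonglongrightarrow> X t (Z t y)" using X_Z[OF t01] by simp
    show "mono (X t)" by (rule mono_X[OF t01])
    show "z = Z t y" if "X t z = X t (Z t y)" for z using that Z_X[OF t, of z] X_Z[OF t01, of y] by simp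
  qed
  have "(\<lambda>n. xn n (zn n) - xn n (Z t y)) \<longlonglongrightarrow> 0"
  proof (rule Lim_null_comparison[OF always_eventually, OF allI])
    show "norm (xn n (zn n) - xn n (Z t y)) \<le> 2 * \<bar>zn n - Z t y\<bar>" for n
      using char_param.xx_lipschitz[OF cp] by simp
    show "(\<lambda>n. 2 * \<bar>zn n - Z t y\<bar>) \<longlonglongrightarrow> 0"
      using tendsto_mult_right_zero[OF tendsto_rabs_zero[OF LIM_zero[OF zl]]] .
  qed
  from tendsto_add[OF this lim[of "Z t y"]] have "(\<lambda>n. xn n (zn n)) \<longlonglongrightarrow> xx (Z t y)" by simp
  then have "(\<lambda>n. char_param.speed T (xn n) (zn n)) \<longlonglongrightarrow> speed (Z t y)"
    unfolding char_param.speed_def[OF cp] speed_def using T_pos by (intro tendsto_intros zl) auto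
  moreover have "isCont b (speed (Z t y))"
    using continuous_b[OF continuous_on_id, of UNIV] by (simp add: continuous_on_eq_continuous_at)
  ultimately show ?thesis
    unfolding char_param.u_def[OF cp] u_def ctt zn_def[symmetric] by (intro isCont_tendsto_compose[of _ b])
qed

text \<open>The equality passes from the averaged parametrisations to \<open>xx\<close> itself: the
  approximate solutions converge inside the strip and share the bound \<open>M'\<close>.\<close>

lemma integral_E_eq_0:
  assumes g: "has_C1_grad \<phi> p q" and K: "compact K" "K \<subseteq> {0<..<T} \<times> UNIV" "\<And>z. z \<notin> K \<Longrightarrow> \<phi> z = 0"
  shows "(\<integral>z. E k p q z \<partial>lborel) = 0"
proof -
  define h where "h n = 1 / real (Suc n)" for n
  have h: "0 < h n" "h n \<le> 1" for n by (auto simp: h_def divide_le_eq)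
  have h0: "h \<longlonglongrightarrow> 0" unfolding h_def by (rule LIMSEQ_Suc[OF lim_1_over_n])
  define xn where "xn n z = integral {z..z + h n} xx / h n" for n z
  note av = average_char_param[OF h, folded xn_def]
  have cp: "char_param f c T (S + 2) (xn n)" for n unfolding xn_def by (rule average_char_param(6)[OF h])
  have lim: "(\<lambda>n. xn n z) \<longlonglongrightarrow> xx z" for z
  proof -
    have "(\<lambda>n. xn n z - xx z) \<longlonglongrightarrow> 0"
    proof (rule Lim_null_comparison[OF always_eventually, OF allI])
      show "norm (xn n z - xx z) \<le> 2 * h n" for n unfolding xn_def using average_char_param(5)[OF h] by simp
      show "(\<lambda>n. 2 * h n) \<longlonglongrightarrow> 0" using tendsto_mult_right_zero[OF h0] .
    qed
    then show ?thesis by (rule LIM_zero_cancel)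
  qed
  define H where "H n = char_param.E f T (xn n) k p q" for n
  have Hc: "continuous_on UNIV (H n)" for n unfolding H_def by (rule char_param.continuous_E[OF cp g K])
  have H0: "H n z = 0" if "z \<notin> K" for n z unfolding H_def by (rule char_param.E_eq_0[OF cp g K(1,3) that])
  have Hint: "(\<integral>z. H n z \<partial>lborel) = 0" for n
  proof -
    have i: "integrable (lborel \<Otimes>\<^sub>M lborel) (H n)" by (rule integrable_compact_support_pair[OF Hc K(1) H0])
    have "(\<integral>z. H n z \<partial>lborel) = (\<integral>t. \<integral>y. H n (t, y) \<partial>lborel \<partial>lborel)"
      using lborel_pair.integral_fst[of "\<lambda>t y. H n (t, y)"] i by (simp add: lborel_prod)
    also have "\<dots> = 0"
      unfolding H_def
      by (rule char_param.smooth_entropy_equality[where xx' = "\<lambda>z. (xx (z + h n) - xx z) / h n", OF cp _ _ _ _ g K])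
        (unfold xn_def, use average_char_param(1-4)[OF h] in auto)
    finally show ?thesis .
  qed
  define M' where "M' = char_param.Mu f T (S + 2)"
  have un: "\<bar>char_param.u f T (xn n) t y\<bar> \<le> M'" for n t y unfolding M'_def by (rule char_param.u_bdd[OF cp])
  have c: "continuous_on UNIV p" "continuous_on UNIV q" using g unfolding has_C1_grad_def by auto
  have z0: "p z = 0" "q z = 0" if "z \<notin> K" for z
    using has_C1_grad_eq_0[OF g compact_imp_closed[OF K(1)] K(3) that] by auto
  obtain B where B: "integrable lborel (\<lambda>z. B * indicator K z)"
    "\<And>w z. \<bar>w\<bar> \<le> M' \<Longrightarrow> \<bar>\<bar>w - k\<bar> * p z + sgn (w - k) * (f w - f k) * q z\<bar> \<le> B * indicator K z"
    using kruzkov_integrand_bdd[OF c K(1) z0] by blast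
  have "(\<lambda>n. \<integral>z. H n z \<partial>lborel) \<longlonglongrightarrow> (\<integral>z. E k p q z \<partial>lborel)"
  proof (rule integral_dominated_convergence[where w = "\<lambda>z. B * indicator K z"])
    show "E k p q \<in> borel_measurable lborel" using continuous_E[OF g K] by (simp add: borel_measurable_continuous_onI)
    show "H n \<in> borel_measurable lborel" for n using Hc by (simp add: borel_measurable_continuous_onI)
    show "integrable lborel (\<lambda>z. B * indicator K z)" by (rule B(1))
    show "AE z in lborel. (\<lambda>n. H n z) \<longlonglongrightarrow> E k p q z"
    proof (rule AE_I2)
      fix z
      show "(\<lambda>n. H n z) \<longlonglongrightarrow> E k p q z"
      proof (cases "z \<in> K")
        case True
        then have "fst z \<in> {0<..<T}" using K(2) by auto
        from u_approx[OF cp lim this] have l: "(\<lambda>n. char_param.u f T (xn n) (fst z) (snd z)) \<longlonglongrightarrow> u (fst z) (snd z)" .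
        have s: "(\<lambda>n. sgn (char_param.u f T (xn n) (fst z) (snd z) - k) * (f (char_param.u f T (xn n) (fst z) (snd z)) - f k))
            \<longlonglongrightarrow> sgn (u (fst z) (snd z) - k) * (f (u (fst z) (snd z)) - f k)"
          using continuous_on_tendsto_compose[OF continuous_kruzkov_flux[of UNIV k] l] by simp
        show ?thesis unfolding H_def char_param.E_def[OF cp] E_def
          by (intro tendsto_add tendsto_mult[OF s tendsto_const] tendsto_mult[OF _ tendsto_const]
              tendsto_rabs tendsto_diff l tendsto_const)
      qed (simp add: H0 E_eq_0[OF g K(1,3)])
    qed
    show "AE z in lborel. norm (H n z) \<le> B * indicator K z" for n
      unfolding H_def char_param.E_def[OF cp] real_norm_def by (intro AE_I2 B(2) un)
  qed
  then show ?thesis unfolding Hint by (simp add: LIMSEQ_const_iff)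
qed

end

section \<open>The main result\<close>

context char_param
begin

text \<open>Slices converge at every \<open>x\<close> that has a unique label, hence almost
  everywhere, at the end times as well; dominated convergence turns this into L^1 convergence on
  compact sets.\<close>

lemma u_in_C0_L1loc: "u \<in> C0_L1loc T"
  unfolding C0_L1loc_def
proof (intro CollectI conjI ballI allI impI)
  fix t show "u t \<in> borel_measurable lebesgue"
    using measurable_u by (intro measurable_completion) simp
next
  fix t and K :: "real set" assume K: "compact K"
  have Ks: "K \<in> sets borel" using K by (simp add: borel_closed compact_imp_closed)
  have "integrable lborel (\<lambda>x. indicator K x *\<^sub>R u t x)"
  proof (rule Bochner_Integration.integrable_bound[of lborel "\<lambda>x. Mu * indicator K x"])
    show "integrable lborel (\<lambda>x. Mu * indicator K x)"
      using emeasure_compact_finite[OF K] Ks by (intro integrable_mult_right integrable_real_indicator) (auto simp: less_top)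
    show "(\<lambda>x. indicator K x *\<^sub>R u t x) \<in> borel_measurable lborel"
      using Ks measurable_u[of t] by simp
    show "AE x in lborel. norm (indicator K x *\<^sub>R u t x) \<le> norm (Mu * indicator K x)"
      using u_bdd[of t] by (intro AE_I2) (auto simp: indicator_def intro: order_trans[OF _ abs_ge_self])
  qed
  then show "set_integrable lebesgue K (u t)"
    unfolding set_integrable_def by (rule integrable_completion[THEN iffD2, rotated]) (use Ks measurable_u[of t] in simp)
next
  fix s and K :: "real set" assume s: "s \<in> {0..T}" and K: "compact K"
  have Ks [measurable]: "K \<in> sets borel" using K by (simp add: borel_closed compact_imp_closed)
  note measurable_u [measurable]
  obtain R where R: "\<And>x. x \<in> K \<Longrightarrow> \<bar>x\<bar> \<le> R"
    using compact_imp_bounded[OF K] unfolding bounded_iff by (auto simp: real_norm_def)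
  show "((\<lambda>t. LINT x:K|lebesgue. \<bar>u t x - u s x\<bar>) \<longlongrightarrow> 0) (at s within {0..T})"
    unfolding tendsto_at_iff_sequentially comp_def
  proof (intro allI impI)
    fix t :: "nat \<Rightarrow> real" assume t: "\<forall>i. t i \<in> {0..T} - {s}" "t \<longlonglongrightarrow> s"
    have eq: "(LINT x:K|lebesgue. \<bar>u (t n) x - u s x\<bar>) = (\<integral>x. indicator K x * \<bar>u (t n) x - u s x\<bar> \<partial>lborel)" for n
      unfolding set_lebesgue_integral_def real_scaleR_def by (rule integral_completion) measurable
    have "(\<lambda>n. \<integral>x. indicator K x * \<bar>u (t n) x - u s x\<bar> \<partial>lborel) \<longlonglongrightarrow> (\<integral>x. (0::real) \<partial>(lborel :: real measure))"
    proof (rule integral_tendsto_bounded_support[where g = "\<lambda>n x. indicator K x * \<bar>u (t n) x - u s x\<bar>"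
          and h = "\<lambda>_. 0" and B = "2 * Mu" and R = R])
      show "\<bar>indicator K x * \<bar>u (t n) x - u s x\<bar>\<bar> \<le> 2 * Mu" for n x
        using u_bdd[of "t n" x] u_bdd[of s x] by (auto simp: indicator_def)
      show "indicator K x * \<bar>u (t n) x - u s x\<bar> = 0" if "R < \<bar>x\<bar>" for n x
        using R[of x] that by (auto simp: indicator_def)
      have cs: "max 0 (min T s) = s" using s by auto
      show "AE x in lborel. (\<lambda>n. indicator K x * \<bar>u (t n) x - u s x\<bar>) \<longlonglongrightarrow> 0"
        using AE_unique_Z[OF s]
      proof eventually_elim
        case (elim x)
        then have "(\<lambda>n. u (t n) x) \<longlonglongrightarrow> u s x"
          by (intro u_tendsto t(2) tendsto_const) (simp add: cs)
        then show ?case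
          by (intro tendsto_mult_right_zero tendsto_rabs_zero LIM_zero)
      qed
    qed measurable
    then show "(\<lambda>n. LINT x:K|lebesgue. \<bar>u (t n) x - u s x\<bar>) \<longlonglongrightarrow> 0" unfolding eq by simp
  qed
qed

text \<open>Continuity in the open strip, and no dependence on time before and after it.\<close>

lemma measurable_u_pair: "(\<lambda>z. u (fst z) (snd z)) \<in> borel_measurable borel"
proof -
  let ?\<Omega> = "{0<..<T} \<times> (UNIV :: real set)"
  have o: "open ?\<Omega>" by (intro open_Times) auto
  have m: "(\<lambda>z. u s (snd z)) \<in> borel_measurable (borel :: (real \<times> real) measure)" for s
    using measurable_compose[OF borel_measurable_continuous_onI[OF continuous_on_snd[OF continuous_on_id]] measurable_u] .
  have \<Omega>: "(\<lambda>z. indicator ?\<Omega> z *\<^sub>R u (fst z) (snd z)) \<in> borel_measurable borel"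
    using borel_measurable_continuous_on_indicator[OF borel_open[OF o] continuous_u] .
  have "u (fst z) (snd z) = (if fst z \<le> 0 then u 0 (snd z) else if T \<le> fst z then u T (snd z)
      else indicator ?\<Omega> z *\<^sub>R u (fst z) (snd z))" for z
  proof -
    have "max 0 (min T t) = 0" if "t \<le> 0" for t using that T_pos by simp
    moreover have "max 0 (min T t) = T" if "T \<le> t" for t using that T_pos by simp
    ultimately show ?thesis using T_pos by (cases z) (auto simp: u_def)
  qed
  then have "(\<lambda>z. u (fst z) (snd z)) = (\<lambda>z. if fst z \<le> 0 then u 0 (snd z) else if T \<le> fst z then u T (snd z)
      else indicator ?\<Omega> z *\<^sub>R u (fst z) (snd z))" by (rule ext)
  moreover have "\<dots> \<in> borel_measurable borel"
  proof (intro measurable_If m \<Omega>)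
    have c: "continuous_on UNIV (fst :: real \<times> real \<Rightarrow> real)" by (intro continuous_intros)
    have "closed {z :: real \<times> real. fst z \<le> 0}" "closed {z :: real \<times> real. T \<le> fst z}"
      using c by (auto intro!: closed_Collect_le continuous_intros)
    then show "{z \<in> space borel. fst z \<le> (0::real)} \<in> sets (borel :: (real \<times> real) measure)"
      "{z \<in> space borel. T \<le> fst z} \<in> sets (borel :: (real \<times> real) measure)" by (auto simp: borel_closed)
  qed
  ultimately show ?thesis by simp
qed

lemma weak_entropy_solution_u: "weak_entropy_solution f T u"
  unfolding weak_entropy_solution_def
proof (intro conjI allI ballI impI)
  let ?S = "{0..T} \<times> (UNIV :: real set)"
  have "closed ?S" by (intro closed_Times) auto
  then have S: "?S \<in> sets lebesgue" by auto
  have um: "(\<lambda>z. u (fst z) (snd z)) \<in> borel_measurable (lebesgue_on ?S)"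
    using measurable_u_pair by (intro measurable_restrict_space1 measurable_completion) simp
  then show "(\<lambda>(t, x). u t x) \<in> Linf (lebesgue_on ?S)"
    unfolding Linf_def using u_bdd by (auto simp: split_beta' intro!: exI[of _ Mu])
  show "u \<in> C0_L1loc T" by (rule u_in_C0_L1loc)
  fix k and \<phi> :: "real \<times> real \<Rightarrow> real" assume "\<phi> \<in> C1c ({0<..<T} \<times> UNIV)"
  then obtain p q K where g: "has_C1_grad \<phi> p q" and K: "compact K" "K \<subseteq> {0<..<T} \<times> UNIV" "\<And>z. z \<notin> K \<Longrightarrow> \<phi> z = 0"
    unfolding C1c_iff_grad by blast
  have "(LINT (t, x)|lebesgue_on ?S. \<bar>u t x - k\<bar> * deriv (\<lambda>s. \<phi> (s, x)) t
              + sgn (u t x - k) * (f (u t x) - f k) * deriv (\<lambda>y. \<phi> (t, y)) x)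
      = (LINT z|lebesgue_on ?S. E k p q z)"
    unfolding DERIV_imp_deriv[OF has_C1_grad_partials(1)[OF g]] DERIV_imp_deriv[OF has_C1_grad_partials(2)[OF g]]
    by (simp add: E_def split_beta')
  also have "\<dots> = (LINT z|lebesgue. (if z \<in> ?S then E k p q z else 0))"
    by (rule Lebesgue_Measure.integral_restrict_UNIV[OF S, symmetric])
  also have "\<dots> = (LINT z|lebesgue. E k p q z)"
  proof (rule Bochner_Integration.integral_cong[OF refl])
    fix z :: "real \<times> real"
    have "z \<notin> K" if "z \<notin> ?S" using that K(2) by auto
    then show "(if z \<in> ?S then E k p q z else 0) = E k p q z" using E_eq_0[OF g K(1,3)] by auto
  qed
  also have "\<dots> = (LINT z|lborel. E k p q z)"
    using continuous_E[OF g K] by (intro integral_completion) (simp add: borel_measurable_continuous_onI)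
  also have "\<dots> = 0" by (rule integral_E_eq_0[OF g K])
  finally show "0 \<le> (LINT (t, x)|lebesgue_on ?S. \<bar>u t x - k\<bar> * deriv (\<lambda>s. \<phi> (s, x)) t
              + sgn (u t x - k) * (f (u t x) - f k) * deriv (\<lambda>y. \<phi> (t, y)) x)" by simp
qed

end

section \<open>Reconstruction of a solution from its backward characteristic map\<close>

context convex_flux
begin

text \<open>\<open>x + p x\<close> is twice the midpoint of the line from \<open>p x\<close> at time
  0 to \<open>x\<close> at time \<open>T\<close>, and \<open>xx\<close> is the generalised inverse
  of the midpoint map. As \<open>x + p x\<close> grows at least as fast as \<open>x\<close>, this
  inverse has slope at most 2. Jumps of \<open>p\<close> become flat pieces of \<open>xx\<close>,
  where characteristics focus at time \<open>T\<close>; flat pieces of \<open>p\<close> become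
  pieces of slope 2, fans that leave one point at time 0.\<close>

lemma backward_solution:
  assumes T: "0 < T" and p: "mono p" "\<And>x. \<bar>x - p x\<bar> \<le> S"
  shows "\<exists>u M. weak_entropy_solution f T u \<and> (\<forall>t x. \<bar>u t x\<bar> \<le> M) \<and> (\<forall>t. u t \<in> borel_measurable borel)
    \<and> (AE x in lborel. u T x = b ((x - p x) / T))"
proof -
  define A where "A z = {x. x + p x \<le> 2 * z}" for z
  define xx where "xx z = Sup (A z)" for z
  have S: "0 \<le> S" using p(2)[of 0] by linarith
  \<comment> \<open>\<open>x + p x\<close> differs from \<open>2 * x\<close> by at most
    \<open>S\<close>, which places \<open>xx z\<close> within \<open>S / 2\<close> of
    \<open>z\<close>.\<close>
  have ne: "z - S / 2 \<in> A z" for z using p(2)[of "z - S / 2"] by (auto simp: A_def)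
  have ub: "x \<le> z + S / 2" if "x \<in> A z" for x z using p(2)[of x] that by (auto simp: A_def)
  have bd: "bdd_above (A z)" for z using ub by (intro bdd_aboveI) auto
  have "char_param f c T S xx"
  proof (intro char_param.intro char_param_axioms.intro convex_flux_axioms T)
    fix z z' :: real assume z: "z \<le> z'"
    show "xx z \<le> xx z'" unfolding xx_def
    proof (rule cSup_subset_mono[OF _ bd])
      show "A z \<noteq> {}" using ne by blast
      show "A z \<subseteq> A z'" using z by (auto simp: A_def)
    qed
    show "xx z' \<le> xx z + 2 * (z' - z)"
      unfolding xx_def[of z']
    proof (rule cSup_least)
      fix x assume x: "x \<in> A z'"
      have "p (x - 2 * (z' - z)) \<le> p x" using z by (intro monoD[OF p(1)]) simp
      then have "x - 2 * (z' - z) \<in> A z" using x by (simp add: A_def)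
      then have "x - 2 * (z' - z) \<le> xx z" unfolding xx_def by (rule cSup_upper[OF _ bd])
      then show "x \<le> xx z + 2 * (z' - z)" by simp
    qed (use ne in blast)
  next
    fix z
    have "z - S / 2 \<le> xx z" unfolding xx_def by (rule cSup_upper[OF ne bd])
    moreover have "xx z \<le> z + S / 2" unfolding xx_def by (rule cSup_least) (use ne ub in auto)
    ultimately show "\<bar>xx z - z\<bar> \<le> S" using S by (auto simp: abs_le_iff)
  qed
  then interpret char_param f c T S xx .
  \<comment> \<open>At the midpoint of an actual line the supremum is attained, and the inverse is
    exact.\<close>
  have xxm: "xx ((x + p x) / 2) = x" for x
    unfolding xx_def
  proof (rule cSup_eq_maximum)
    fix x' assume "x' \<in> A ((x + p x) / 2)"
    then show "x' \<le> x" using monoD[OF p(1), of x x'] by (cases "x \<le> x'") (auto simp: A_def)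
  qed (simp add: A_def)
  have "AE x in lborel. u T x = b ((x - p x) / T)"
  proof -
    have "T \<in> {0..T}" using T by simp
    from AE_unique_Z[OF this] show ?thesis
  proof eventually_elim
    case (elim x)
    have XT: "X T z = xx z" for z using T by (simp add: X_def speed_def)
    then have Zx: "Z T x = (x + p x) / 2" using elim xxm[of x] by metis
    have "2 * (x - (x + p x) / 2) = x - p x" by (simp add: field_simps)
    then have sx: "speed ((x + p x) / 2) = (x - p x) / T" unfolding speed_def xxm by simp
    have "max 0 (min T T) = T" using T by simp
    then show ?case unfolding u_def by (simp only: Zx sx)
  qed
  qed
  then show ?thesis using weak_entropy_solution_u u_bdd measurable_u by blast
qed

end

lemma oleinik_iff_mono:
  fixes g :: "real \<Rightarrow> real"
  assumes "0 < T"
  shows "(\<forall>x. \<forall>y>0. g (x + y) - g x \<le> y / T) \<longleftrightarrow> (\<forall>x. \<forall>y>0. x - T * g x \<le> (x + y) - T * g (x + y))"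
proof -
  have "g (x + y) - g x \<le> y / T \<longleftrightarrow> x - T * g x \<le> (x + y) - T * g (x + y)" for x y
  proof -
    have "g (x + y) - g x \<le> y / T \<longleftrightarrow> (g (x + y) - g x) * T \<le> y" using assms by (rule pos_le_divide_eq)
    also have "\<dots> \<longleftrightarrow> x - T * g x \<le> (x + y) - T * g (x + y)" by (auto simp: algebra_simps)
    finally show ?thesis .
  qed
  then show ?thesis by simp
qed

theorem corollary3p2:
  fixes f :: "real \<Rightarrow> real" and c T :: real and w :: "real \<Rightarrow> real"
  assumes "C2 f"
    and "c > 0" and "\<forall>x. deriv (deriv f) x \<ge> c"
    and "f 0 = 0" and "\<forall>x. f 0 \<le> f x"
    and "T > 0"
    and "w \<in> Linf lebesgue"
  shows "(ICL f T w \<noteq> {} \<longleftrightarrow>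
           (\<exists>v. (AE x in lebesgue. v x = w x) \<and>
                (\<forall>x. \<forall>y>0. deriv f (v (x + y)) - deriv f (v x) \<le> y / T))) \<and>
         (\<forall>v. (AE x in lebesgue. v x = w x) \<longrightarrow>
           ((\<forall>x. \<forall>y>0. deriv f (v (x + y)) - deriv f (v x) \<le> y / T) \<longleftrightarrow>
            (let p = (\<lambda>x. x - T * deriv f (v x)) in \<forall>x. \<forall>y>0. p x \<le> p (x + y))))"
proof (intro conjI iffI)
  interpret convex_flux f c by unfold_locales (use assms in auto)
  have T: "0 < T" by fact
  show "\<forall>v. (AE x in lebesgue. v x = w x) \<longrightarrow>
           ((\<forall>x. \<forall>y>0. deriv f (v (x + y)) - deriv f (v x) \<le> y / T) \<longleftrightarrow>
            (let p = (\<lambda>x. x - T * deriv f (v x)) in \<forall>x. \<forall>y>0. p x \<le> p (x + y)))"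
    unfolding Let_def
  proof (intro allI impI)
    fix v
    show "(\<forall>x. \<forall>y>0. deriv f (v (x + y)) - deriv f (v x) \<le> y / T) \<longleftrightarrow>
        (\<forall>x. \<forall>y>0. x - T * deriv f (v x) \<le> x + y - T * deriv f (v (x + y)))"
      by (rule oleinik_iff_mono[OF T, of "\<lambda>x. deriv f (v x)"])
  qed
  have T0: "0 \<in> {0..T}" "T \<in> {0..T}" using T by auto
  show "\<exists>v. (AE x in lebesgue. v x = w x) \<and> (\<forall>x. \<forall>y>0. deriv f (v (x + y)) - deriv f (v x) \<le> y / T)"
    if ne: "ICL f T w \<noteq> {}"
  proof -
    obtain uo where "SCL f T T uo w" using ne unfolding ICL_def by blast
    then obtain u where sol: "weak_entropy_solution f T u" and uT: "AE x in lborel. u T x = w x"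
      unfolding SCL_def weak_entropy_solution_from_def AE_lborel_completion by blast
    obtain u' M where s: "entropy_slices f c u' M T" and u': "\<And>t. t \<in> {0..T} \<Longrightarrow> AE x in lborel. u' t x = u t x"
      using solution_slices[OF sol T] by blast
    obtain v where v: "AE x in lborel. u' T x = v x" "\<forall>x. \<forall>y>0. deriv f (v (x + y)) - deriv f (v x) \<le> y / T"
      using entropy_slices.oleinik[OF s] by blast
    have "AE x in lebesgue. v x = w x"
      unfolding AE_lborel_completion using v(1) u'[OF T0(2)] uT by eventually_elim simp
    then show ?thesis using v(2) by blast
  qed
  show "ICL f T w \<noteq> {}"
    if ex: "\<exists>v. (AE x in lebesgue. v x = w x) \<and> (\<forall>x. \<forall>y>0. deriv f (v (x + y)) - deriv f (v x) \<le> y / T)"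
  proof -
    obtain v where vw: "AE x in lborel. v x = w x"
      and ol: "\<forall>x. \<forall>y>0. deriv f (v (x + y)) - deriv f (v x) \<le> y / T"
      using ex unfolding AE_lborel_completion by blast
    define p where "p x = x - T * deriv f (v x)" for x
    have mono: "mono p"
    proof (rule monoI)
      fix x y :: real assume "x \<le> y"
      then show "p x \<le> p y"
        using ol[unfolded oleinik_iff_mono[OF T, of "\<lambda>x. deriv f (v x)"], rule_format, of "y - x" x]
        by (cases "x = y") (auto simp: p_def)
    qed
    obtain C where "AE x in lborel. \<bar>w x\<bar> \<le> C"
      using assms(7) unfolding Linf_def AE_lborel_completion by blast
    obtain \<Lambda> where \<Lambda>: "0 < \<Lambda>" "\<And>x. \<bar>x\<bar> \<le> C \<Longrightarrow> \<bar>deriv f x\<bar> \<le> \<Lambda>" using f'_bdd by blast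
    \<comment> \<open>\<open>w\<close> is bounded almost everywhere, but the representative
      \<open>v\<close> is not yet known to be bounded at every point. Monotonicity of
      \<open>p\<close> extends the bound to all \<open>x\<close>, from good points at distance less
      than \<open>e\<close> on either side.\<close>
    have ae: "AE x in lborel. \<bar>x - p x\<bar> \<le> T * \<Lambda>"
      using vw \<open>AE x in lborel. \<bar>w x\<bar> \<le> C\<close>
    proof eventually_elim
      case (elim x)
      then have "\<bar>deriv f (v x)\<bar> \<le> \<Lambda>" by (intro \<Lambda>(2)) simp
      then show ?case using T by (simp add: p_def abs_mult)
    qed
    have near: "\<bar>x - p x\<bar> \<le> T * \<Lambda>" for x
    proof (rule field_le_epsilon)
      fix e :: real assume e: "0 < e"
      obtain l where l: "l \<in> {x - e<..<x}" "\<bar>l - p l\<bar> \<le> T * \<Lambda>" using AE_lborel_ex_in_interval[OF ae, of "x - e" x] e by auto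
      obtain r where r: "r \<in> {x<..<x + e}" "\<bar>r - p r\<bar> \<le> T * \<Lambda>" using AE_lborel_ex_in_interval[OF ae, of x "x + e"] e by auto
      have "p l \<le> p x" "p x \<le> p r" using l r by (auto intro!: monoD[OF mono])
      then show "\<bar>x - p x\<bar> \<le> T * \<Lambda> + e" using l r by (auto simp: abs_le_iff)
    qed
    obtain u M where sol: "weak_entropy_solution f T u" and ub: "\<And>t x. \<bar>u t x\<bar> \<le> M"
      and um: "\<And>t. u t \<in> borel_measurable borel" and uT: "AE x in lborel. u T x = b ((x - p x) / T)"
      using backward_solution[OF T mono near] by blast
    have bv: "b ((x - p x) / T) = v x" for x using T by (simp add: p_def)
    have uTw: "AE x in lborel. u T x = w x" using uT vw by eventually_elim (simp add: bv)
    obtain u1 M1 where s1: "entropy_slices f c u1 M1 T" and u1: "\<And>t. t \<in> {0..T} \<Longrightarrow> AE x in lborel. u1 t x = u t x"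
      using solution_slices[OF sol T] by blast
    \<comment> \<open>The datum is the value at time 0 of the constructed solution; uniqueness at
      time \<open>T\<close> gives every other solution from it the same value
      \<open>w\<close>.\<close>
    have "SCL f T T (u 0) w"
      unfolding SCL_def
    proof (intro conjI allI impI)
      show "\<exists>u'. weak_entropy_solution_from f T (u 0) u'"
        using sol unfolding weak_entropy_solution_from_def by auto
      fix u' assume u': "weak_entropy_solution_from f T (u 0) u'"
      then have sol': "weak_entropy_solution f T u'" and u'0: "AE x in lborel. u' 0 x = u 0 x"
        unfolding weak_entropy_solution_from_def AE_lborel_completion by auto
      obtain u2 M2 where s2: "entropy_slices f c u2 M2 T" and u2: "\<And>t. t \<in> {0..T} \<Longrightarrow> AE x in lborel. u2 t x = u' t x"
        using solution_slices[OF sol' T] by blast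
      have "AE x in lborel. u2 0 x = u1 0 x"
        using u2[OF T0(1)] u1[OF T0(1)] u'0 by eventually_elim simp
      then have "AE x in lborel. u2 T x = u1 T x" by (rule entropy_slices_unique[OF s2 s1])
      then show "AE x in lebesgue. u' T x = w x"
        unfolding AE_lborel_completion using u2[OF T0(2)] u1[OF T0(2)] uTw by eventually_elim simp
    qed
    moreover have "u 0 \<in> Linf lebesgue"
      unfolding Linf_def using um ub by (auto intro!: measurable_completion exI[of _ M])
    ultimately show ?thesis unfolding ICL_def by blast
  qed
qed

end
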